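(* Fix $\Delta>0$ and $g>0$. Then there is an exceptional set of integers $n$ containing at most $O(N^{3/4+o(1)})$ elements $n\le N$ (as $N\to\infty$) such that for every positive integer $n$ outside this set, the following holds: the open interval $(n,n+1)$ contains exactly two elements of one of the shifted parity spectra $\mathcal X^{+}$, $\mathcal X^{-}$ and no element of the other; each of the adjacent intervals $(n-1,n)$ and $(n+1,n+2)$ contains exactly two elements of that other shifted parity spectrum and no element of the first one; and none of $n-1,n,n+1$ belongs to $\mathcal X^+\cup\mathcal X^-$. In particular, for all but $O(N^{3/4+o(1)})$ integers $n\le N$, the interval $[n,n+1]$ contains exactly two elements of $\mathcal X^+\cup\mathcal X^-$.
   Context: The quantum Rabi model is the Hamiltonian $H=a^\dagger a+\Delta\sigma_z+g\sigma_x(a+a^\dagger)$ acting on $L^2(\mathbb R)\otimes\mathbb C^2$, where $a^\dagger,a$ are the creation and annihilation operators of the harmonic oscillator (frequency $1$), $\sigma_x=\begin{pmatrix}0&1\\1&0\end{pmatrix}$, $\sigma_z=\begin{pmatrix}1&0\\0&-1\end{pmatrix}$, $\Delta>0$ and $g>0$. $H$ commutes with the parity operator $P=(-1)^{a^\dagger a}\sigma_z$, and on each of the $\pm1$-eigenspaces of $P$ it is unitarily equivalent to the Jacobi matrix (indices $k\ge0$) with diagonal entries $d_\pm(k)=k\pm(-1)^k\Delta$ and off-diagonal entries $a(k)=g\sqrt k$ in positions $(k-1,k)$ and $(k,k-1)$, $k\ge1$. The spectrum in each parity class $\pm$ is discrete and simple; its eigenvalues are labeled in increasing order $E^\pm_n$,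 with the indexing normalized so that $E^\pm_n=n-g^2+o(1)$ as $n\to\infty$. The shifted eigenvalues are $x_n^\pm=E_n^\pm+g^2$ and the shifted parity spectra are $\mathcal X^\pm=\{x_n^\pm\}$. (Known background: Boutet de Monvel and Zielinski proved $E_n^\pm=n-g^2\mp\frac{\Delta}{\sqrt{2\pi g}}\frac{(-1)^n\cos(4g\sqrt n-\pi/4)}{n^{1/4}}+O(n^{-1/2+o(1)})$.) *)

theory Defs
  imports "HOL-Analysis.Analysis" "HOL-Library.Landau_Symbols"
begin

text \<open>Jacobi matrix of the parity class with sign s (s = 1 for +, s = -1 for -):
  diagonal d(k) = k + s (-1)^k Delta, off-diagonal a(k) = g sqrt k (k >= 1).\<close>

definition rabi_diag :: "real \<Rightarrow> real \<Rightarrow> nat \<Rightarrow> real" where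
  "rabi_diag s \<Delta> k = real k + s * (-1) ^ k * \<Delta>"

definition rabi_off :: "real \<Rightarrow> nat \<Rightarrow> real" where
  "rabi_off g k = g * sqrt (real k)"

definition rabi_jacobi_apply :: "real \<Rightarrow> real \<Rightarrow> real \<Rightarrow> (nat \<Rightarrow> real) \<Rightarrow> nat \<Rightarrow> real" where
  "rabi_jacobi_apply s \<Delta> g u k =
     (if k = 0 then 0 else rabi_off g k * u (k - 1))
     + rabi_diag s \<Delta> k * u k
     + rabi_off g (Suc k) * u (Suc k)"

text \<open>E is an eigenvalue of the (self-adjoint, by Carleman's condition) Jacobi operator
  on l^2(N): there is a nonzero square-summable eigenvector.\<close>
definition rabi_eigenvalue :: "real \<Rightarrow> real \<Rightarrow> real \<Rightarrow> real \<Rightarrow> bool" where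
  "rabi_eigenvalue s \<Delta> g E \<longleftrightarrow>
     (\<exists>u. u \<noteq> (\<lambda>_. 0) \<and> summable (\<lambda>k. (u k)\<^sup>2) \<and>
          (\<forall>k. rabi_jacobi_apply s \<Delta> g u k = E * u k))"

definition shifted_spectrum :: "real \<Rightarrow> real \<Rightarrow> real \<Rightarrow> real set" where
  "shifted_spectrum s \<Delta> g = {E + g\<^sup>2 | E. rabi_eigenvalue s \<Delta> g E}"

definition two_pattern :: "real set \<Rightarrow> real set \<Rightarrow> real \<Rightarrow> bool" where
  "two_pattern X Y n \<longleftrightarrow>
     card (X \<inter> {n<..<n+1}) = 2 \<and> Y \<inter> {n<..<n+1} = {} \<and>
     card (Y \<inter> {n-1<..<n}) = 2 \<and> X \<inter> {n-1<..<n} = {} \<and>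
     card (Y \<inter> {n+1<..<n+2}) = 2 \<and> X \<inter> {n+1<..<n+2} = {}"

end

theory Submission
  imports Defs "HOL-Real_Asymp.Real_Asymp"
begin

text \<open>
  For $\Delta = 0$ the Jacobi matrix is a displaced harmonic oscillator with eigenvalues
  $n - g^2$; its eigenvectors, the displaced number states, form an orthonormal basis. In that basis
  the perturbation $\pm\Delta(-1)^k$ becomes $\pm\Delta (-1)^m D_{jm}$, where $D$ is again a matrix
  of displaced number states, now with displacement $2g$. An energy argument for the three-term
  recurrence shows that $D_{jm}^2 + D_{j,m-1}^2$ is comparable to $j^{-1/2}$ as long as
  $|m - j| \le 3g\sqrt j$. Hence the perturbation is small near the diagonal, and for large $n$ there
  is exactly one shifted eigenvalue within $1/2$ of $n$, at
  $n \pm \Delta (-1)^n D_{nn} + O(n^{-1/2}\log n)$.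

  Outside the exceptional set $|D_{nn}|$ exceeds a multiple of $n^{-1/2}\log n$. There $D_{nn}$ has
  constant sign on consecutive $n$, so the eigenvalues alternate sides of the integers, oppositely for
  the two parities. When $D_{nn}$ is small, its increment $2g D_{n,n+1}/\sqrt{n+1}$ is of exact order
  $n^{-3/4}$ and keeps its sign for about $\sqrt n$ steps. Every block of about $\sqrt n$ integers
  thus contains $O(n^{1/4}\log n)$ exceptional ones.
\<close>

section \<open>Displaced number states and orthogonal matrices\<close>

text \<open>The scales come from perturbation theory. Near the diagonal the perturbation has entries
  of size n^(-1/4), so the first-order shift is typically of that size, while the second-order error
  is (n^(-1/4))^2 times a harmonic sum, that is n^(-1/2) log n. This error is the threshold for
  |D_nn|, and only near-zeros of D_nn can spoil the pattern. They are counted from sizes alone: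
  where D_nn is small, the lower bound for the pair forces its neighbour D_{n,n+1} to be of order
  n^(-1/4). The window of the energy argument is constrained from both sides. With \<beta> = 2g the
  energy is definite only for |m-j| below about 2 \<beta> sqrt j, whereas the state has variance
  about 2 \<beta>^2 j, so Chebyshev's inequality finds mass only in windows wider than sqrt 2
  \<beta> sqrt j. The factor 3/2 lies between. The Jacobi matrix is unbounded and enters only
  through its square-summable solutions, tested against rapidly decaying vectors. An eigenvalue near
  each large n is produced by a contraction; it is unique because two eigenvectors concentrated at
  the same n cannot be orthogonal.\<close>

text \<open>
  The vacuum displaced by $-\beta$, raised by $(a^\dagger + \beta)/\sqrt{m+1}$. At $k = 0$ the junk
  value \<open>disp \<beta> m (0 - 1)\<close> is multiplied by $\sqrt 0$.
\<close>

primrec disp :: "real \<Rightarrow> nat \<Rightarrow> nat \<Rightarrow> real" where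
  "disp \<beta> 0 = (\<lambda>k. exp (- (\<beta>\<^sup>2) / 2) * (- \<beta>) ^ k / sqrt (fact k))"
| "disp \<beta> (Suc m) =
     (\<lambda>k. (sqrt (real k) * disp \<beta> m (k - 1) + \<beta> * disp \<beta> m k) / sqrt (real (Suc m)))"

lemma disp_raise:
  "sqrt (real (Suc m)) * disp \<beta> (Suc m) k = sqrt (real k) * disp \<beta> m (k - 1) + \<beta> * disp \<beta> m k"
  by simp

lemma disp_raise':
  "sqrt (real m) * disp \<beta> m k
     = (if m = 0 then 0 else sqrt (real k) * disp \<beta> (m - 1) (k - 1) + \<beta> * disp \<beta> (m - 1) k)"
  by (cases m) (use disp_raise[of "m - 1" \<beta> k] in \<open>simp_all del: disp.simps\<close>)

lemma sqrt_mult_self_mult: "sqrt (real k) * (sqrt (real k) * x) = real k * x"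
  by (simp add: mult.assoc[symmetric])

text \<open>The operator a + \<beta> lowers the displaced states because a and a^+ commute up to 1;
  in the induction the isolated term \<open>?f k\<close> is this commutator and turns m into m + 1.
  At m = 0 the junk index m - 1 is multiplied by sqrt 0.\<close>

lemma disp_lower:
  "sqrt (real (Suc k)) * disp \<beta> m (Suc k) + \<beta> * disp \<beta> m k = sqrt (real m) * disp \<beta> (m - 1) k"
proof (induction m arbitrary: k)
  case 0
  have "sqrt (fact (Suc k)) = sqrt (real (Suc k)) * sqrt (fact k)"
    by (simp only: fact_Suc of_nat_mult real_sqrt_mult)
  then show ?case
    by (simp add: field_simps del: fact_Suc of_nat_Suc)
next
  case (Suc m)
  let ?f = "disp \<beta> m"
  have IH: "sqrt (real (Suc k)) * ?f (Suc k) + \<beta> * ?f k = sqrt (real m) * disp \<beta> (m - 1) k" for k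
    by (rule Suc)
  have lo: "real k * ?f k + \<beta> * (sqrt (real k) * ?f (k - 1))
      = sqrt (real m) * (sqrt (real k) * disp \<beta> (m - 1) (k - 1))"
  proof (cases k)
    case (Suc l)
    have "sqrt (real k) * (sqrt (real (Suc l)) * ?f (Suc l) + \<beta> * ?f l)
        = sqrt (real k) * (sqrt (real m) * disp \<beta> (m - 1) l)"
      using IH[of l] by simp
    then show ?thesis
      unfolding Suc distrib_left sqrt_mult_self_mult by (simp add: algebra_simps)
  qed simp
  have up: "sqrt (real m) * (sqrt (real k) * disp \<beta> (m - 1) (k - 1)) + \<beta> * (sqrt (real m) * disp \<beta> (m - 1) k)
      = real m * ?f k"
  proof -
    have "sqrt (real m) * (sqrt (real m) * ?f k) = sqrt (real m) *
      (if m = 0 then 0 else sqrt (real k) * disp \<beta> (m - 1) (k - 1) + \<beta> * disp \<beta> (m - 1) k)"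
      by (subst disp_raise') simp
    then show ?thesis
      unfolding sqrt_mult_self_mult by (cases "m = 0") (simp_all add: algebra_simps)
  qed
  let ?s = "sqrt (real (Suc m))"
  have "?s * (sqrt (real (Suc k)) * disp \<beta> (Suc m) (Suc k) + \<beta> * disp \<beta> (Suc m) k)
      = sqrt (real (Suc k)) * (?s * disp \<beta> (Suc m) (Suc k)) + \<beta> * (?s * disp \<beta> (Suc m) k)"
    by (simp only: algebra_simps)
  also have "\<dots> = sqrt (real (Suc k)) * (sqrt (real (Suc k)) * ?f k + \<beta> * ?f (Suc k))
      + \<beta> * (sqrt (real k) * ?f (k - 1) + \<beta> * ?f k)"
    unfolding disp_raise by simp
  also have "\<dots> = real (Suc k) * ?f k + \<beta> * (sqrt (real (Suc k)) * ?f (Suc k) + \<beta> * ?f k)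
      + \<beta> * (sqrt (real k) * ?f (k - 1))"
    unfolding distrib_left sqrt_mult_self_mult by (simp only: algebra_simps)
  also have "\<dots> = ?f k + (real k * ?f k + \<beta> * (sqrt (real k) * ?f (k - 1)))
       + \<beta> * (sqrt (real m) * disp \<beta> (m - 1) k)"
    unfolding IH by (simp add: algebra_simps)
  also have "\<dots> = ?f k + real m * ?f k"
    unfolding lo using up by simp
  also have "\<dots> = ?s * (?s * ?f k)"
    unfolding sqrt_mult_self_mult by (simp add: algebra_simps)
  finally show ?case
    by (simp del: disp.simps)
qed

text \<open>The displaced number operator (a^+ + \<beta>)(a + \<beta>) = a^+ a + \<beta> (a + a^+) +
  \<beta>^2 has the m-th displaced state as eigenvector with eigenvalue m; this is component k of
  that equation.\<close>

lemma disp_three_term: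
  "\<beta> * sqrt (real k) * disp \<beta> m (k - 1) + (real k + \<beta>\<^sup>2 - real m) * disp \<beta> m k
     + \<beta> * sqrt (real (Suc k)) * disp \<beta> m (Suc k) = 0"
proof -
  have a: "\<beta> * (sqrt (real (Suc k)) * disp \<beta> m (Suc k) + \<beta> * disp \<beta> m k)
      = \<beta> * (sqrt (real m) * disp \<beta> (m - 1) k)"
    unfolding disp_lower ..
  have b: "sqrt (real k) * (sqrt (real k) * disp \<beta> m k + \<beta> * disp \<beta> m (k - 1))
      = sqrt (real k) * (sqrt (real m) * disp \<beta> (m - 1) (k - 1))"
    using disp_lower[of "k - 1" \<beta> m] by (cases k) (simp_all del: disp.simps)
  have c: "sqrt (real m) * (sqrt (real m) * disp \<beta> m k)
     = sqrt (real m) * (sqrt (real k) * disp \<beta> (m - 1) (k - 1) + \<beta> * disp \<beta> (m - 1) k)"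
    by (subst disp_raise') simp
  show ?thesis
    using a b c unfolding distrib_left sqrt_mult_self_mult
    by (simp add: algebra_simps power2_eq_square)
qed

lemma disp_at_0: "disp \<beta> m 0 = exp (- (\<beta>\<^sup>2) / 2) * \<beta> ^ m / sqrt (fact m)"
  by (induction m) (simp_all add: real_sqrt_mult ac_simps)

text \<open>The matrix represents a displacement, its transpose is the opposite displacement, and
  conjugation by parity reverses the direction, which produces the sign. In the induction, raising
  in m on one side is lowering in the same variable on the other.\<close>

lemma disp_sym: "disp \<beta> m k = (-1) ^ (m + k) * disp \<beta> k m"
proof (induction m arbitrary: k)
  case 0
  show ?case
    by (simp add: disp_at_0 power_minus[of \<beta>])
next
  case (Suc m)
  have "sqrt (real (Suc m)) * disp \<beta> k (Suc m) = sqrt (real k) * disp \<beta> (k - 1) m - \<beta> * disp \<beta> k m"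
    using disp_lower[of m \<beta> k] by linarith
  then have "sqrt (real (Suc m)) * ((-1) ^ (Suc m + k) * disp \<beta> k (Suc m))
      = (-1) ^ (Suc m + k) * (sqrt (real k) * disp \<beta> (k - 1) m - \<beta> * disp \<beta> k m)"
    by (metis mult.left_commute)
  also have "\<dots> = sqrt (real k) * ((-1) ^ (m + (k - 1)) * disp \<beta> (k - 1) m)
      + \<beta> * ((-1) ^ (m + k) * disp \<beta> k m)"
    by (cases k) (simp_all add: algebra_simps del: disp.simps)
  also have "\<dots> = sqrt (real (Suc m)) * disp \<beta> (Suc m) k"
    unfolding disp_raise Suc[symmetric] ..
  finally have "sqrt (real (Suc m)) * ((-1) ^ (Suc m + k) * disp \<beta> k (Suc m))
      = sqrt (real (Suc m)) * disp \<beta> (Suc m) k" .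
  then show ?case
    by (simp only: mult_cancel_left real_sqrt_eq_zero_cancel_iff of_nat_eq_0_iff nat.distinct)
       (simp only: simp_thms eq_commute[of "disp \<beta> (Suc m) k"])
qed

section \<open>Sequences that decay faster than every geometric one\<close>

definition rapid :: "(nat \<Rightarrow> real) \<Rightarrow> bool" where
  "rapid f \<longleftrightarrow> (\<forall>r>0. \<exists>C. \<forall>k. \<bar>f k\<bar> \<le> C * r ^ k)"

lemma rapid_cmult: "rapid f \<Longrightarrow> rapid (\<lambda>k. c * f k)"
  unfolding rapid_def abs_mult
proof (intro allI impI)
  fix r :: real assume f: "\<forall>r>0. \<exists>C. \<forall>k. \<bar>f k\<bar> \<le> C * r ^ k" and "r > 0"
  then obtain C where "\<forall>k. \<bar>f k\<bar> \<le> C * r ^ k" by blast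
  then show "\<exists>C. \<forall>k. \<bar>c\<bar> * \<bar>f k\<bar> \<le> C * r ^ k"
    by (intro exI[of _ "\<bar>c\<bar> * C"]) (simp add: mult_left_mono mult.assoc)
qed

lemma rapid_add: 
  assumes "rapid f" "rapid h" shows "rapid (\<lambda>k. f k + h k)"
  unfolding rapid_def
proof (intro allI impI)
  fix r :: real assume "r > 0"
  then obtain C D where "\<forall>k. \<bar>f k\<bar> \<le> C * r ^ k" "\<forall>k. \<bar>h k\<bar> \<le> D * r ^ k" 
    using assms unfolding rapid_def by meson
  then have "\<forall>k. \<bar>f k + h k\<bar> \<le> (C + D) * r ^ k"
    by (simp add: algebra_simps) (meson abs_triangle_ineq add_mono order_trans)
  then show "\<exists>C. \<forall>k. \<bar>f k + h k\<bar> \<le> C * r ^ k" ..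
qed

lemma sqrt_le_two_power: "sqrt (real k) \<le> 2 ^ k"
proof -
  have "real k \<le> 2 ^ k" using of_nat_less_two_power[of k, where ?'a=real] by simp
  also have "\<dots> \<le> (2 ^ k)\<^sup>2" by (simp add: power2_eq_square)
  finally show ?thesis by (simp add: real_le_lsqrt)
qed

text \<open>The bound at r/2 gains a factor 2^k, which pays for sqrt k. This closure, which square
  summability does not have, allows ladder operators to act on the displaced states any number of
  times.\<close>

lemma rapid_sqrt: assumes "rapid f" shows "rapid (\<lambda>k. sqrt (real k) * f k)"
  unfolding rapid_def
proof (intro allI impI)
  fix r :: real assume "r > 0"
  then obtain C where C: "\<And>k. \<bar>f k\<bar> \<le> C * (r/2) ^ k" 
    using assms unfolding rapid_def by (metis half_gt_zero)
  have "\<bar>sqrt (real k) * f k\<bar> \<le> 2 ^ k * (C * (r/2) ^ k)" for k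
    unfolding abs_mult using C[of k] sqrt_le_two_power[of k] by (intro mult_mono) auto
  then have "\<forall>k. \<bar>sqrt (real k) * f k\<bar> \<le> C * r ^ k"
    by (simp add: field_simps power_divide)
  then show "\<exists>C. \<forall>k. \<bar>sqrt (real k) * f k\<bar> \<le> C * r ^ k" ..
qed

lemma rapid_Suc: assumes "rapid f" shows "rapid (\<lambda>k. f (Suc k))"
  unfolding rapid_def
proof (intro allI impI)
  fix r :: real assume "r > 0"
  then obtain C where C: "\<And>k. \<bar>f k\<bar> \<le> C * r ^ k" 
    using assms unfolding rapid_def by metis
  then have "\<forall>k. \<bar>f (Suc k)\<bar> \<le> (C * r) * r ^ k"
    using C[of "Suc k" for k] by (simp add: mult.assoc)
  then show "\<exists>C. \<forall>k. \<bar>f (Suc k)\<bar> \<le> C * r ^ k" ..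
qed

lemma rapid_pred: assumes "rapid f" shows "rapid (\<lambda>k. f (k - 1))"
  unfolding rapid_def
proof (intro allI impI)
  fix r :: real assume r: "r > 0"
  then obtain C where C: "\<And>k. \<bar>f k\<bar> \<le> C * r ^ k" 
    using assms unfolding rapid_def by metis
  have "C \<ge> 0" using C[of 0] by simp
  have "\<bar>f (k - 1)\<bar> \<le> (C + C / r) * r ^ k" for k
  proof (cases k)
    case 0
    have "0 \<le> C / r" using \<open>C \<ge> 0\<close> r by simp
    then show ?thesis using C[of 0] 0 by simp
  next
    case (Suc l)
    have "\<bar>f l\<bar> \<le> C * r * r ^ l + C * r ^ l"
      using C[of l] \<open>C \<ge> 0\<close> r by (intro add_increasing) auto
    moreover have "(C + C / r) * r ^ Suc l = C * r * r ^ l + C * r ^ l"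
      using r by (simp add: field_simps)
    ultimately show ?thesis using Suc by simp
  qed
  then show "\<exists>C. \<forall>k. \<bar>f (k - 1)\<bar> \<le> C * r ^ k" by blast
qed

lemma rapid_disp: "rapid (disp \<beta> m)"
proof (induction m)
  case 0
  have "\<exists>C. \<forall>k. \<bar>(- \<beta>) ^ k / sqrt (fact k)\<bar> \<le> C * r ^ k" if r: "r > 0" for r :: real
  proof -
    \<comment> \<open>The terms of the exponential series at (\<beta>/r)^2 are bounded, and their
      square roots are (|\<beta>|/r)^k / sqrt (k!); multiplying by r^k gives the claim.\<close>
    have "(\<lambda>k. ((\<beta> / r)\<^sup>2) ^ k / fact k) \<longlonglongrightarrow> 0"
      using summable_exp[of "(\<beta> / r)\<^sup>2"] by (intro summable_LIMSEQ_zero) (simp add: field_simps)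
    then have "Bseq (\<lambda>k. ((\<beta> / r)\<^sup>2) ^ k / fact k)"
      using convergent_imp_Bseq convergentI by blast
    then obtain K where K: "\<And>k. \<bar>((\<beta> / r)\<^sup>2) ^ k / fact k\<bar> \<le> K"
      unfolding Bseq_def by (auto simp: real_norm_def)
    have "\<bar>(- \<beta>) ^ k / sqrt (fact k)\<bar> \<le> sqrt K * r ^ k" for k
    proof -
      have "sqrt (((\<beta> / r)\<^sup>2) ^ k / fact k) \<le> sqrt K"
        using K[of k] by (simp add: abs_le_iff)
      moreover have "sqrt (((\<beta> / r)\<^sup>2) ^ k / fact k) = \<bar>\<beta>\<bar> ^ k / r ^ k / sqrt (fact k)"
      proof -
        have "((\<beta> / r)\<^sup>2) ^ k = ((\<bar>\<beta>\<bar> / r) ^ k)\<^sup>2"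
          by (simp add: power_divide power_mult[symmetric] mult.commute[of 2])
             (simp add: mult.commute[of k] power_mult)
        then show ?thesis
          using r by (simp only: real_sqrt_divide real_sqrt_abs) (simp add: power_divide)
      qed
      ultimately have "\<bar>\<beta>\<bar> ^ k / r ^ k / sqrt (fact k) \<le> sqrt K" by (simp only:)
      then show ?thesis
        using r by (simp add: abs_divide power_abs field_simps)
    qed
    then show ?thesis by blast
  qed
  then have "rapid (\<lambda>k. (- \<beta>) ^ k / sqrt (fact k))"
    unfolding rapid_def by blast
  from rapid_cmult[OF this, of "exp (- (\<beta>\<^sup>2) / 2)"] show ?case by simp
next
  case (Suc m)
  have "rapid (\<lambda>k. (1 / sqrt (real (Suc m))) * (sqrt (real k) * disp \<beta> m (k - 1) + \<beta> * disp \<beta> m k))"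
    by (intro rapid_cmult rapid_add rapid_sqrt rapid_pred Suc)
  then show ?case by simp
qed

lemma rapid_sign: "rapid f \<Longrightarrow> rapid (\<lambda>k. (-1) ^ k * f k)"
  unfolding rapid_def by (simp add: abs_mult)

lemma rapid_imp_l2: assumes "rapid f" shows "summable (\<lambda>k. (f k)\<^sup>2)"
proof -
  obtain C where C: "\<And>k. \<bar>f k\<bar> \<le> C * (1/2) ^ k"
    using assms unfolding rapid_def by (metis half_gt_zero zero_less_one)
  have "summable (\<lambda>k. C\<^sup>2 * (1/4::real) ^ k)"
    by (intro summable_mult summable_geometric) simp
  moreover have "norm ((f k)\<^sup>2) \<le> C\<^sup>2 * (1/4) ^ k" for k
  proof -
    have "\<bar>f k\<bar>\<^sup>2 \<le> (C * (1/2) ^ k)\<^sup>2" using C[of k] by (intro power_mono) auto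
    also have "\<dots> = C\<^sup>2 * (1/4) ^ k"
      by (simp add: power_mult_distrib power2_eq_square power_mult_distrib[symmetric])
    finally show ?thesis by simp
  qed
  ultimately show ?thesis by (rule summable_comparison_test'[where N=0])
qed

section \<open>Square-summable sequences\<close>

definition l2 :: "(nat \<Rightarrow> real) \<Rightarrow> bool" where
  "l2 u \<longleftrightarrow> summable (\<lambda>k. (u k)\<^sup>2)"

definition nsq :: "(nat \<Rightarrow> real) \<Rightarrow> real" where
  "nsq u = (\<Sum>k. (u k)\<^sup>2)"

definition ip :: "(nat \<Rightarrow> real) \<Rightarrow> (nat \<Rightarrow> real) \<Rightarrow> real" where
  "ip u v = (\<Sum>k. u k * v k)"

lemma l2_abs_mult_summable:
  assumes "l2 u" "l2 v" shows "summable (\<lambda>k. \<bar>u k * v k\<bar>)"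
proof -
  have "summable (\<lambda>k. (u k)\<^sup>2 + (v k)\<^sup>2)"
    using assms unfolding l2_def by (rule summable_add)
  moreover have "norm \<bar>u k * v k\<bar> \<le> (u k)\<^sup>2 + (v k)\<^sup>2" for k
  proof -
    have "2 * (\<bar>u k\<bar> * \<bar>v k\<bar>) \<le> \<bar>u k\<bar>\<^sup>2 + \<bar>v k\<bar>\<^sup>2" using sum_squares_bound[of "\<bar>u k\<bar>" "\<bar>v k\<bar>"] by simp
    moreover have "0 \<le> \<bar>u k\<bar> * \<bar>v k\<bar>" by simp
    ultimately have "\<bar>u k\<bar> * \<bar>v k\<bar> \<le> (u k)\<^sup>2 + (v k)\<^sup>2" unfolding power2_abs by linarith
    then show ?thesis by (simp add: abs_mult)
  qed
  ultimately show ?thesis by (rule summable_comparison_test'[where N=0])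
qed

lemma l2_mult_summable: "l2 u \<Longrightarrow> l2 v \<Longrightarrow> summable (\<lambda>k. u k * v k)"
  using l2_abs_mult_summable[of u v] summable_rabs_cancel[of "\<lambda>k. u k * v k"] by simp

lemma ip_sums: "l2 u \<Longrightarrow> l2 v \<Longrightarrow> (\<lambda>k. u k * v k) sums ip u v"
  unfolding ip_def by (intro summable_sums l2_mult_summable)

lemma l2_add: assumes "l2 u" "l2 v" shows "l2 (\<lambda>k. u k + v k)"
proof -
  have "summable (\<lambda>k. (u k)\<^sup>2 + (v k)\<^sup>2 + 2 * (u k * v k))"
    using assms l2_mult_summable[OF assms] unfolding l2_def by (intro summable_add summable_mult)
  then show ?thesis unfolding l2_def by (simp add: power2_sum mult.assoc)
qed

lemma l2_cmult: "l2 u \<Longrightarrow> l2 (\<lambda>k. c * u k)"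
  unfolding l2_def by (simp add: power_mult_distrib summable_mult)

lemma l2_diff: "l2 u \<Longrightarrow> l2 v \<Longrightarrow> l2 (\<lambda>k. u k - v k)"
  using l2_add[of u "\<lambda>k. (-1) * v k"] l2_cmult[of v "-1"] by simp

lemma sign_square: "((-1) ^ k * x)\<^sup>2 = (x::real)\<^sup>2"
  by (cases "even k") auto

lemma l2_sign: "l2 u \<Longrightarrow> l2 (\<lambda>k. (-1) ^ k * u k)"
  unfolding l2_def by (simp only: sign_square)

lemma nsq_sums: "l2 u \<Longrightarrow> (\<lambda>k. (u k)\<^sup>2) sums nsq u"
  unfolding nsq_def l2_def by (rule summable_sums)

lemma nsq_nonneg: "l2 u \<Longrightarrow> 0 \<le> nsq u"
  unfolding nsq_def l2_def by (rule suminf_nonneg) auto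

lemma nsq_ge_sum: "l2 u \<Longrightarrow> finite A \<Longrightarrow> (\<Sum>k\<in>A. (u k)\<^sup>2) \<le> nsq u"
  unfolding nsq_def l2_def by (rule sum_le_suminf) auto

lemma l2_boundedI:
  assumes "\<And>n. (\<Sum>k<n. (u k)\<^sup>2) \<le> B" shows "l2 u" "nsq u \<le> B"
proof -
  show "l2 u" unfolding l2_def
    by (rule summableI_nonneg_bounded) (use assms in auto)
  then show "nsq u \<le> B" unfolding nsq_def l2_def
    by (rule suminf_le_const) (use assms in auto)
qed

lemma abs_suminf_mult_le:
  assumes "l2 u" "l2 v"
  shows "(\<Sum>k. \<bar>u k * v k\<bar>) \<le> sqrt (nsq u) * sqrt (nsq v)"
proof (rule suminf_le_const[OF l2_abs_mult_summable[OF assms]])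
  fix n
  have "(\<Sum>k<n. \<bar>u k * v k\<bar>) = (\<Sum>k<n. \<bar>u k\<bar> * \<bar>v k\<bar>)" by (simp add: abs_mult)
  also have "\<dots> \<le> L2_set (\<lambda>k. u k) {..<n} * L2_set (\<lambda>k. v k) {..<n}"
    by (rule L2_set_mult_ineq)
  also have "\<dots> \<le> sqrt (nsq u) * sqrt (nsq v)"
    unfolding L2_set_def using nsq_ge_sum[OF assms(1)] nsq_ge_sum[OF assms(2)]
    by (intro mult_mono) (auto simp: sum_nonneg nsq_nonneg assms)
  finally show "(\<Sum>k<n. \<bar>u k * v k\<bar>) \<le> sqrt (nsq u) * sqrt (nsq v)" .
qed

lemma abs_ip_le: assumes "l2 u" "l2 v" shows "\<bar>ip u v\<bar> \<le> sqrt (nsq u) * sqrt (nsq v)"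
  using summable_rabs[OF l2_abs_mult_summable[OF assms]] abs_suminf_mult_le[OF assms]
  unfolding ip_def by simp

lemma ip_add: "l2 u \<Longrightarrow> l2 v \<Longrightarrow> l2 w \<Longrightarrow> ip u (\<lambda>k. v k + w k) = ip u v + ip u w"
  unfolding ip_def by (simp add: distrib_left suminf_add l2_mult_summable)

lemma ip_diff: "l2 u \<Longrightarrow> l2 v \<Longrightarrow> l2 w \<Longrightarrow> ip u (\<lambda>k. v k - w k) = ip u v - ip u w"
  unfolding ip_def by (simp add: right_diff_distrib suminf_diff l2_mult_summable)

lemma ip_commute: "ip u v = ip v u"
  unfolding ip_def by (simp add: mult.commute)

lemma nsq_eq_ip: "nsq u = ip u u"
  unfolding ip_def nsq_def by (simp add: power2_eq_square)

text \<open>For infinite matrices orthonormal rows do not imply orthonormal columns, so both are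
  recorded: the rows say that the system is orthonormal, the columns that it is complete.\<close>

locale orthogonal_matrix =
  fixes Q :: "nat \<Rightarrow> nat \<Rightarrow> real"
  assumes rows: "(\<lambda>k. Q m k * Q m' k) sums (if m = m' then 1 else 0)"
    and cols: "(\<lambda>m. Q m k * Q m k') sums (if k = k' then 1 else 0)"
begin

lemma transposed: "orthogonal_matrix (\<lambda>m k. Q k m)"
  by unfold_locales (fact cols rows)+

lemma l2_row: "l2 (Q m)"
  using rows[of m m] unfolding l2_def power2_eq_square by (rule sums_summable)

lemma nsq_row: "nsq (Q m) = 1"
  using rows[of m m] unfolding nsq_def power2_eq_square by (simp add: sums_iff)

text \<open>The squared distance of u from its projection onto the first N rows is nonnegative; row
  orthonormality evaluates it.\<close>

lemma bessel:
  assumes u: "l2 u"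
  shows "l2 (\<lambda>m. ip (Q m) u)" and "nsq (\<lambda>m. ip (Q m) u) \<le> nsq u"
proof -
  have *: "(\<Sum>m<N. (ip (Q m) u)\<^sup>2) \<le> nsq u" for N
  proof -
    define a where "a m = ip (Q m) u" for m
    have s1: "(\<lambda>k. \<Sum>m<N. a m * (Q m k * u k)) sums (\<Sum>m<N. a m * a m)"
      unfolding a_def by (intro sums_sum sums_mult ip_sums l2_row u)
    have "(\<lambda>k. \<Sum>m<N. \<Sum>m'<N. (a m * a m') * (Q m k * Q m' k)) sums
        (\<Sum>m<N. \<Sum>m'<N. (a m * a m') * (if m = m' then 1 else 0))"
      by (intro sums_sum sums_mult rows)
    moreover have "(\<Sum>m<N. \<Sum>m'<N. (a m * a m') * (if m = m' then 1 else 0)) = (\<Sum>m<N. a m * a m)"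
      by (intro sum.cong refl) (simp add: if_distrib cong: if_cong)
    moreover have "(\<Sum>m<N. \<Sum>m'<N. (a m * a m') * (Q m k * Q m' k)) = (\<Sum>m<N. a m * Q m k)\<^sup>2" for k
      by (simp add: power2_eq_square sum_product ac_simps)
    ultimately have s2: "(\<lambda>k. (\<Sum>m<N. a m * Q m k)\<^sup>2) sums (\<Sum>m<N. a m * a m)" by simp
    have "(\<lambda>k. (u k)\<^sup>2 - 2 * (\<Sum>m<N. a m * (Q m k * u k)) + (\<Sum>m<N. a m * Q m k)\<^sup>2) sums
       (nsq u - 2 * (\<Sum>m<N. a m * a m) + (\<Sum>m<N. a m * a m))"
      by (intro sums_add sums_diff sums_mult s1 s2 nsq_sums u)
    moreover have "(u k)\<^sup>2 - 2 * (\<Sum>m<N. a m * (Q m k * u k)) + (\<Sum>m<N. a m * Q m k)\<^sup>2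
        = (u k - (\<Sum>m<N. a m * Q m k))\<^sup>2" for k
      by (simp add: power2_diff sum_distrib_left sum_distrib_right ac_simps)
    ultimately have "(\<lambda>k. (u k - (\<Sum>m<N. a m * Q m k))\<^sup>2) sums (nsq u - (\<Sum>m<N. a m * a m))"
      by simp
    from sums_le[OF _ sums_zero this] have "0 \<le> nsq u - (\<Sum>m<N. a m * a m)"
      by simp
    then show ?thesis unfolding a_def by (simp add: power2_eq_square)
  qed
  show "l2 (\<lambda>m. ip (Q m) u)" "nsq (\<lambda>m. ip (Q m) u) \<le> nsq u"
    using l2_boundedI[OF *] by auto
qed

text \<open>For the head of u up to M the inner sums are finite, so summation can be exchanged and
  the column relation applies. The contribution of the tail is bounded by its norm, through Bessel's
  inequality and the unit norm of column k, and vanishes as M grows.\<close>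

lemma inversion:
  assumes u: "l2 u"
  shows "ip (\<lambda>m. Q m k) (\<lambda>m. ip (Q m) u) = u k"
proof -
  interpret T: orthogonal_matrix "\<lambda>m k. Q k m" by (rule transposed)
  have "\<bar>ip (\<lambda>m. Q m k) (\<lambda>m. ip (Q m) u) - u k\<bar> \<le> sqrt (\<Sum>i. (u (i + M))\<^sup>2)" if M: "M > k" for M
  proof -
    define h where "h j = (if j < M then u j else 0)" for j
    define t where "t j = (if j < M then 0 else u j)" for j
    have fin: "(\<lambda>j. if j < M then f j else 0) sums (\<Sum>j<M. f j)" for f :: "nat \<Rightarrow> real"
      using sums_If_finite_set[of "{..<M}" f] by simp
    have ut: "u = (\<lambda>j. h j + t j)" unfolding h_def t_def by auto
    have h2: "l2 h"
      unfolding l2_def h_def using sums_summable[OF fin[of "\<lambda>j. (u j)\<^sup>2"]]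
      by (simp add: if_distrib[of "\<lambda>x. x\<^sup>2"] cong: if_cong)
    have t2: "l2 t" using l2_diff[OF u h2] by (subst (asm) ut) simp
    have nt: "nsq t = (\<Sum>i. (u (i + M))\<^sup>2)"
    proof -
      have "nsq t = (\<Sum>i. (t (i + M))\<^sup>2) + (\<Sum>i<M. (t i)\<^sup>2)"
        unfolding nsq_def using suminf_split_initial_segment[OF t2[unfolded l2_def], of M] by simp
      then show ?thesis unfolding t_def by simp
    qed
    have iph: "ip (Q m) h = (\<Sum>j<M. Q m j * u j)" for m
      unfolding ip_def h_def using fin[of "\<lambda>j. Q m j * u j"] by (simp add: sums_iff if_distrib cong: if_cong)
    have "(\<lambda>m. \<Sum>j<M. (Q m k * Q m j) * u j) sums (\<Sum>j<M. (if k = j then 1 else 0) * u j)"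
      by (intro sums_sum sums_mult2 cols)
    moreover have "(\<Sum>j<M. (if k = j then 1 else 0) * u j) = u k"
      using M by (simp add: if_distrib[of "\<lambda>x. x * _"] cong: if_cong)
    ultimately have "ip (\<lambda>m. Q m k) (\<lambda>m. ip (Q m) h) = u k"
      unfolding iph unfolding ip_def by (simp add: sums_iff sum_distrib_left mult.assoc)
    moreover have "ip (\<lambda>m. Q m k) (\<lambda>m. ip (Q m) u) =
        ip (\<lambda>m. Q m k) (\<lambda>m. ip (Q m) h) + ip (\<lambda>m. Q m k) (\<lambda>m. ip (Q m) t)"
      by (subst ut, subst ip_add[OF l2_row h2 t2], rule ip_add) (intro T.l2_row bessel h2 t2)+
    moreover have "\<bar>ip (\<lambda>m. Q m k) (\<lambda>m. ip (Q m) t)\<bar> \<le> sqrt 1 * sqrt (nsq t)"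
      using abs_ip_le[OF T.l2_row bessel(1)[OF t2], of k] bessel(2)[OF t2] T.nsq_row[of k]
      by (simp add: order_trans[OF _ real_sqrt_le_mono])
    ultimately show ?thesis using nt by simp
  qed
  moreover have "(\<lambda>M. sqrt (\<Sum>i. (u (i + M))\<^sup>2)) \<longlonglongrightarrow> sqrt 0"
    by (intro tendsto_real_sqrt suminf_exist_split2 u[unfolded l2_def])
  ultimately have "\<bar>ip (\<lambda>m. Q m k) (\<lambda>m. ip (Q m) u) - u k\<bar> \<le> 0"
    by (intro tendsto_lowerbound[of "\<lambda>M. sqrt (\<Sum>i. (u (i + M))\<^sup>2)"])
       (auto intro!: eventually_sequentiallyI[of "Suc k"])
  then show ?thesis by simp
qed

text \<open>Bessel's inequality for Q in one direction and, after inversion, for its transpose in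
  the other.\<close>

lemma nsq_isometry:
  assumes u: "l2 u" shows "nsq (\<lambda>m. ip (Q m) u) = nsq u"
proof (rule antisym)
  interpret T: orthogonal_matrix "\<lambda>m k. Q k m" by (rule transposed)
  show "nsq (\<lambda>m. ip (Q m) u) \<le> nsq u" by (rule bessel(2)[OF u])
  have "nsq u = nsq (\<lambda>k. ip (\<lambda>m. Q m k) (\<lambda>m. ip (Q m) u))" unfolding inversion[OF u] ..
  also have "\<dots> \<le> nsq (\<lambda>m. ip (Q m) u)" by (rule T.bessel(2)[OF bessel(1)[OF u]])
  finally show "nsq u \<le> nsq (\<lambda>m. ip (Q m) u)" .
qed

text \<open>Polarization of the isometry.\<close>

lemma parseval:
  assumes u: "l2 u" and v: "l2 v"
  shows "ip (\<lambda>m. ip (Q m) u) (\<lambda>m. ip (Q m) v) = ip u v"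
proof -
  have pol: "nsq (\<lambda>k. a k + b k) = nsq a + nsq b + 2 * ip a b" if "l2 a" "l2 b" for a b
  proof -
    have "(\<lambda>k. (a k)\<^sup>2 + (b k)\<^sup>2 + 2 * (a k * b k)) sums (nsq a + nsq b + 2 * ip a b)"
      by (intro sums_add sums_mult nsq_sums ip_sums that)
    then show ?thesis unfolding nsq_def[of "\<lambda>k. a k + b k"] by (simp add: sums_iff power2_sum mult.assoc)
  qed
  have "nsq (\<lambda>m. ip (Q m) u + ip (Q m) v) = nsq (\<lambda>k. u k + v k)"
    using nsq_isometry[OF l2_add[OF u v]] by (simp add: ip_add[OF l2_row u v])
  then show ?thesis
    unfolding pol[OF u v] pol[OF bessel(1)[OF u] bessel(1)[OF v]]
    by (simp add: nsq_isometry u v)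
qed

end

section \<open>The Rabi matrix in the displaced basis\<close>

lemma rapid_l2: "rapid f \<Longrightarrow> l2 f"
  unfolding l2_def by (rule rapid_imp_l2)

lemma l2_pred: assumes "l2 h" shows "l2 (\<lambda>k. h (k - 1))"
  using assms unfolding l2_def by (subst summable_Suc_iff[symmetric]) simp

lemma l2_Suc: assumes "l2 h" shows "l2 (\<lambda>k. h (Suc k))"
  using assms unfolding l2_def by (subst summable_Suc_iff)

lemma ip_shift:
  assumes "l2 F" "l2 h" "F 0 = 0"
  shows "ip F (\<lambda>k. h (k - 1)) = ip (\<lambda>k. F (Suc k)) h"
  unfolding ip_def
  using suminf_split_head[OF l2_mult_summable[OF assms(1) l2_pred[OF assms(2)]]] assms(3) by simp

lemma ip_shift':
  assumes "l2 F" "l2 h" "F 0 = 0"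
  shows "ip (\<lambda>k. F (Suc k)) (\<lambda>k. h (Suc k)) = ip F h"
  unfolding ip_def
  using suminf_split_head[OF l2_mult_summable[OF assms(1,2)]] assms(3) by simp

lemma ip_cmult: "l2 u \<Longrightarrow> l2 v \<Longrightarrow> ip u (\<lambda>k. c * v k) = c * ip u v"
  unfolding ip_def using suminf_mult[OF l2_mult_summable, of u v c] by (simp add: ac_simps)

lemma ip_cmult_left: "l2 u \<Longrightarrow> l2 v \<Longrightarrow> ip (\<lambda>k. c * u k) v = c * ip u v"
  using ip_cmult[of v u c] by (simp add: ip_commute)

lemma ip_sqrt_shift:
  assumes "rapid f" "l2 h"
  shows "ip (\<lambda>k. sqrt (real k) * f k) (\<lambda>k. h (k - 1)) = ip (\<lambda>k. sqrt (real (Suc k)) * f (Suc k)) h"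
  using ip_shift[OF rapid_l2[OF rapid_sqrt[OF assms(1)]] assms(2)] by simp

lemma l2_disp: "l2 (disp \<beta> m)"
  by (intro rapid_l2 rapid_disp)

text \<open>The adjoint of a^+ + \<beta> is a + \<beta>: what raises in one slot lowers in the
  other. Iterating this reduces every inner product of two states to one with the displaced
  vacuum.\<close>

lemma ip_disp_raise:
  "sqrt (real (Suc k)) * ip (disp \<beta> m) (disp \<beta> (Suc k)) = sqrt (real m) * ip (disp \<beta> (m - 1)) (disp \<beta> k)"
proof -
  let ?f = "disp \<beta> m" and ?h = "disp \<beta> k"
  have l: "l2 (\<lambda>j. sqrt (real j) * ?h (j - 1))" "l2 (\<lambda>j. sqrt (real (Suc j)) * ?f (Suc j))"
    by (intro rapid_l2 rapid_sqrt rapid_pred rapid_disp rapid_Suc[OF rapid_sqrt])+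
  have "sqrt (real (Suc k)) * ip ?f (disp \<beta> (Suc k)) = ip ?f (\<lambda>j. sqrt (real (Suc k)) * disp \<beta> (Suc k) j)"
    by (rule ip_cmult[symmetric]) (rule l2_disp)+
  also have "\<dots> = ip ?f (\<lambda>j. sqrt (real j) * ?h (j - 1) + \<beta> * ?h j)"
    unfolding disp_raise ..
  also have "\<dots> = ip ?f (\<lambda>j. sqrt (real j) * ?h (j - 1)) + \<beta> * ip ?f ?h"
    by (subst ip_add) (simp_all only: ip_cmult l2_disp l2_cmult l)
  also have "ip ?f (\<lambda>j. sqrt (real j) * ?h (j - 1)) = ip (\<lambda>j. sqrt (real j) * ?f j) (\<lambda>j. ?h (j - 1))"
    by (simp add: ip_def ac_simps)
  also have "\<dots> = ip (\<lambda>j. sqrt (real (Suc j)) * ?f (Suc j)) ?h"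
    by (intro ip_sqrt_shift rapid_disp l2_disp)
  also have "\<dots> + \<beta> * ip ?f ?h = ip (\<lambda>j. sqrt (real (Suc j)) * ?f (Suc j) + \<beta> * ?f j) ?h"
    by (subst (1 2 3) ip_commute, subst ip_add) (simp_all only: ip_cmult l2_disp l2_cmult l)
  also have "\<dots> = ip (\<lambda>j. sqrt (real m) * disp \<beta> (m - 1) j) ?h"
    unfolding disp_lower ..
  finally show ?thesis
    by (simp only: ip_cmult_left l2_disp)
qed

lemma exp_sums: "(\<lambda>k. x ^ k / fact k) sums exp (x::real)"
  using exp_converges[of x] by (simp add: field_simps)

lemma disp_0_mult: "disp \<beta> 0 k * disp \<beta> 0 k = exp (- (\<beta>\<^sup>2)) * ((\<beta>\<^sup>2) ^ k / fact k)"
proof -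
  have "exp (- (\<beta>\<^sup>2) / 2) * exp (- (\<beta>\<^sup>2) / 2) = exp (- (\<beta>\<^sup>2))"
    by (simp add: exp_add[symmetric])
  moreover have "(- \<beta>) ^ k * (- \<beta>) ^ k = (\<beta>\<^sup>2) ^ k"
    by (simp add: power_mult_distrib[symmetric] power2_eq_square)
  ultimately show ?thesis
    by (simp add: field_simps)
qed

lemma ip_disp: "ip (disp \<beta> m) (disp \<beta> k) = (if m = k then 1 else 0)"
proof (induction k arbitrary: m)
  case 0
  show ?case
  proof (cases m)
    case 0
    have "(\<lambda>k. disp \<beta> 0 k * disp \<beta> 0 k) sums (exp (- (\<beta>\<^sup>2)) * exp (\<beta>\<^sup>2))"
      unfolding disp_0_mult by (intro sums_mult exp_sums)
    then show ?thesis unfolding 0 ip_def by (simp add: sums_iff exp_add[symmetric])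
  next
    case (Suc l)
    then show ?thesis
      using ip_disp_raise[of l \<beta> 0] by (simp add: ip_commute[of "disp \<beta> (Suc l)"] del: disp.simps)
  qed
next
  case (Suc k)
  have "sqrt (real (Suc k)) * ip (disp \<beta> m) (disp \<beta> (Suc k)) = (if m = Suc k then sqrt (real (Suc k)) else 0)"
    unfolding ip_disp_raise Suc by (cases m) auto
  then show ?case
    by (simp del: disp.simps of_nat_Suc split: if_splits)
qed

text \<open>Completeness costs nothing beyond orthonormality, because by \<open>disp_sym\<close> a
  column is a row up to signs.\<close>

lemma orthogonal_disp: "orthogonal_matrix (disp \<beta>)"
proof
  fix m m' :: nat
  show "(\<lambda>k. disp \<beta> m k * disp \<beta> m' k) sums (if m = m' then 1 else 0)"
    using ip_sums[OF l2_disp[of \<beta> m] l2_disp[of \<beta> m']] unfolding ip_disp .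
next
  fix k k' :: nat
  have "disp \<beta> m k * disp \<beta> m k' = (-1) ^ (k + k') * (disp \<beta> k m * disp \<beta> k' m)" for m
    by (subst (1 2) disp_sym) (simp add: power_add)
  moreover have "(\<lambda>m. (-1) ^ (k + k') * (disp \<beta> k m * disp \<beta> k' m)) sums ((-1) ^ (k + k') * (if k = k' then 1 else 0))"
    using ip_sums[OF l2_disp[of \<beta> k] l2_disp[of \<beta> k']] unfolding ip_disp by (rule sums_mult)
  ultimately show "(\<lambda>m. disp \<beta> m k * disp \<beta> m k') sums (if k = k' then 1 else 0)"
    by (auto simp: power_add power_mult_distrib[symmetric] split: if_splits)
qed

section \<open>The parity operator in the displaced basis\<close>

definition parity_mat :: "real \<Rightarrow> nat \<Rightarrow> nat \<Rightarrow> real" where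
  "parity_mat g m j = ip (disp g m) (\<lambda>k. (-1) ^ k * disp g j k)"

lemma parity_mat_sym: "parity_mat g m j = parity_mat g j m"
  unfolding parity_mat_def ip_def by (simp add: ac_simps)

text \<open>Parity anticommutes with a^+, so moving a^+ + g past it leaves -(a^+ + g) + 2g; the
  adjoint of the first term then lowers the index m.\<close>

lemma parity_mat_Suc:
  "sqrt (real (Suc j)) * parity_mat g m (Suc j)
     = 2 * g * parity_mat g m j - sqrt (real m) * parity_mat g (m - 1) j"
proof -
  let ?f = "disp g m" and ?h = "\<lambda>k. (-1) ^ k * disp g j k"
  have h: "l2 ?h" by (intro rapid_l2 rapid_sign rapid_disp)
  have l: "l2 (\<lambda>k. - sqrt (real k) * ?h (k - 1))"
    using rapid_cmult[OF rapid_sqrt[OF rapid_pred[OF rapid_sign[OF rapid_disp]]], of "-1" g j]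
    by (intro rapid_l2) simp
  have l': "l2 (\<lambda>k. sqrt (real k) * disp g m k)" by (intro rapid_l2 rapid_sqrt rapid_disp)
  have "sqrt (real (Suc j)) * parity_mat g m (Suc j)
      = ip ?f (\<lambda>k. sqrt (real (Suc j)) * ((-1) ^ k * disp g (Suc j) k))"
    unfolding parity_mat_def by (rule ip_cmult[symmetric]) (intro l2_disp l2_sign)+
  also have "(\<lambda>k. sqrt (real (Suc j)) * ((-1) ^ k * disp g (Suc j) k))
      = (\<lambda>k. - sqrt (real k) * ?h (k - 1) + g * ?h k)"
  proof
    fix k
    have "sqrt (real (Suc j)) * ((-1) ^ k * disp g (Suc j) k) = (-1) ^ k * (sqrt (real (Suc j)) * disp g (Suc j) k)"
      by (rule mult.left_commute)
    also have "\<dots> = - sqrt (real k) * ?h (k - 1) + g * ?h k"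
      unfolding disp_raise by (cases k) (simp_all add: algebra_simps del: disp.simps)
    finally show "sqrt (real (Suc j)) * ((-1) ^ k * disp g (Suc j) k) = - sqrt (real k) * ?h (k - 1) + g * ?h k" .
  qed
  also have "ip ?f \<dots> = ip ?f (\<lambda>k. - sqrt (real k) * ?h (k - 1)) + g * ip ?f ?h"
    by (subst ip_add) (simp_all only: ip_cmult l2_disp l2_cmult l h)
  also have "ip ?f (\<lambda>k. - sqrt (real k) * ?h (k - 1))
      = - ip (\<lambda>k. sqrt (real k) * ?f k) (\<lambda>k. ?h (k - 1))"
    unfolding ip_def
    by (subst suminf_minus[symmetric], rule l2_mult_summable[OF l' l2_pred[OF h]]) (simp add: ac_simps)
  also have "ip (\<lambda>k. sqrt (real k) * ?f k) (\<lambda>k. ?h (k - 1)) = ip (\<lambda>k. sqrt (real (Suc k)) * ?f (Suc k)) ?h"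
    by (rule ip_sqrt_shift[OF rapid_disp h])
  also have "(\<lambda>k. sqrt (real (Suc k)) * ?f (Suc k)) = (\<lambda>k. sqrt (real m) * disp g (m - 1) k - g * ?f k)"
    by (simp only: disp_lower[symmetric]) simp
  also have "ip \<dots> ?h = sqrt (real m) * ip (disp g (m - 1)) ?h - g * ip ?f ?h"
    by (subst (1 2 3) ip_commute, subst ip_diff) (simp_all only: ip_cmult l2_disp l2_cmult h)
  finally show ?thesis
    unfolding parity_mat_def by (simp add: algebra_simps)
qed

lemma parity_mat_0: "parity_mat g 0 m = disp (2 * g) m 0"
proof (induction m)
  case 0
  have "disp g 0 k * ((-1) ^ k * disp g 0 k) = exp (- (g\<^sup>2)) * ((- (g\<^sup>2)) ^ k / fact k)" for k
    unfolding mult.left_commute[of _ "(-1) ^ k"] disp_0_mult power_minus[of "g\<^sup>2"] by simp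
  \<comment> \<open>The alternating sign turns the exponential series at g^2 into the one at -g^2,
    and exp (-g^2) squared equals exp (-(2g)^2 / 2), the vacuum entry for displacement 2g.\<close>
  then have "(\<lambda>k. disp g 0 k * ((-1) ^ k * disp g 0 k)) sums (exp (- (g\<^sup>2)) * exp (- (g\<^sup>2)))"
    by (simp only:) (intro sums_mult exp_sums)
  then show ?case
    unfolding parity_mat_def ip_def disp_at_0
    by (simp add: sums_iff exp_add[symmetric] power_mult_distrib del: disp.simps)
next
  case (Suc m)
  have "sqrt (real (Suc m)) * parity_mat g 0 (Suc m) = sqrt (real (Suc m)) * disp (2 * g) (Suc m) 0"
    unfolding parity_mat_Suc disp_raise Suc by simp
  then show ?case by (simp del: disp.simps of_nat_Suc)
qed

text \<open>
  Both sides satisfy the raising recurrence of a displacement by $2g$, because the parity operator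
  anticommutes with $a^\dagger$.
\<close>

theorem parity_mat_eq: "parity_mat g m j = (-1) ^ m * disp (2 * g) j m"
proof (induction j arbitrary: m)
  case 0
  show ?case
    using disp_sym[of "2 * g" m 0] by (simp add: parity_mat_sym[of g m 0] parity_mat_0 del: disp.simps)
next
  case (Suc j)
  have "sqrt (real (Suc j)) * parity_mat g m (Suc j)
     = 2 * g * ((-1) ^ m * disp (2 * g) j m) - sqrt (real m) * ((-1) ^ (m - 1) * disp (2 * g) j (m - 1))"
    unfolding parity_mat_Suc Suc ..
  also have "\<dots> = (-1) ^ m * (sqrt (real m) * disp (2 * g) j (m - 1) + 2 * g * disp (2 * g) j m)"
    by (cases m) (simp_all add: algebra_simps del: disp.simps)
  also have "\<dots> = sqrt (real (Suc j)) * ((-1) ^ m * disp (2 * g) (Suc j) m)"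
    unfolding disp_raise[symmetric] by (rule mult.left_commute)
  finally show ?case by (simp del: disp.simps of_nat_Suc)
qed

lemma orthogonal_parity_mat: "orthogonal_matrix (parity_mat g)"
proof -
  interpret D: orthogonal_matrix "disp (2 * g)" by (rule orthogonal_disp)
  have r: "(\<lambda>k. parity_mat g m k * parity_mat g m' k) sums (if m = m' then 1 else 0)" for m m'
  proof -
    have "(\<lambda>k. (-1) ^ (m + m') * (disp (2 * g) k m * disp (2 * g) k m')) sums
        ((-1) ^ (m + m') * (if m = m' then 1 else 0))"
      by (intro sums_mult D.cols)
    then show ?thesis unfolding parity_mat_eq
      by (auto simp: power_add power_mult_distrib[symmetric] ac_simps split: if_splits)
  qed
  show ?thesis
    by unfold_locales (use r in \<open>auto simp: parity_mat_sym[of g _ m for m]\<close>)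
qed

text \<open>By Parseval both sides are the inner product of u with the parity operator applied to
  the m-th state.\<close>

lemma parity_mat_apply:
  assumes u: "l2 u"
  shows "ip (parity_mat g m) (\<lambda>j. ip (disp g j) u) = ip (disp g m) (\<lambda>k. (-1) ^ k * u k)"
proof -
  interpret D: orthogonal_matrix "disp g" by (rule orthogonal_disp)
  have "ip (\<lambda>j. ip (disp g j) (\<lambda>k. (-1) ^ k * disp g m k)) (\<lambda>j. ip (disp g j) u) = ip (\<lambda>k. (-1) ^ k * disp g m k) u"
    by (intro D.parseval u l2_sign l2_disp)
  moreover have "(\<lambda>j. ip (disp g j) (\<lambda>k. (-1) ^ k * disp g m k)) = parity_mat g m"
    using parity_mat_sym[of g m] by (auto simp: parity_mat_def)
  moreover have "ip (\<lambda>k. (-1) ^ k * disp g m k) u = ip (disp g m) (\<lambda>k. (-1) ^ k * u k)"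
    by (simp add: ip_def ac_simps)
  ultimately show ?thesis by simp
qed

section \<open>The eigenvalue equation in the displaced basis\<close>

lemma disp_jacobi:
  "g * sqrt (real k) * disp g m (k - 1) + real k * disp g m k + g * sqrt (real (Suc k)) * disp g m (Suc k)
     = (real m - g\<^sup>2) * disp g m k"
  using disp_three_term[of g k m] by (simp add: algebra_simps del: disp.simps)

lemma rabi_jacobi_apply_eq:
  "rabi_jacobi_apply s \<Delta> g u k
     = g * sqrt (real k) * u (k - 1) + real k * u k + g * sqrt (real (Suc k)) * u (Suc k) + s * \<Delta> * ((-1) ^ k * u k)"
  unfolding rabi_jacobi_apply_def rabi_diag_def rabi_off_def by (simp add: algebra_simps)

text \<open>The coefficients are c_m = \<open>ip (disp g m) u\<close>: the matrix without its sign
  term becomes multiplication by m - g^2, and the sign term becomes \<open>parity_mat\<close>. From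
  left to right u is merely square-summable, so the Jacobi matrix is moved by summation by parts
  onto the rapidly decaying states. From right to left each row of the Jacobi matrix is finite, so
  the few series involved combine term by term.\<close>

theorem rabi_eigenvalue_iff:
  "rabi_eigenvalue s \<Delta> g E \<longleftrightarrow>
     (\<exists>c. c \<noteq> (\<lambda>_. 0) \<and> l2 c \<and> (\<forall>m. (E + g\<^sup>2 - real m) * c m = s * \<Delta> * ip (parity_mat g m) c))"
proof
  interpret D: orthogonal_matrix "disp g" by (rule orthogonal_disp)
  interpret T: orthogonal_matrix "\<lambda>m k. disp g k m" by (rule D.transposed)
  {
    assume "rabi_eigenvalue s \<Delta> g E"
    then obtain u where u: "u \<noteq> (\<lambda>_. 0)" "l2 u" and Eu: "\<And>k. rabi_jacobi_apply s \<Delta> g u k = E * u k"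
      unfolding rabi_eigenvalue_def l2_def by auto
    define c where "c m = ip (disp g m) u" for m
    have "l2 c" unfolding c_def by (rule D.bessel(1)[OF u(2)])
    have inv: "ip (\<lambda>m. disp g m k) c = u k" for k
      unfolding c_def by (rule D.inversion[OF u(2)])
    have "c \<noteq> (\<lambda>_. 0)"
    proof
      assume "c = (\<lambda>_. 0)"
      then have "u k = 0" for k using inv[of k] by (simp add: ip_def)
      then show False using u(1) by auto
    qed
    have "(E + g\<^sup>2 - real m) * c m = s * \<Delta> * ip (parity_mat g m) c" for m
    proof -
      let ?f = "disp g m"
      have f: "rapid ?f" by (rule rapid_disp)
      have l: "l2 (\<lambda>k. sqrt (real k) * ?f k)" "l2 (\<lambda>k. sqrt (real k) * ?f (k - 1))"
        "l2 (\<lambda>k. sqrt (real (Suc k)) * ?f (Suc k))" "l2 (\<lambda>k. sqrt (real (Suc k)) * ?f k)"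
        using rapid_Suc[OF rapid_sqrt[OF rapid_pred[OF f]]]
        by (intro rapid_l2 rapid_sqrt rapid_pred f rapid_Suc[OF rapid_sqrt]; simp)+
      have l4: "l2 (\<lambda>k. real k * ?f k)"
        using rapid_l2[OF rapid_sqrt[OF rapid_sqrt[OF f]]] unfolding sqrt_mult_self_mult .
      have "(\<lambda>k. ?f k * (sqrt (real k) * u (k - 1))) sums ip (\<lambda>k. sqrt (real (Suc k)) * ?f (Suc k)) u"
        using ip_sums[OF l(1) l2_pred[OF u(2)]] unfolding ip_sqrt_shift[OF f u(2)] by (simp add: ac_simps)
      moreover have "(\<lambda>k. ?f k * (sqrt (real (Suc k)) * u (Suc k))) sums ip (\<lambda>k. sqrt (real k) * ?f (k - 1)) u"
        using ip_sums[OF l(4) l2_Suc[OF u(2)]] ip_shift'[OF l(2) u(2)] by (simp add: ac_simps)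
      moreover have "(\<lambda>k. ?f k * (real k * u k)) sums ip (\<lambda>k. real k * ?f k) u"
        using ip_sums[OF l4 u(2)] by (simp add: ac_simps)
      moreover have "(\<lambda>k. ?f k * ((-1) ^ k * u k)) sums ip (parity_mat g m) c"
        using ip_sums[OF l2_disp l2_sign[OF u(2)]] parity_mat_apply[OF u(2)] unfolding c_def by simp
      ultimately have "(\<lambda>k. g * (?f k * (sqrt (real k) * u (k - 1))) + ?f k * (real k * u k)
           + g * (?f k * (sqrt (real (Suc k)) * u (Suc k))) + s * \<Delta> * (?f k * ((-1) ^ k * u k))) sums
         (g * ip (\<lambda>k. sqrt (real (Suc k)) * ?f (Suc k)) u + ip (\<lambda>k. real k * ?f k) u
           + g * ip (\<lambda>k. sqrt (real k) * ?f (k - 1)) u + s * \<Delta> * ip (parity_mat g m) c)"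
        by (intro sums_add sums_mult)
      moreover have "g * (?f k * (sqrt (real k) * u (k - 1))) + ?f k * (real k * u k)
           + g * (?f k * (sqrt (real (Suc k)) * u (Suc k))) + s * \<Delta> * (?f k * ((-1) ^ k * u k)) = E * (?f k * u k)" for k
      proof -
        have "?f k * (E * u k) = ?f k * (g * sqrt (real k) * u (k - 1) + real k * u k
            + g * sqrt (real (Suc k)) * u (Suc k) + s * \<Delta> * ((-1) ^ k * u k))"
          using Eu[of k] unfolding rabi_jacobi_apply_eq by simp
        then show ?thesis by (simp add: algebra_simps del: disp.simps)
      qed
      moreover have "(\<lambda>k. E * (?f k * u k)) sums (E * c m)"
        unfolding c_def by (intro sums_mult ip_sums l2_disp u)
      ultimately have 1: "g * ip (\<lambda>k. sqrt (real (Suc k)) * ?f (Suc k)) u + ip (\<lambda>k. real k * ?f k) u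
           + g * ip (\<lambda>k. sqrt (real k) * ?f (k - 1)) u + s * \<Delta> * ip (parity_mat g m) c = E * c m"
        by (simp add: sums_iff)
      have "g * ip (\<lambda>k. sqrt (real (Suc k)) * ?f (Suc k)) u + ip (\<lambda>k. real k * ?f k) u
           + g * ip (\<lambda>k. sqrt (real k) * ?f (k - 1)) u
         = ip (\<lambda>k. g * (sqrt (real k) * ?f (k - 1)) + real k * ?f k + g * (sqrt (real (Suc k)) * ?f (Suc k))) u"
        by (subst (1 2 3 4) ip_commute) (simp only: ip_add ip_cmult l2_cmult l2_add l l4 u(2))
      also have "\<dots> = ip (\<lambda>k. (real m - g\<^sup>2) * ?f k) u"
        using disp_jacobi[of g _ m] by (simp add: mult.assoc del: disp.simps)
      also have "\<dots> = (real m - g\<^sup>2) * c m"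
        unfolding c_def by (rule ip_cmult_left[OF l2_disp u(2)])
      finally show ?thesis using 1 by (simp add: algebra_simps)
    qed
    then show "\<exists>c. c \<noteq> (\<lambda>_. 0) \<and> l2 c \<and> (\<forall>m. (E + g\<^sup>2 - real m) * c m = s * \<Delta> * ip (parity_mat g m) c)"
      using \<open>c \<noteq> (\<lambda>_. 0)\<close> \<open>l2 c\<close> by blast
  }
  {
    assume "\<exists>c. c \<noteq> (\<lambda>_. 0) \<and> l2 c \<and> (\<forall>m. (E + g\<^sup>2 - real m) * c m = s * \<Delta> * ip (parity_mat g m) c)"
    then obtain c where c: "c \<noteq> (\<lambda>_. 0)" "l2 c"
      and Ec: "\<And>m. (E + g\<^sup>2 - real m) * c m = s * \<Delta> * ip (parity_mat g m) c" by blast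
    define u where "u k = ip (\<lambda>m. disp g m k) c" for k
    have u2: "l2 u" unfolding u_def by (rule T.bessel(1)[OF c(2)])
    have cu: "c = (\<lambda>m. ip (disp g m) u)"
      unfolding u_def by (rule ext) (rule T.inversion[OF c(2), symmetric])
    have u0: "u \<noteq> (\<lambda>_. 0)"
    proof
      assume "u = (\<lambda>_. 0)"
      then have "c = (\<lambda>_. 0)" unfolding cu by (simp add: ip_def)
      then show False using c(1) by contradiction
    qed
    have "rabi_jacobi_apply s \<Delta> g u k = E * u k" for k
    proof -
      have us: "(\<lambda>m. disp g m i * c m) sums u i" for i
        unfolding u_def by (intro ip_sums T.l2_row c)
      have "(\<lambda>m. g * sqrt (real k) * (disp g m (k - 1) * c m) + real k * (disp g m k * c m)
             + g * sqrt (real (Suc k)) * (disp g m (Suc k) * c m)) sums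
           (g * sqrt (real k) * u (k - 1) + real k * u k + g * sqrt (real (Suc k)) * u (Suc k))"
        by (intro sums_add sums_mult us)
      moreover have "g * sqrt (real k) * (disp g m (k - 1) * c m) + real k * (disp g m k * c m)
             + g * sqrt (real (Suc k)) * (disp g m (Suc k) * c m)
           = E * (disp g m k * c m) - s * \<Delta> * (disp g m k * ip (disp g m) (\<lambda>k. (-1) ^ k * u k))" for m
      proof -
        have "g * sqrt (real k) * (disp g m (k - 1) * c m) + real k * (disp g m k * c m)
             + g * sqrt (real (Suc k)) * (disp g m (Suc k) * c m)
           = (g * sqrt (real k) * disp g m (k - 1) + real k * disp g m k
             + g * sqrt (real (Suc k)) * disp g m (Suc k)) * c m"
          by (simp add: algebra_simps del: disp.simps)
        also have "\<dots> = disp g m k * ((real m - g\<^sup>2) * c m)"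
          unfolding disp_jacobi by simp
        also have "(real m - g\<^sup>2) * c m = E * c m - s * \<Delta> * ip (parity_mat g m) c"
          using Ec[of m] by (simp add: algebra_simps)
        also have "ip (parity_mat g m) c = ip (disp g m) (\<lambda>k. (-1) ^ k * u k)"
          unfolding cu by (rule parity_mat_apply[OF u2])
        finally show ?thesis by (simp add: algebra_simps del: disp.simps)
      qed
      moreover have "(\<lambda>m. disp g m k * ip (disp g m) (\<lambda>k. (-1) ^ k * u k)) sums ((-1) ^ k * u k)"
        using ip_sums[OF T.l2_row D.bessel(1)[OF l2_sign[OF u2]], of k] unfolding D.inversion[OF l2_sign[OF u2]] .
      then have "(\<lambda>m. E * (disp g m k * c m) - s * \<Delta> * (disp g m k * ip (disp g m) (\<lambda>k. (-1) ^ k * u k)))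
          sums (E * u k - s * \<Delta> * ((-1) ^ k * u k))"
        by (intro sums_diff sums_mult us)
      ultimately have "g * sqrt (real k) * u (k - 1) + real k * u k + g * sqrt (real (Suc k)) * u (Suc k)
          = E * u k - s * \<Delta> * ((-1) ^ k * u k)"
        by (simp add: sums_iff)
      then show ?thesis unfolding rabi_jacobi_apply_eq by simp
    qed
    then show "rabi_eigenvalue s \<Delta> g E"
      unfolding rabi_eigenvalue_def using u0 u2[unfolded l2_def] by blast
  }
qed

section \<open>Size of the displaced number states near the diagonal\<close>

declare disp.simps [simp del]

section \<open>Concentration of a displaced state around its own index\<close>

lemma disp_shifted_mult:
  "(real k - real m) * disp \<beta> m k
     = \<beta>\<^sup>2 * disp \<beta> m k - \<beta> * sqrt (real (Suc m)) * disp \<beta> (Suc m) k - \<beta> * sqrt (real m) * disp \<beta> (m - 1) k"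
proof -
  have "\<beta> * (sqrt (real (Suc m)) * disp \<beta> (Suc m) k) = \<beta> * (sqrt (real k) * disp \<beta> m (k - 1) + \<beta> * disp \<beta> m k)"
    unfolding disp_raise ..
  moreover have "\<beta> * (sqrt (real m) * disp \<beta> (m - 1) k)
      = \<beta> * (sqrt (real (Suc k)) * disp \<beta> m (Suc k) + \<beta> * disp \<beta> m k)"
    unfolding disp_lower ..
  ultimately show ?thesis
    using disp_three_term[of \<beta> k m] by (simp add: algebra_simps power2_eq_square del: disp.simps)
qed

text \<open>In terms of the displaced ladder operators, multiplication by k - m sends the state to a
  combination of itself and its two neighbours, so the moment is the sum of the three squared
  coefficients. For m = 0 the neighbour m - 1 would coincide with m.\<close>

lemma disp_second_moment:
  assumes "m \<ge> 1"
  shows "(\<lambda>k. ((real k - real m) * disp \<beta> m k)\<^sup>2) sums (\<beta> ^ 4 + \<beta>\<^sup>2 * (2 * real m + 1))"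
proof -
  interpret D: orthogonal_matrix "disp \<beta>" by (rule orthogonal_disp)
  let ?A = "disp \<beta> m" and ?B = "disp \<beta> (Suc m)" and ?C = "disp \<beta> (m - 1)"
  let ?a = "\<beta>\<^sup>2" and ?b = "\<beta> * sqrt (real (Suc m))" and ?c = "\<beta> * sqrt (real m)"
  have "(\<lambda>k. ?a\<^sup>2 * (?A k * ?A k) + ?b\<^sup>2 * (?B k * ?B k) + ?c\<^sup>2 * (?C k * ?C k)
        - 2 * ?a * ?b * (?A k * ?B k) - 2 * ?a * ?c * (?A k * ?C k) + 2 * ?b * ?c * (?B k * ?C k)) sums
      (?a\<^sup>2 * 1 + ?b\<^sup>2 * 1 + ?c\<^sup>2 * 1 - 2 * ?a * ?b * 0 - 2 * ?a * ?c * 0 + 2 * ?b * ?c * 0)"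
    using D.rows[of m m] D.rows[of "Suc m" "Suc m"] D.rows[of "m - 1" "m - 1"] D.rows[of m "Suc m"]
      D.rows[of m "m - 1"] D.rows[of "Suc m" "m - 1"] assms
    by (intro sums_add sums_diff sums_mult) (simp_all del: disp.simps split: if_splits)
  moreover have "?a\<^sup>2 * (?A k * ?A k) + ?b\<^sup>2 * (?B k * ?B k) + ?c\<^sup>2 * (?C k * ?C k)
        - 2 * ?a * ?b * (?A k * ?B k) - 2 * ?a * ?c * (?A k * ?C k) + 2 * ?b * ?c * (?B k * ?C k)
      = ((real k - real m) * disp \<beta> m k)\<^sup>2" for k
  proof -
    have "(a * A - b * B - c * C)\<^sup>2 = a\<^sup>2 * (A * A) + b\<^sup>2 * (B * B) + c\<^sup>2 * (C * C)
        - 2 * a * b * (A * B) - 2 * a * c * (A * C) + 2 * b * c * (B * C)" for a b c A B C :: real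
      by (simp add: power2_eq_square algebra_simps)
    then show ?thesis unfolding disp_shifted_mult by simp
  qed
  moreover have "?a\<^sup>2 * 1 + ?b\<^sup>2 * 1 + ?c\<^sup>2 * 1 - 2 * ?a * ?b * 0 - 2 * ?a * ?c * 0 + 2 * ?b * ?c * 0
      = \<beta> ^ 4 + \<beta>\<^sup>2 * (2 * real m + 1)"
    by (simp add: power_mult_distrib algebra_simps)
  ultimately show ?thesis by (simp only:)
qed

text \<open>Chebyshev's inequality; an integer outside the window is at distance at least R + 1,
  whence the bound on r.\<close>

lemma disp_mass_near:
  assumes "m \<ge> 1" "r > 0" "r \<le> real (Suc R)"
  shows "(\<Sum>k\<in>{m-R..m+R}. (disp \<beta> m k)\<^sup>2) \<ge> 1 - (\<beta> ^ 4 + \<beta>\<^sup>2 * (2 * real m + 1)) / r\<^sup>2"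
proof -
  let ?v = "disp \<beta> m" and ?I = "{m-R..m+R}"
  interpret D: orthogonal_matrix "disp \<beta>" by (rule orthogonal_disp)
  have "(\<lambda>k. (?v k)\<^sup>2) sums 1"
    using D.rows[of m m] by (simp add: power2_eq_square)
  moreover have "(\<lambda>k. (if k \<in> ?I then (?v k)\<^sup>2 else 0) + ((real k - real m) * ?v k)\<^sup>2 / r\<^sup>2) sums
       ((\<Sum>k\<in>?I. (?v k)\<^sup>2) + (\<beta> ^ 4 + \<beta>\<^sup>2 * (2 * real m + 1)) / r\<^sup>2)"
    by (intro sums_add sums_divide disp_second_moment assms sums_If_finite_set) simp
  moreover have "(?v k)\<^sup>2 \<le> (if k \<in> ?I then (?v k)\<^sup>2 else 0) + ((real k - real m) * ?v k)\<^sup>2 / r\<^sup>2" for k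
  proof (cases "k \<in> ?I")
    case False
    then have "r \<le> \<bar>real k - real m\<bar>" using assms(3) by auto
    then have "r\<^sup>2 \<le> (real k - real m)\<^sup>2" using assms(2) by (simp add: abs_le_square_iff[symmetric])
    then have "r\<^sup>2 * (?v k)\<^sup>2 \<le> ((real k - real m) * ?v k)\<^sup>2"
      by (simp add: power_mult_distrib mult_right_mono)
    then show ?thesis using False assms(2) by (simp add: field_simps)
  qed simp
  ultimately have "1 \<le> (\<Sum>k\<in>?I. (?v k)\<^sup>2) + (\<beta> ^ 4 + \<beta>\<^sup>2 * (2 * real m + 1)) / r\<^sup>2"
    by (rule sums_le[rotated])
  then show ?thesis by simp
qed

text \<open>
  Writing $a_k = \beta\sqrt k$, $d_k = k + \beta^2 - m$ and $v$ for the displaced state, the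
  recurrence is $a_{k+1} v_{k+1} + d_k v_k + a_k v_{k-1} = 0$, so $X = a_{k+1}v_{k+1}$ and $Y = a_k v_{k-1}$
  satisfy $X^2 + d_k v_k X = Y^2 + d_k v_k Y$. The energy is built from this invariant and is positive
  definite as long as $|d_k| < 2 a_k$; its relative change per step is of order $m^{-1/2}$.
\<close>

definition disp_energy :: "real \<Rightarrow> nat \<Rightarrow> nat \<Rightarrow> real" where
  "disp_energy \<beta> m k = \<beta>\<^sup>2 * real k * ((disp \<beta> m k)\<^sup>2 + (disp \<beta> m (k - 1))\<^sup>2)
     + (real k + \<beta>\<^sup>2 - real m) * (\<beta> * sqrt (real k)) * (disp \<beta> m k * disp \<beta> m (k - 1))"

text \<open>The invariant cancels X^2 against Y^2 together with the cross terms taken with the same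
  d. What remains comes from the growth of the coefficients: \<beta>^2 from b^2 - a^2, and the cross
  term from d increasing by 1.\<close>

lemma disp_energy_step:
  "disp_energy \<beta> m (Suc k) - disp_energy \<beta> m k
     = \<beta>\<^sup>2 * (disp \<beta> m k)\<^sup>2 + \<beta> * sqrt (real (Suc k)) * (disp \<beta> m k * disp \<beta> m (Suc k))"
proof -
  define v Y X where "v = disp \<beta> m k" and "Y = disp \<beta> m (k - 1)" and "X = disp \<beta> m (Suc k)"
  define a b d where "a = \<beta> * sqrt (real k)" and "b = \<beta> * sqrt (real (Suc k))" and "d = real k + \<beta>\<^sup>2 - real m"
  have a2: "\<beta>\<^sup>2 * real k = a\<^sup>2" and b2: "\<beta>\<^sup>2 * real (Suc k) = b\<^sup>2"
    unfolding a_def b_def by (simp_all add: power_mult_distrib)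
  have ab: "b\<^sup>2 = a\<^sup>2 + \<beta>\<^sup>2" unfolding a2[symmetric] b2[symmetric] by (simp add: algebra_simps)
  have t: "b * X = - (a * Y + d * v)"
    using disp_three_term[of \<beta> k m] unfolding a_def b_def d_def v_def X_def Y_def by linarith
  have "b\<^sup>2 * X\<^sup>2 + d * b * (X * v) = (b * X) * (b * X + d * v)"
    by (simp add: algebra_simps power2_eq_square)
  also have "\<dots> = a\<^sup>2 * Y\<^sup>2 + d * a * (v * Y)"
    unfolding t by (simp add: algebra_simps power2_eq_square)
  finally have 1: "b\<^sup>2 * X\<^sup>2 + d * b * (X * v) = a\<^sup>2 * Y\<^sup>2 + d * a * (v * Y)" .
  have e1: "disp_energy \<beta> m (Suc k) = b\<^sup>2 * (X\<^sup>2 + v\<^sup>2) + (d + 1) * b * (X * v)"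
    unfolding disp_energy_def b2 unfolding X_def v_def b_def d_def by (simp add: algebra_simps)
  have e0: "disp_energy \<beta> m k = a\<^sup>2 * (v\<^sup>2 + Y\<^sup>2) + d * a * (v * Y)"
    unfolding disp_energy_def a2 unfolding Y_def v_def a_def d_def ..
  have "disp_energy \<beta> m (Suc k) - disp_energy \<beta> m k = (b\<^sup>2 * X\<^sup>2 + d * b * (X * v)) - (a\<^sup>2 * Y\<^sup>2 + d * a * (v * Y))
      + b\<^sup>2 * v\<^sup>2 - a\<^sup>2 * v\<^sup>2 + b * (v * X)"
    unfolding e0 e1 by (simp add: algebra_simps)
  also have "\<dots> = \<beta>\<^sup>2 * v\<^sup>2 + b * (v * X)" unfolding 1 unfolding ab by (simp add: algebra_simps)
  finally show ?thesis unfolding v_def X_def b_def .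
qed

text \<open>As 7/4 < 2, the cross term is at most 7/8 of the diagonal part, which leaves 1/8 below
  and less than 2 above.\<close>

lemma quadratic_form_bounds:
  fixes a d x y :: real
  assumes "a \<ge> 0" "\<bar>d\<bar> \<le> 7/4 * a"
  shows "a\<^sup>2 * (x\<^sup>2 + y\<^sup>2) / 8 \<le> a\<^sup>2 * (x\<^sup>2 + y\<^sup>2) + d * a * (x * y)"
    and "a\<^sup>2 * (x\<^sup>2 + y\<^sup>2) + d * a * (x * y) \<le> 2 * (a\<^sup>2 * (x\<^sup>2 + y\<^sup>2))"
proof -
  have "\<bar>d * a * (x * y)\<bar> = (\<bar>d\<bar> * a) * \<bar>x * y\<bar>" using assms(1) by (simp add: abs_mult)
  also have "\<dots> \<le> (7/4 * a * a) * ((x\<^sup>2 + y\<^sup>2) / 2)"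
  proof (intro mult_mono)
    have "2 * \<bar>x * y\<bar> \<le> x\<^sup>2 + y\<^sup>2"
      using sum_squares_bound[of "\<bar>x\<bar>" "\<bar>y\<bar>"] by (simp add: abs_mult)
    then show "\<bar>x * y\<bar> \<le> (x\<^sup>2 + y\<^sup>2) / 2" by simp
  qed (use assms in \<open>auto intro!: mult_right_mono\<close>)
  finally have *: "\<bar>d * a * (x * y)\<bar> \<le> 7/8 * (a\<^sup>2 * (x\<^sup>2 + y\<^sup>2))"
    by (simp add: power2_eq_square)
  have "0 \<le> a\<^sup>2 * (x\<^sup>2 + y\<^sup>2)" by simp
  then show "a\<^sup>2 * (x\<^sup>2 + y\<^sup>2) / 8 \<le> a\<^sup>2 * (x\<^sup>2 + y\<^sup>2) + d * a * (x * y)"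
    "a\<^sup>2 * (x\<^sup>2 + y\<^sup>2) + d * a * (x * y) \<le> 2 * (a\<^sup>2 * (x\<^sup>2 + y\<^sup>2))"
    using * by (simp_all only: abs_le_iff) linarith+
qed

lemma disp_energy_compare:
  assumes "\<beta> > 0" "k \<ge> 1" "(real k + \<beta>\<^sup>2 - real m)\<^sup>2 \<le> (7/4)\<^sup>2 * (\<beta>\<^sup>2 * real k)"
  shows "\<beta>\<^sup>2 * real k * ((disp \<beta> m k)\<^sup>2 + (disp \<beta> m (k - 1))\<^sup>2) / 8 \<le> disp_energy \<beta> m k"
    and "disp_energy \<beta> m k \<le> 2 * (\<beta>\<^sup>2 * real k * ((disp \<beta> m k)\<^sup>2 + (disp \<beta> m (k - 1))\<^sup>2))"
proof -
  let ?a = "\<beta> * sqrt (real k)"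
  have a2: "\<beta>\<^sup>2 * real k = ?a\<^sup>2" by (simp add: power_mult_distrib)
  have "(real k + \<beta>\<^sup>2 - real m)\<^sup>2 \<le> (7/4 * ?a)\<^sup>2"
    using assms(3) unfolding power_mult_distrib[of "7/4"] a2 .
  then have "\<bar>real k + \<beta>\<^sup>2 - real m\<bar> \<le> \<bar>7/4 * ?a\<bar>"
    by (simp only: abs_le_square_iff)
  also have "\<bar>7/4 * ?a\<bar> = 7/4 * ?a"
    using assms(1) by (intro abs_of_nonneg) simp
  finally have "\<bar>real k + \<beta>\<^sup>2 - real m\<bar> \<le> 7/4 * ?a" .
  then show "\<beta>\<^sup>2 * real k * ((disp \<beta> m k)\<^sup>2 + (disp \<beta> m (k - 1))\<^sup>2) / 8 \<le> disp_energy \<beta> m k"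
    "disp_energy \<beta> m k \<le> 2 * (\<beta>\<^sup>2 * real k * ((disp \<beta> m k)\<^sup>2 + (disp \<beta> m (k - 1))\<^sup>2))"
    unfolding disp_energy_def a2 using assms(1) quadratic_form_bounds[of ?a] by auto
qed

lemma iterate_ratio_bound:
  fixes q :: "nat \<Rightarrow> real"
  assumes "\<And>i. k \<le> i \<Longrightarrow> i < k + d \<Longrightarrow> q (Suc i) \<le> \<rho> * q i \<and> q i \<le> \<rho> * q (Suc i)" "\<rho> \<ge> 0"
  shows "q (k + d) \<le> \<rho> ^ d * q k \<and> q k \<le> \<rho> ^ d * q (k + d)"
  using assms(1)
proof (induction d)
  case (Suc d)
  have IH: "q (k + d) \<le> \<rho> ^ d * q k" "q k \<le> \<rho> ^ d * q (k + d)" using Suc by auto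
  have st: "q (Suc (k + d)) \<le> \<rho> * q (k + d)" "q (k + d) \<le> \<rho> * q (Suc (k + d))" using Suc(2)[of "k + d"] by auto
  have "q (k + Suc d) \<le> \<rho> ^ Suc d * q k"
    using order_trans[OF st(1) mult_left_mono[OF IH(1) assms(2)]] by (simp add: mult.assoc)
  moreover have "q k \<le> \<rho> ^ Suc d * q (k + Suc d)"
    using order_trans[OF IH(2) mult_left_mono[OF st(2) zero_le_power[OF assms(2), of d]]] by (simp add: ac_simps)
  ultimately show ?case by blast
qed simp

text \<open>The energy changes by a factor 1 + O(m^(-1/2)) per step over O(sqrt m) steps, so across
  the window it is constant up to K. Averaging over the window then fixes its size, since the total
  mass there is bounded above and below. A collects the two terms of
  \<open>disp_energy_step\<close>: 9 for the square and 5/\<beta> for the cross term.\<close>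

lemma disp_bulk_aux:
  fixes \<beta> :: real and m :: nat
  defines "r \<equiv> 3/2 * \<beta> * sqrt (real m)"
  defines "A \<equiv> 9 + 5 / \<beta>"
  assumes \<beta>: "\<beta> > 0" and m1: "m \<ge> 1" and c1: "\<beta>\<^sup>2 + 2 \<le> \<beta> * sqrt (real m) / 10"
    and c2: "r + 2 \<le> real m / 10" and c3: "A / sqrt (real m) \<le> 1/2" and c4: "\<beta>\<^sup>2 + 1 \<le> real m / 40"
    and l: "\<bar>real l - real m\<bar> \<le> r"
  shows "(disp \<beta> m l)\<^sup>2 + (disp \<beta> m (l - 1))\<^sup>2 \<le> (40 * exp (16 * A * \<beta>) / \<beta>) / sqrt (real m)"
    and "(1 / (1000 * \<beta> * exp (16 * A * \<beta>))) / sqrt (real m) \<le> (disp \<beta> m l)\<^sup>2 + (disp \<beta> m (l - 1))\<^sup>2"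
proof -
  let ?v = "disp \<beta> m" and ?q = "disp_energy \<beta> m" and ?s = "sqrt (real m)"
  define R where "R = nat \<lfloor>r\<rfloor>"
  define K where "K = exp (16 * A * \<beta>)"
  have K1: "K \<ge> 1" "K > 0" unfolding K_def A_def using \<beta> by auto
  have s0: "?s \<ge> 1" "?s > 0" using m1 by auto
  have ss: "?s * ?s = real m" by simp
  have r0: "r \<ge> 0" unfolding r_def using \<beta> by simp
  have RR: "real R \<le> r" "r < real (Suc R)" unfolding R_def using r0 by linarith+
  have "\<beta> * ?s \<ge> 20" using c1 zero_le_power2[of \<beta>] by linarith
  then have r1: "r \<ge> 1" unfolding r_def by simp
  have mem: "k \<in> {m-R..m+R} \<longleftrightarrow> \<bar>real k - real m\<bar> \<le> r" for k
  proof
    assume "k \<in> {m-R..m+R}"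
    then have "k \<le> m + R" "m \<le> k + R" by auto
    then have "real k \<le> real m + real R" "real m \<le> real k + real R" by linarith+
    then show "\<bar>real k - real m\<bar> \<le> r" using RR by linarith
  next
    assume "\<bar>real k - real m\<bar> \<le> r"
    then have "real k < real (m + Suc R)" "real m < real (k + Suc R)" using RR by (simp_all add: abs_le_iff)
    then have "k < m + Suc R" "m < k + Suc R" unfolding of_nat_less_iff .
    then show "k \<in> {m-R..m+R}" by auto
  qed
  have rng: "9/10 * real m \<le> real k \<and> real k \<le> 11/10 * real m" if "\<bar>real k - real m\<bar> \<le> r" for k
    using that c2 by (simp add: abs_le_iff)
  have pos: "k \<ge> 1" if "\<bar>real k - real m\<bar> \<le> r" for k
    using rng[OF that] m1 by (cases k) auto
  have cmp: "\<beta>\<^sup>2 * real k * ((?v k)\<^sup>2 + (?v (k - 1))\<^sup>2) / 8 \<le> ?q k"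
      "?q k \<le> 2 * (\<beta>\<^sup>2 * real k * ((?v k)\<^sup>2 + (?v (k - 1))\<^sup>2))" if k: "\<bar>real k - real m\<bar> \<le> r" for k
  proof -
    \<comment> \<open>8/5 is the window constant 3/2 plus the 1/10 that \<open>c1\<close> allows for
      \<beta>^2; since (8/5)^2 is below (7/4)^2 times 9/10, m can then be traded for k.\<close>
    have "\<bar>real k + \<beta>\<^sup>2 - real m\<bar> \<le> 8/5 * \<beta> * ?s"
      using k c1 unfolding r_def abs_le_iff using zero_le_power2[of \<beta>] by linarith
    then have "(real k + \<beta>\<^sup>2 - real m)\<^sup>2 \<le> (8/5 * \<beta> * ?s)\<^sup>2"
      by (metis abs_ge_zero power2_abs power_mono)
    also have "\<dots> = (8/5)\<^sup>2 * \<beta>\<^sup>2 * real m"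
      by (simp only: power_mult_distrib real_sqrt_pow2 of_nat_0_le_iff)
    also have "\<dots> \<le> (7/4)\<^sup>2 * \<beta>\<^sup>2 * (9/10 * real m)"
      using \<beta> by (simp add: field_simps power2_eq_square)
    also have "\<dots> \<le> (7/4)\<^sup>2 * \<beta>\<^sup>2 * real k"
      using rng[OF k] by (intro mult_left_mono) auto
    finally have "(real k + \<beta>\<^sup>2 - real m)\<^sup>2 \<le> (7/4)\<^sup>2 * (\<beta>\<^sup>2 * real k)" by simp
    from disp_energy_compare[OF \<beta> pos[OF k] this] show "\<beta>\<^sup>2 * real k * ((?v k)\<^sup>2 + (?v (k - 1))\<^sup>2) / 8 \<le> ?q k"
      "?q k \<le> 2 * (\<beta>\<^sup>2 * real k * ((?v k)\<^sup>2 + (?v (k - 1))\<^sup>2))" .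
  qed
  have q0: "?q k \<ge> 0" if "\<bar>real k - real m\<bar> \<le> r" for k
    using cmp(1)[OF that] by (rule order_trans[rotated]) simp
  define \<eta> where "\<eta> = A / ?s"
  have \<eta>0: "\<eta> \<ge> 0" "\<eta> \<le> 1/2" using c3 s0 \<beta> unfolding \<eta>_def A_def by auto
  have step: "?q (Suc i) \<le> (1 + 4 * \<eta>) * ?q i \<and> ?q i \<le> (1 + 4 * \<eta>) * ?q (Suc i)"
    if i: "\<bar>real i - real m\<bar> \<le> r" "\<bar>real (Suc i) - real m\<bar> \<le> r" for i
  proof -
    have ip: "real i > 0" using pos[OF i(1)] by simp
    have "\<beta>\<^sup>2 * real i * (?v i)\<^sup>2 \<le> \<beta>\<^sup>2 * real i * ((?v i)\<^sup>2 + (?v (i - 1))\<^sup>2)"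
      by (intro mult_left_mono) auto
    also have "\<dots> \<le> 8 * ?q i" using cmp(1)[OF i(1)] by linarith
    finally have "\<beta>\<^sup>2 * (?v i)\<^sup>2 * real i \<le> 8 * ?q i" by (simp only: ac_simps)
    then have a: "\<beta>\<^sup>2 * (?v i)\<^sup>2 \<le> 8 * ?q i / real i"
      using ip by (simp only: pos_le_divide_eq)
    have "8 * ?q i / real i \<le> 8 * ?q i / (9/10 * real m)"
      using rng[OF i(1)] q0[OF i(1)] m1 by (intro divide_left_mono) auto
    also have "\<dots> \<le> (9 / ?s) * ?q i"
    proof -
      have "?q i * (?s * 80) \<le> ?q i * (real m * 81)"
      proof (rule mult_left_mono[OF _ q0[OF i(1)]])
        have "?s * 1 \<le> ?s * ?s" using s0 by (intro mult_left_mono) auto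
        then show "?s * 80 \<le> real m * 81" unfolding ss by simp
      qed
      then show ?thesis using s0 m1 by (simp add: field_simps)
    qed
    finally have a': "\<beta>\<^sup>2 * (?v i)\<^sup>2 \<le> (9 / ?s) * ?q i" using a by simp
    let ?b = "\<beta> * sqrt (real (Suc i))"
    have b0: "?b > 0" using \<beta> by simp
    have bb: "?b * ?b = \<beta>\<^sup>2 * real (Suc i)" by (simp add: power2_eq_square)
    have b1: "?b \<ge> 9/10 * (\<beta> * ?s)"
    proof -
      have "sqrt (real (Suc i)) \<ge> sqrt (9/10 * real m)" using rng[OF i(2)] by simp
      also have "sqrt (9/10 * real m) = sqrt (9/10) * ?s" by (rule real_sqrt_mult)
      finally have "sqrt (9/10) * ?s \<le> sqrt (real (Suc i))" .
      moreover have "9/10 \<le> sqrt (9/10)" by (rule real_le_rsqrt) (simp add: power2_eq_square)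
      ultimately have "9/10 * ?s \<le> sqrt (real (Suc i))"
        using s0 by (meson mult_right_mono order_trans less_imp_le)
      then show ?thesis using mult_left_mono[of "9/10 * ?s" "sqrt (real (Suc i))" \<beta>] \<beta> by (simp add: ac_simps)
    qed
    have "\<bar>?b * (?v i * ?v (Suc i))\<bar> = ?b * \<bar>?v i * ?v (Suc i)\<bar>"
      unfolding abs_mult[of ?b] using b0 by (simp only: abs_of_pos)
    also have "\<dots> \<le> ?b * (((?v (Suc i))\<^sup>2 + (?v i)\<^sup>2) / 2)"
    proof -
      have "2 * \<bar>?v i * ?v (Suc i)\<bar> \<le> (?v (Suc i))\<^sup>2 + (?v i)\<^sup>2"
        using sum_squares_bound[of "\<bar>?v i\<bar>" "\<bar>?v (Suc i)\<bar>"] unfolding abs_mult power2_abs by linarith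
      then show ?thesis using b0 by (intro mult_left_mono) auto
    qed
    also have "\<dots> \<le> 4 * ?q (Suc i) / ?b"
    proof -
      have "?b * ?b * ((?v (Suc i))\<^sup>2 + (?v i)\<^sup>2) / 8 \<le> ?q (Suc i)"
        using cmp(1)[OF i(2)] unfolding bb by simp
      moreover have "x * (w / 2) * x = 4 * (x * x * w / 8)" for x w :: real by simp
      ultimately have "?b * (((?v (Suc i))\<^sup>2 + (?v i)\<^sup>2) / 2) * ?b \<le> 4 * ?q (Suc i)"
        by (simp only:)
      then show ?thesis using b0 pos_le_divide_eq by blast
    qed
    also have "\<dots> \<le> 4 * ?q (Suc i) / (9/10 * (\<beta> * ?s))"
      using b1 b0 q0[OF i(2)] \<beta> s0 by (intro divide_left_mono) auto
    also have "\<dots> \<le> (5 / \<beta> / ?s) * ?q (Suc i)"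
      using q0[OF i(2)] \<beta> s0 by (simp add: field_simps)
    finally have b': "\<bar>?b * (?v i * ?v (Suc i))\<bar> \<le> (5 / \<beta> / ?s) * ?q (Suc i)" .
    have "\<bar>?q (Suc i) - ?q i\<bar> \<le> \<bar>\<beta>\<^sup>2 * (?v i)\<^sup>2\<bar> + \<bar>?b * (?v i * ?v (Suc i))\<bar>"
      unfolding disp_energy_step by (rule abs_triangle_ineq)
    then have "\<bar>?q (Suc i) - ?q i\<bar> \<le> (9 / ?s) * ?q i + (5 / \<beta> / ?s) * ?q (Suc i)"
      using a' b' by simp
    also have "\<dots> \<le> \<eta> * ?q i + \<eta> * ?q (Suc i)"
    proof -
      have "9 / ?s \<le> \<eta>" "5 / \<beta> / ?s \<le> \<eta>"
        unfolding \<eta>_def A_def by (rule divide_right_mono; use \<beta> s0 in simp)+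
      then show ?thesis using q0[OF i(1)] q0[OF i(2)] by (intro add_mono mult_right_mono)
    qed
    finally have d: "\<bar>?q (Suc i) - ?q i\<bar> \<le> \<eta> * ?q i + \<eta> * ?q (Suc i)" .
    \<comment> \<open>For \<eta> at most 1/2 the ratio (1 + \<eta>)/(1 - \<eta>) is at most 1 +
      4\<eta>.\<close>
    have gen: "y \<le> (1 + 4 * \<eta>) * x" if "y - x \<le> \<eta> * x + \<eta> * y" "x \<ge> 0" "y \<ge> 0" for x y
    proof -
      have "0 \<le> \<eta> * (2 - 4 * \<eta>) * x" using \<eta>0 that by simp
      then have "(1 - \<eta>) * y \<le> (1 - \<eta>) * ((1 + 4 * \<eta>) * x)"
        using that(1) by (simp add: algebra_simps)
      then show ?thesis using \<eta>0 by (simp add: mult_le_cancel_left)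
    qed
    show ?thesis
      using d gen[of "?q (Suc i)" "?q i"] gen[of "?q i" "?q (Suc i)"] q0[OF i(1)] q0[OF i(2)]
      by (auto simp: abs_le_iff)
  qed
  have comp: "?q j \<le> K * ?q k \<and> ?q k \<le> K * ?q j"
    if jk: "\<bar>real j - real m\<bar> \<le> r" "\<bar>real k - real m\<bar> \<le> r" "k \<le> j" for j k
  proof -
    have in_r: "\<bar>real i - real m\<bar> \<le> r" if "k \<le> i" "i \<le> j" for i
    proof -
      have "real k \<le> real i" "real i \<le> real j" using that by auto
      then show ?thesis using jk(1,2) by linarith
    qed
    have *: "?q (k + (j - k)) \<le> (1 + 4 * \<eta>) ^ (j - k) * ?q k \<and> ?q k \<le> (1 + 4 * \<eta>) ^ (j - k) * ?q (k + (j - k))"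
    proof (rule iterate_ratio_bound)
      fix i assume "k \<le> i" "i < k + (j - k)"
      then show "?q (Suc i) \<le> (1 + 4 * \<eta>) * ?q i \<and> ?q i \<le> (1 + 4 * \<eta>) * ?q (Suc i)"
        by (intro step in_r) auto
    qed (use \<eta>0 in simp)
    have "(1 + 4 * \<eta>) ^ (j - k) \<le> exp (4 * \<eta>) ^ (j - k)"
      using \<eta>0 by (intro power_mono) (auto simp: exp_ge_add_one_self)
    also have "\<dots> = exp (real (j - k) * (4 * \<eta>))" by (rule exp_of_nat_mult[symmetric])
    also have "\<dots> \<le> K"
    proof -
      \<comment> \<open>The window has at most 2r = 3 \<beta> sqrt m steps and \<eta> is A / sqrt m,
        so m drops out of the exponent.\<close>
      have "real (j - k) \<le> 2 * r" using jk by (simp add: abs_le_iff)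
      then have "real (j - k) * (4 * \<eta>) \<le> 2 * r * (4 * \<eta>)" using \<eta>0 by (intro mult_right_mono) auto
      also have "\<dots> = 12 * A * \<beta>" unfolding \<eta>_def r_def using s0 by simp
      also have "\<dots> \<le> 16 * A * \<beta>" using \<beta> unfolding A_def by (simp add: field_simps)
      finally show ?thesis unfolding K_def by simp
    qed
    finally have K: "(1 + 4 * \<eta>) ^ (j - k) \<le> K" .
    show ?thesis using * mult_right_mono[OF K q0[OF jk(1)]] mult_right_mono[OF K q0[OF jk(2)]] jk(3)
      by auto
  qed
  have comp: "?q j \<le> K * ?q k" if "\<bar>real j - real m\<bar> \<le> r" "\<bar>real k - real m\<bar> \<le> r" for j k
    using comp[of j k] comp[of k j] that by (cases "k \<le> j") auto
  let ?I = "{m-R..m+R}"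
  have inI: "\<bar>real k - real m\<bar> \<le> r" if "k \<in> ?I" for k using that mem by blast
  have cardU: "real (card ?I) \<le> 3 * r" using RR r1 by auto
  have cardL: "r \<le> real (card ?I)" using RR by auto
  have ub: "r * ?q l \<le> K * (\<beta>\<^sup>2 * (11/10 * real m) * 6)"
  proof -
    have sp: "(\<Sum>k\<in>?I. (?v k)\<^sup>2) \<le> 1" 
      using nsq_ge_sum[OF l2_disp, of ?I \<beta> m] orthogonal_matrix.nsq_row[OF orthogonal_disp, of \<beta> m] by simp
    \<comment> \<open>The shifted sequence counts component 0 twice, because 0 - 1 = 0; hence the
      bound 2 and a total of 3.\<close>
    have "(\<Sum>k\<in>?I. (?v (k - 1))\<^sup>2) \<le> nsq (\<lambda>k. ?v (k - 1))"
      by (rule nsq_ge_sum[OF l2_pred[OF l2_disp]]) simp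
    also have "\<dots> = (?v 0)\<^sup>2 + nsq ?v"
      unfolding nsq_def
      using suminf_split_head[OF l2_pred[OF l2_disp, unfolded l2_def], of \<beta> m] by (simp del: disp.simps)
    also have "\<dots> \<le> 2"
      using nsq_ge_sum[OF l2_disp, of "{0}" \<beta> m] orthogonal_matrix.nsq_row[OF orthogonal_disp, of \<beta> m] by simp
    finally have "(\<Sum>k\<in>?I. (?v k)\<^sup>2 + (?v (k - 1))\<^sup>2) \<le> 3" using sp by (simp add: sum.distrib)
    have "r * ?q l \<le> real (card ?I) * ?q l" using cardL q0[OF l] by (rule mult_right_mono)
    also have "\<dots> = (\<Sum>k\<in>?I. ?q l)" by (simp only: sum_constant)
    also have "\<dots> \<le> (\<Sum>k\<in>?I. K * (2 * (\<beta>\<^sup>2 * (11/10 * real m) * ((?v k)\<^sup>2 + (?v (k - 1))\<^sup>2))))"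
    proof (rule sum_mono)
      fix k assume k: "k \<in> ?I"
      have "?q l \<le> K * ?q k" using comp[OF l inI[OF k]] .
      also have "?q k \<le> 2 * (\<beta>\<^sup>2 * real k * ((?v k)\<^sup>2 + (?v (k - 1))\<^sup>2))" by (rule cmp(2)[OF inI[OF k]])
      also have "\<dots> \<le> 2 * (\<beta>\<^sup>2 * (11/10 * real m) * ((?v k)\<^sup>2 + (?v (k - 1))\<^sup>2))"
        using rng[OF inI[OF k]] by (intro mult_left_mono mult_right_mono) auto
      finally show "?q l \<le> K * (2 * (\<beta>\<^sup>2 * (11/10 * real m) * ((?v k)\<^sup>2 + (?v (k - 1))\<^sup>2)))"
        using K1 by simp
    qed
    also have "\<dots> = K * (2 * (\<beta>\<^sup>2 * (11/10 * real m) * (\<Sum>k\<in>?I. (?v k)\<^sup>2 + (?v (k - 1))\<^sup>2)))"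
      by (simp only: sum_distrib_left)
    also have "\<dots> \<le> K * (2 * (\<beta>\<^sup>2 * (11/10 * real m) * 3))"
      using K1 \<open>_ \<le> 3\<close> by (intro mult_left_mono) auto
    finally show ?thesis by simp
  qed
  have mass: "1/10 \<le> (\<Sum>k\<in>?I. (?v k)\<^sup>2)"
  proof -
    \<comment> \<open>By \<open>c4\<close> the second moment is at most 81/40 \<beta>^2 m, against
      r^2 = 9/4 \<beta>^2 m; the quotient 9/10 leaves mass 1/10 in the window.\<close>
    have "(\<beta> ^ 4 + \<beta>\<^sup>2 * (2 * real m + 1)) / r\<^sup>2 \<le> 9/10"
    proof -
      have "\<beta> ^ 4 + \<beta>\<^sup>2 * (2 * real m + 1) = \<beta>\<^sup>2 * (\<beta>\<^sup>2 + 1 + 2 * real m)"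
        by (simp add: power2_eq_square power4_eq_xxxx algebra_simps)
      also have "\<dots> \<le> \<beta>\<^sup>2 * (real m * 81 / 40)" using c4 by (intro mult_left_mono) auto
      also have "\<dots> = 9/10 * r\<^sup>2" unfolding r_def by (simp add: power_mult_distrib power_divide)
      finally show ?thesis using r1 by (simp add: divide_le_eq)
    qed
    moreover have "1 - (\<beta> ^ 4 + \<beta>\<^sup>2 * (2 * real m + 1)) / r\<^sup>2 \<le> (\<Sum>k\<in>?I. (?v k)\<^sup>2)"
      by (rule disp_mass_near[OF m1]) (use RR r1 in auto)
    ultimately show ?thesis by linarith
  qed
  have lb: "\<beta>\<^sup>2 * (9/10 * real m) / 80 \<le> 3 * r * (K * ?q l)"
  proof -
    have "\<beta>\<^sup>2 * (9/10 * real m) / 80 \<le> \<beta>\<^sup>2 * (9/10 * real m) / 8 * (\<Sum>k\<in>?I. (?v k)\<^sup>2)"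
    proof -
      have "\<beta>\<^sup>2 * (9/10 * real m) / 8 * (1/10) \<le> \<beta>\<^sup>2 * (9/10 * real m) / 8 * (\<Sum>k\<in>?I. (?v k)\<^sup>2)"
        using mass by (intro mult_left_mono) auto
      then show ?thesis by simp
    qed
    also have "\<dots> = (\<Sum>k\<in>?I. \<beta>\<^sup>2 * (9/10 * real m) / 8 * (?v k)\<^sup>2)" by (rule sum_distrib_left)
    also have "\<dots> \<le> (\<Sum>k\<in>?I. K * ?q l)"
    proof (rule sum_mono)
      fix k assume k: "k \<in> ?I"
      have "\<beta>\<^sup>2 * (9/10 * real m) * (?v k)\<^sup>2 \<le> \<beta>\<^sup>2 * real k * ((?v k)\<^sup>2 + (?v (k - 1))\<^sup>2)"
        using rng[OF inI[OF k]] by (intro mult_mono) auto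
      then have "\<beta>\<^sup>2 * (9/10 * real m) / 8 * (?v k)\<^sup>2 \<le> \<beta>\<^sup>2 * real k * ((?v k)\<^sup>2 + (?v (k - 1))\<^sup>2) / 8"
      proof -
        have "x * y \<le> z \<Longrightarrow> x / 8 * y \<le> z / 8" for x y z :: real by simp
        then show "\<beta>\<^sup>2 * (9/10 * real m) * (?v k)\<^sup>2 \<le> \<beta>\<^sup>2 * real k * ((?v k)\<^sup>2 + (?v (k - 1))\<^sup>2) \<Longrightarrow> ?thesis" .
      qed
      also have "\<dots> \<le> ?q k" by (rule cmp(1)[OF inI[OF k]])
      also have "\<dots> \<le> K * ?q l" using comp[OF inI[OF k] l] .
      finally show "\<beta>\<^sup>2 * (9/10 * real m) / 8 * (?v k)\<^sup>2 \<le> K * ?q l" .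
    qed
    also have "\<dots> = real (card ?I) * (K * ?q l)" by (simp only: sum_constant)
    also have "\<dots> \<le> 3 * r * (K * ?q l)" using K1 q0[OF l] cardU by (intro mult_right_mono) auto
    finally show ?thesis .
  qed
  define w where "w = (?v l)\<^sup>2 + (?v (l - 1))\<^sup>2"
  have w0: "w \<ge> 0" unfolding w_def by simp
  have lm: "9/10 * real m \<le> real l" "real l \<le> 11/10 * real m" using rng[OF l] by auto
  have "r * (\<beta>\<^sup>2 * (9/10 * real m) * w / 8) \<le> r * (\<beta>\<^sup>2 * real l * w / 8)"
    using r0 w0 lm by (intro mult_left_mono divide_right_mono mult_right_mono) auto
  also have "\<dots> \<le> r * ?q l"
    using cmp(1)[OF l] r0 unfolding w_def by (intro mult_left_mono) auto
  also have "\<dots> \<le> K * (\<beta>\<^sup>2 * (11/10 * real m) * 6)" by (rule ub)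
  finally have "(\<beta>\<^sup>2 * real m) * (r * w * (9/80)) \<le> (\<beta>\<^sup>2 * real m) * (K * (66/10))" by (simp add: ac_simps)
  then have "r * w * (9/80) \<le> K * (66/10)" using \<beta> m1 by (subst (asm) mult_le_cancel_left_pos) auto
  then have "w * (\<beta> * ?s) \<le> K * (80 * 66 * 2 / (27 * 10))" unfolding r_def by (simp add: ac_simps)
  also have "\<dots> \<le> K * 40" using K1 by simp
  finally have "w \<le> (40 * K / \<beta>) / ?s" using \<beta> s0 by (simp add: field_simps)
  then show "(disp \<beta> m l)\<^sup>2 + (disp \<beta> m (l - 1))\<^sup>2 \<le> (40 * exp (16 * A * \<beta>) / \<beta>) / sqrt (real m)"
    unfolding w_def K_def .
  have "\<beta>\<^sup>2 * (9/10 * real m) / 80 \<le> 3 * r * (K * ?q l)" by (rule lb)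
  also have "\<dots> \<le> 3 * r * (K * (2 * (\<beta>\<^sup>2 * (11/10 * real m) * w)))"
  proof -
    have "?q l \<le> 2 * (\<beta>\<^sup>2 * real l * w)" using cmp(2)[OF l] unfolding w_def .
    also have "\<dots> \<le> 2 * (\<beta>\<^sup>2 * (11/10 * real m) * w)" using lm w0 by (intro mult_left_mono mult_right_mono) auto
    finally show ?thesis using r0 K1 by (intro mult_left_mono) auto
  qed
  finally have "(\<beta>\<^sup>2 * real m) * (9/800) \<le> (\<beta>\<^sup>2 * real m) * (66/10 * r * K * w)" by (simp add: ac_simps)
  then have "9/800 \<le> 66/10 * r * K * w" using \<beta> m1 by (subst (asm) mult_le_cancel_left_pos) auto
  then have "9/8000 \<le> (99/100) * (\<beta> * ?s * K * w)" unfolding r_def by (simp add: ac_simps)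
  then have "1/1000 \<le> \<beta> * ?s * K * w" by linarith
  then have "(1 / (1000 * \<beta> * K)) / ?s \<le> w" using \<beta> s0 K1 by (simp add: field_simps)
  then show "(1 / (1000 * \<beta> * exp (16 * A * \<beta>))) / sqrt (real m) \<le> (disp \<beta> m l)\<^sup>2 + (disp \<beta> m (l - 1))\<^sup>2"
    unfolding w_def K_def .
qed

text \<open>Consecutive entries are paired because a single entry may vanish, while the definite
  energy controls both together.\<close>

theorem disp_bulk:
  assumes \<beta>: "\<beta> > 0"
  obtains c C where "c > 0" "C > 0"
    and "\<forall>\<^sub>F m in sequentially. \<forall>l. \<bar>real l - real m\<bar> \<le> 3/2 * \<beta> * sqrt (real m) \<longrightarrow>
        c / sqrt (real m) \<le> (disp \<beta> m l)\<^sup>2 + (disp \<beta> m (l - 1))\<^sup>2 \<and>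
        (disp \<beta> m l)\<^sup>2 + (disp \<beta> m (l - 1))\<^sup>2 \<le> C / sqrt (real m)"
proof
  let ?A = "9 + 5 / \<beta>"
  let ?K = "exp (16 * ?A * \<beta>)"
  show "1 / (1000 * \<beta> * ?K) > 0" "40 * ?K / \<beta> > 0" using \<beta> by auto
  have "\<forall>\<^sub>F m in sequentially. m \<ge> (1::nat)" by (rule eventually_ge_at_top)
  moreover have "\<forall>\<^sub>F m::nat in sequentially. \<beta>\<^sup>2 + 2 \<le> \<beta> * sqrt (real m) / 10" using \<beta> by real_asymp
  moreover have "\<forall>\<^sub>F m::nat in sequentially. 3/2 * \<beta> * sqrt (real m) + 2 \<le> real m / 10" using \<beta> by real_asymp
  moreover have "\<forall>\<^sub>F m::nat in sequentially. \<beta>\<^sup>2 + 1 \<le> real m / 40" using \<beta> by real_asymp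
  moreover have "\<forall>\<^sub>F m::nat in sequentially. ?A / sqrt (real m) \<le> 1/2"
  proof -
    have "(\<lambda>m. ?A / sqrt (real m)) \<longlonglongrightarrow> 0" by real_asymp
    from order_tendstoD(2)[OF this, of "1/2"] show ?thesis
      by (auto elim!: eventually_mono)
  qed
  ultimately show "\<forall>\<^sub>F m in sequentially. \<forall>l. \<bar>real l - real m\<bar> \<le> 3/2 * \<beta> * sqrt (real m) \<longrightarrow>
        (1 / (1000 * \<beta> * ?K)) / sqrt (real m) \<le> (disp \<beta> m l)\<^sup>2 + (disp \<beta> m (l - 1))\<^sup>2 \<and>
        (disp \<beta> m l)\<^sup>2 + (disp \<beta> m (l - 1))\<^sup>2 \<le> (40 * ?K / \<beta>) / sqrt (real m)"
  proof eventually_elim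
    case (elim m)
    show ?case using disp_bulk_aux[OF \<beta> elim(1,2,3,5,4)] by blast
  qed
qed

section \<open>Localization of eigenvectors\<close>

definition ndist :: "nat \<Rightarrow> nat \<Rightarrow> nat" where
  "ndist n k = (k - n) + (n - k)"

lemma real_ndist: "real (ndist n k) = \<bar>real k - real n\<bar>"
  unfolding ndist_def by (cases "k \<le> n") (simp_all add: of_nat_diff)

lemma ndist_eq_0 [simp]: "ndist n k = 0 \<longleftrightarrow> k = n"
  unfolding ndist_def by auto

lemma ndist_self [simp]: "ndist n n = 0"
  by simp

lemma ndist_le_iff: "ndist n k \<le> L \<longleftrightarrow> k \<in> {n-L..n+L}"
  unfolding ndist_def by auto

text \<open>On either side of n each distance occurs at most once, hence the factor 2.\<close>

lemma sum_ndist_le: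
  fixes p :: "nat \<Rightarrow> real"
  assumes "finite A" "\<And>d. d \<ge> 1 \<Longrightarrow> d \<in> B \<Longrightarrow> p d \<ge> 0" "finite B" "\<And>k. k \<in> A \<Longrightarrow> k \<noteq> n \<and> ndist n k \<in> B"
  shows "(\<Sum>k\<in>A. p (ndist n k)) \<le> 2 * (\<Sum>d\<in>B - {0}. p d)"
proof -
  have half: "(\<Sum>k\<in>A'. p (ndist n k)) \<le> (\<Sum>d\<in>B - {0}. p d)" if "A' \<subseteq> A" "inj_on (ndist n) A'" for A'
  proof -
    have "(\<Sum>k\<in>A'. p (ndist n k)) = (\<Sum>d\<in>ndist n ` A'. p d)"
      using that(2) by (simp add: sum.reindex)
    also have "\<dots> \<le> (\<Sum>d\<in>B - {0}. p d)"
      using assms that(1) by (intro sum_mono2) (auto simp: Suc_le_eq)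
    finally show ?thesis .
  qed
  have "(\<Sum>k\<in>A. p (ndist n k)) = (\<Sum>k\<in>{k\<in>A. k < n}. p (ndist n k)) + (\<Sum>k\<in>{k\<in>A. n \<le> k}. p (ndist n k))"
    using assms(1) by (subst sum.union_disjoint[symmetric]) (auto intro!: sum.cong)
  also have "\<dots> \<le> (\<Sum>d\<in>B - {0}. p d) + (\<Sum>d\<in>B - {0}. p d)"
    by (intro add_mono half) (auto simp: inj_on_def ndist_def)
  finally show ?thesis by simp
qed

lemma l2_mono:
  assumes "l2 v" "\<And>k. \<bar>u k\<bar> \<le> \<bar>v k\<bar>"
  shows "l2 u" "nsq u \<le> nsq v"
proof -
  have le: "(u k)\<^sup>2 \<le> (v k)\<^sup>2" for k using assms(2)[of k] by (simp add: abs_le_square_iff)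
  have "(\<Sum>k<n. (u k)\<^sup>2) \<le> nsq v" for n
    using sum_mono[of "{..<n}" "\<lambda>k. (u k)\<^sup>2" "\<lambda>k. (v k)\<^sup>2"] le nsq_ge_sum[OF assms(1), of "{..<n}"] by fastforce
  from l2_boundedI[of u, OF this] show "l2 u" "nsq u \<le> nsq v" .
qed

lemma nsq_cmult: "l2 u \<Longrightarrow> nsq (\<lambda>k. a * u k) = a\<^sup>2 * nsq u"
  unfolding nsq_def l2_def by (simp add: power_mult_distrib suminf_mult)

lemma l2_eq_0: assumes "l2 u" "nsq u = 0" shows "u = (\<lambda>_. 0)"
proof
  fix k
  have "(u k)\<^sup>2 \<le> 0" using nsq_ge_sum[OF assms(1), of "{k}"] assms(2) by simp
  then show "u k = 0" by simp
qed

definition cutoff :: "nat set \<Rightarrow> (nat \<Rightarrow> real) \<Rightarrow> nat \<Rightarrow> real" where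
  "cutoff A u k = (if k \<in> A then 0 else u k)"

lemma l2_cutoff: "l2 u \<Longrightarrow> l2 (cutoff A u)"
  by (rule l2_mono(1)) (auto simp: cutoff_def)

lemma ip_cutoff:
  assumes "finite A" "l2 u" "l2 v"
  shows "ip u v = (\<Sum>k\<in>A. u k * v k) + ip u (cutoff A v)"
proof -
  have "(\<lambda>k. (if k \<in> A then u k * v k else 0) + u k * cutoff A v k) sums ((\<Sum>k\<in>A. u k * v k) + ip u (cutoff A v))"
    by (intro sums_add sums_If_finite_set assms ip_sums l2_cutoff)
  moreover have "(if k \<in> A then u k * v k else 0) + u k * cutoff A v k = u k * v k" for k
    by (simp add: cutoff_def)
  ultimately show ?thesis by (simp add: ip_def sums_iff)
qed

lemma nsq_cutoff:
  assumes "finite A" "l2 v"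
  shows "nsq v = (\<Sum>k\<in>A. (v k)\<^sup>2) + nsq (cutoff A v)"
proof -
  have "ip (cutoff A v) v = ip v (cutoff A v)" by (rule ip_commute)
  moreover have "ip v (cutoff A v) = ip (cutoff A v) (cutoff A v)"
    unfolding ip_def by (rule suminf_cong) (simp add: cutoff_def)
  ultimately show ?thesis
    using ip_cutoff[OF assms(1,2,2)] by (simp add: nsq_eq_ip power2_eq_square)
qed

section \<open>Eigenvectors of a diagonal matrix plus a symmetric orthogonal one\<close>

locale symmetric_perturbation = orthogonal_matrix W for W +
  fixes t :: real
  assumes sym: "W m k = W k m"
begin

text \<open>The diagonal is 0, 1, 2, ... and the perturbation is tW. The locale assumptions concern
  W alone, so outside the locale the strength becomes an argument of \<open>eigen\<close>, and both
  signs of t share one W.\<close>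

definition eigen :: "real \<Rightarrow> (nat \<Rightarrow> real) \<Rightarrow> bool" where
  "eigen x c \<longleftrightarrow> c \<noteq> (\<lambda>_. 0) \<and> l2 c \<and> (\<forall>m. (x - real m) * c m = t * ip (W m) c)"

text \<open>W is symmetric and orthogonal, so it is its own inverse and Parseval makes it
  self-adjoint. The unbounded diagonal is cancelled in each component separately, so the possibly
  divergent sum of m c_m c'_m is never formed.\<close>

lemma eigen_orthogonal:
  assumes "eigen x c" "eigen x' c'" "x \<noteq> x'"
  shows "ip c c' = 0"
proof -
  let ?w = "\<lambda>c m. ip (W m) c"
  have l: "l2 c" "l2 c'" using assms unfolding eigen_def by auto
  have lw: "l2 (?w c)" "l2 (?w c')" by (intro bessel l)+
  have "?w (?w c') = c'"
    using inversion[OF l(2)] sym by (metis (no_types, lifting) ext)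
  then have s: "ip (?w c) c' = ip c (?w c')"
    using parseval[OF l(1) lw(2)] by simp
  have "(\<lambda>m. t * (?w c m * c' m) - t * (c m * ?w c' m)) sums (t * ip (?w c) c' - t * ip c (?w c'))"
    by (intro sums_diff sums_mult ip_sums l lw)
  moreover have "t * (?w c m * c' m) - t * (c m * ?w c' m) = (x - x') * (c m * c' m)" for m
  proof -
    have "(x - real m) * c m * c' m = t * ?w c m * c' m" "(x' - real m) * c' m * c m = t * ?w c' m * c m"
      using assms(1,2) unfolding eigen_def by auto
    then show ?thesis by (simp add: algebra_simps)
  qed
  moreover have "(\<lambda>m. (x - x') * (c m * c' m)) sums ((x - x') * ip c c')"
    by (intro sums_mult ip_sums l)
  ultimately have "(x - x') * ip c c' = 0"
    using s by (simp add: sums_iff)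
  then show ?thesis using assms(3) by simp
qed

text \<open>
  Off the diagonal the equation gives $|c_m| \le 2 |f_m| / |m-n|$ with $f = tWc$. Inside the strip $f$ is
  bounded by its maximum $S$, which is controlled by $\kappa$ and a harmonic sum; outside it the isometry
  of $W$ gives an $l^2$ bound with a gain of $1/L$.
\<close>

lemma eigen_localized:
  fixes n L :: nat and \<kappa> H :: real
  assumes eig: "eigen x c" and x: "\<bar>x - real n\<bar> \<le> 1/2"
    and \<kappa>: "\<And>m k. m \<in> {n-L..n+L} \<Longrightarrow> k \<in> {n-L..n+L} \<Longrightarrow> \<bar>t * W m k\<bar> \<le> \<kappa>"
    and H: "2 * harm L \<le> H" and h1: "4 * \<kappa> * H \<le> 1" and h2: "32 * H * \<kappa>\<^sup>2 \<le> 1/8"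
    and h3: "(128 * H * t ^ 4 + 4 * t\<^sup>2) / (real L + 1)\<^sup>2 \<le> 1/16"
  shows "c n \<noteq> 0" and "nsq (cutoff {n} c) \<le> 1/5 * (c n)\<^sup>2"
    and "\<bar>x - real n - t * W n n\<bar> \<le> 2 * \<kappa> * H * (2 * \<kappa> + 6 * t\<^sup>2 / (real L + 1)) + 3 * t\<^sup>2 / (real L + 1)"
proof -
  define I where "I = {n-L..n+L}"
  have I: "finite I" "n \<in> I" unfolding I_def by auto
  have l: "l2 c" and c0: "c \<noteq> (\<lambda>_. 0)" and eq: "\<And>m. (x - real m) * c m = t * ip (W m) c"
    using eig unfolding eigen_def by auto
  define N where "N = sqrt (nsq c)"
  have N0: "N \<ge> 0" "N\<^sup>2 = nsq c" unfolding N_def using nsq_nonneg[OF l] by auto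
  have Npos: "nsq c > 0" using l2_eq_0[OF l] c0 nsq_nonneg[OF l] by fastforce
  define f where "f m = t * ip (W m) c" for m
  have lf: "l2 f" unfolding f_def by (intro l2_cmult bessel l)
  have nf: "nsq f = t\<^sup>2 * nsq c"
    unfolding f_def using nsq_cmult[OF bessel(1)[OF l]] nsq_isometry[OF l] by simp
  have H0: "H \<ge> 0" using H harm_nonneg[of L, where 'a=real] by linarith
  have \<kappa>0: "\<kappa> \<ge> 0" using \<kappa>[of n n] by auto
  have L1: "real L + 1 > 0" by simp
  have cf: "\<bar>c m\<bar> \<le> 2 * \<bar>f m\<bar> / real (ndist n m)" if "m \<noteq> n" for m
  proof -
    have "ndist n m \<noteq> 0" using that by simp
    then have d1: "real (ndist n m) \<ge> 1" by linarith
    have "\<bar>real m - real n\<bar> \<le> \<bar>x - real m\<bar> + \<bar>x - real n\<bar>" by linarith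
    moreover have "p / 2 \<le> q" if "p \<le> q + r" "r \<le> 1/2" "1 \<le> p" for p q r :: real
      using that by linarith
    ultimately have "\<bar>x - real m\<bar> \<ge> real (ndist n m) / 2" using x d1 unfolding real_ndist by blast
    then have "real (ndist n m) / 2 * \<bar>c m\<bar> \<le> \<bar>x - real m\<bar> * \<bar>c m\<bar>" by (rule mult_right_mono) simp
    also have "\<dots> = \<bar>f m\<bar>" unfolding f_def eq[symmetric] by (simp only: abs_mult)
    finally show ?thesis using d1 by (simp add: field_simps)
  qed
  define \<tau> where "\<tau> = sqrt (nsq (cutoff I c))"
  have lt: "l2 (cutoff I c)" by (rule l2_cutoff[OF l])
  have \<tau>0: "\<tau> \<ge> 0" "\<tau>\<^sup>2 = nsq (cutoff I c)" unfolding \<tau>_def using nsq_nonneg[OF lt] by auto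
  have \<tau>2: "\<tau>\<^sup>2 \<le> 4 * t\<^sup>2 / (real L + 1)\<^sup>2 * N\<^sup>2"
  proof -
    have "\<bar>cutoff I c k\<bar> \<le> \<bar>2 / (real L + 1) * f k\<bar>" for k
    proof (cases "k \<in> I")
      case False
      then have "\<not> ndist n k \<le> L" unfolding I_def ndist_le_iff .
      then have nd: "real L + 1 \<le> real (ndist n k)" by linarith
      have "k \<noteq> n" using False I by auto
      then have "\<bar>c k\<bar> \<le> 2 * \<bar>f k\<bar> / real (ndist n k)" by (rule cf)
      also have "\<dots> \<le> 2 * \<bar>f k\<bar> / (real L + 1)"
        using nd by (intro divide_left_mono) auto
      finally show ?thesis using False by (simp add: cutoff_def abs_mult)
    qed (simp add: cutoff_def)
    from l2_mono(2)[OF l2_cmult[OF lf] this] show ?thesis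
      unfolding \<tau>0(2) N0(2) nsq_cmult[OF lf] nf by (simp add: power_divide)
  qed
  have \<tau>N: "\<tau> \<le> 2 * \<bar>t\<bar> / (real L + 1) * N"
  proof (rule power2_le_imp_le)
    show "\<tau>\<^sup>2 \<le> (2 * \<bar>t\<bar> / (real L + 1) * N)\<^sup>2"
      using \<tau>2 by (simp add: power_mult_distrib power_divide)
    show "0 \<le> 2 * \<bar>t\<bar> / (real L + 1) * N" using N0 by simp
  qed
  define S where "S = Max ((\<lambda>m. \<bar>f m\<bar>) ` I)"
  have fS: "\<bar>f m\<bar> \<le> S" if "m \<in> I" for m
    unfolding S_def using that I by (intro Max_ge) auto
  have S0: "S \<ge> 0" using fS[OF I(2)] by linarith
  have harmI: "(\<Sum>k\<in>I - {n}. 1 / real (ndist n k)) \<le> H"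
  proof -
    have "(\<Sum>k\<in>I - {n}. 1 / real (ndist n k)) \<le> 2 * (\<Sum>d\<in>{0..L} - {0}. 1 / real d)"
      using I ndist_le_iff[of n _ L] unfolding I_def
      by (intro sum_ndist_le[where p="\<lambda>d. 1 / real d"]) auto
    also have "{0..L} - {0} = {1..L}" by auto
    finally show ?thesis using H by (simp add: harm_def divide_inverse)
  qed
  have cI: "\<bar>c k\<bar> \<le> 2 * S * (1 / real (ndist n k))" if "k \<in> I - {n}" for k
  proof -
    have "\<bar>c k\<bar> \<le> 2 * \<bar>f k\<bar> / real (ndist n k)" using cf that by auto
    also have "\<dots> \<le> 2 * S / real (ndist n k)" using fS that by (intro divide_right_mono) auto
    finally show ?thesis by simp
  qed
  have sumcI: "(\<Sum>k\<in>I - {n}. \<bar>c k\<bar>) \<le> 2 * S * H"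
  proof -
    have "(\<Sum>k\<in>I - {n}. \<bar>c k\<bar>) \<le> (\<Sum>k\<in>I - {n}. 2 * S * (1 / real (ndist n k)))"
      by (intro sum_mono cI)
    also have "\<dots> = 2 * S * (\<Sum>k\<in>I - {n}. 1 / real (ndist n k))" by (rule sum_distrib_left[symmetric])
    also have "\<dots> \<le> 2 * S * H" using harmI S0 by (intro mult_left_mono) auto
    finally show ?thesis .
  qed
  have tail: "\<bar>ip (W m) (cutoff I c)\<bar> \<le> \<tau>" for m
    using abs_ip_le[OF l2_row lt, of m] unfolding nsq_row \<tau>_def by simp
  have split: "f m = t * W m n * c n + (\<Sum>k\<in>I - {n}. t * W m k * c k) + t * ip (W m) (cutoff I c)" for m
  proof -
    have "ip (W m) c = (\<Sum>k\<in>I. W m k * c k) + ip (W m) (cutoff I c)" by (rule ip_cutoff[OF I(1) l2_row l])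
    also have "(\<Sum>k\<in>I. W m k * c k) = W m n * c n + (\<Sum>k\<in>I - {n}. W m k * c k)"
      by (rule sum.remove[OF I])
    finally show ?thesis unfolding f_def by (simp add: algebra_simps sum_distrib_left)
  qed
  have mid: "\<bar>\<Sum>k\<in>I - {n}. t * W m k * c k\<bar> \<le> \<kappa> * (2 * S * H)" if "m \<in> I" for m
  proof -
    have "\<bar>\<Sum>k\<in>I - {n}. t * W m k * c k\<bar> \<le> (\<Sum>k\<in>I - {n}. \<bar>t * W m k * c k\<bar>)" by (rule sum_abs)
    also have "\<dots> \<le> (\<Sum>k\<in>I - {n}. \<kappa> * \<bar>c k\<bar>)"
    proof (rule sum_mono)
      fix k assume "k \<in> I - {n}"
      then show "\<bar>t * W m k * c k\<bar> \<le> \<kappa> * \<bar>c k\<bar>"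
        using \<kappa>[of m k] that unfolding I_def by (subst abs_mult) (intro mult_right_mono, auto)
    qed
    also have "\<dots> = \<kappa> * (\<Sum>k\<in>I - {n}. \<bar>c k\<bar>)" by (rule sum_distrib_left[symmetric])
    also have "\<dots> \<le> \<kappa> * (2 * S * H)" using sumcI \<kappa>0 by (intro mult_left_mono) auto
    finally show ?thesis .
  qed
  have tt: "\<bar>t * ip (W m) (cutoff I c)\<bar> \<le> \<bar>t\<bar> * \<tau>" for m
    unfolding abs_mult using tail by (intro mult_left_mono) auto
  \<comment> \<open>In the row where |f| is maximal the strip terms return at most 2 \<kappa> H S,
    which is at most S/2 by \<open>h1\<close> and can be absorbed.\<close>
  have "S \<le> \<kappa> * \<bar>c n\<bar> + \<kappa> * (2 * S * H) + \<bar>t\<bar> * \<tau>"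
  proof -
    have "S \<in> (\<lambda>m. \<bar>f m\<bar>) ` I" unfolding S_def using I by (intro Max_in) auto
    then obtain m where m: "m \<in> I" "S = \<bar>f m\<bar>" by auto
    have "\<bar>t * W m n * c n\<bar> \<le> \<kappa> * \<bar>c n\<bar>"
      using \<kappa>[of m n] m(1) I(2) unfolding I_def by (subst abs_mult) (intro mult_right_mono, auto)
    then show ?thesis using mid[OF m(1)] tt[of m] unfolding m(2) split by linarith
  qed
  moreover have "\<kappa> * (2 * S * H) \<le> S / 2"
    using mult_right_mono[OF h1 S0] by (simp add: ac_simps)
  ultimately have S1: "S \<le> 2 * \<kappa> * \<bar>c n\<bar> + 2 * \<bar>t\<bar> * \<tau>" by linarith
  have "S\<^sup>2 \<le> (2 * \<kappa> * \<bar>c n\<bar> + 2 * \<bar>t\<bar> * \<tau>)\<^sup>2" using S1 S0 by (intro power_mono)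
  also have "\<dots> \<le> 2 * (2 * \<kappa> * \<bar>c n\<bar>)\<^sup>2 + 2 * (2 * \<bar>t\<bar> * \<tau>)\<^sup>2"
    using sum_squares_bound[of "2 * \<kappa> * \<bar>c n\<bar>" "2 * \<bar>t\<bar> * \<tau>"] unfolding power2_sum by linarith
  also have "\<dots> = 8 * \<kappa>\<^sup>2 * (c n)\<^sup>2 + 8 * t\<^sup>2 * \<tau>\<^sup>2" by (simp add: power_mult_distrib)
  finally have S2: "S\<^sup>2 \<le> 8 * \<kappa>\<^sup>2 * (c n)\<^sup>2 + 8 * t\<^sup>2 * \<tau>\<^sup>2" .
  have sumc2: "(\<Sum>k\<in>I - {n}. (c k)\<^sup>2) \<le> 4 * S\<^sup>2 * H"
  proof -
    have "(\<Sum>k\<in>I - {n}. (c k)\<^sup>2) \<le> (\<Sum>k\<in>I - {n}. 4 * S\<^sup>2 * (1 / real (ndist n k)))"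
    proof (rule sum_mono)
      fix k assume k: "k \<in> I - {n}"
      then have "ndist n k \<noteq> 0" by auto
      then have d1: "real (ndist n k) \<ge> 1" by linarith
      have "(c k)\<^sup>2 \<le> (2 * S * (1 / real (ndist n k)))\<^sup>2"
        using cI[OF k] by (metis abs_ge_zero power2_abs power_mono)
      also have "\<dots> = 4 * S\<^sup>2 * ((1 / real (ndist n k)) * (1 / real (ndist n k)))"
        by (simp add: power2_eq_square)
      also have "\<dots> \<le> 4 * S\<^sup>2 * ((1 / real (ndist n k)) * 1)"
        using d1 by (intro mult_left_mono) auto
      finally show "(c k)\<^sup>2 \<le> 4 * S\<^sup>2 * (1 / real (ndist n k))" by simp
    qed
    also have "\<dots> = 4 * S\<^sup>2 * (\<Sum>k\<in>I - {n}. 1 / real (ndist n k))" by (rule sum_distrib_left[symmetric])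
    also have "\<dots> \<le> 4 * S\<^sup>2 * H" using harmI by (intro mult_left_mono) auto
    finally show ?thesis .
  qed
  \<comment> \<open>With 1/8 and 1/16 here, N^2 is at most (9/8)/(15/16) = 6/5 times (c n)^2, which
    leaves 1/5 away from n.\<close>
  have off: "nsq (cutoff {n} c) \<le> 1/8 * (c n)\<^sup>2 + 1/16 * N\<^sup>2"
  proof -
    have "nsq (cutoff {n} c) = (\<Sum>k\<in>I - {n}. (c k)\<^sup>2) + \<tau>\<^sup>2"
      using nsq_cutoff[of "{n}", OF _ l] nsq_cutoff[OF I(1) l] sum.remove[OF I, of "\<lambda>k. (c k)\<^sup>2"] unfolding \<tau>0(2) by simp
    also have "\<dots> \<le> 4 * (8 * \<kappa>\<^sup>2 * (c n)\<^sup>2 + 8 * t\<^sup>2 * \<tau>\<^sup>2) * H + \<tau>\<^sup>2"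
      using sumc2 mult_right_mono[OF S2, of "4 * H"] H0 by (simp add: ac_simps)
    also have "\<dots> = (32 * H * \<kappa>\<^sup>2) * (c n)\<^sup>2 + (32 * H * t\<^sup>2 + 1) * \<tau>\<^sup>2" by (simp add: algebra_simps)
    also have "\<dots> \<le> 1/8 * (c n)\<^sup>2 + (32 * H * t\<^sup>2 + 1) * (4 * t\<^sup>2 / (real L + 1)\<^sup>2 * N\<^sup>2)"
      using h2 \<tau>2 H0 by (intro add_mono mult_right_mono mult_left_mono) auto
    also have "(32 * H * t\<^sup>2 + 1) * (4 * t\<^sup>2 / (real L + 1)\<^sup>2 * N\<^sup>2)
        = (128 * H * t ^ 4 + 4 * t\<^sup>2) / (real L + 1)\<^sup>2 * N\<^sup>2"
      using L1 by (simp add: field_simps power2_eq_square power4_eq_xxxx)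
    also have "\<dots> \<le> 1/16 * N\<^sup>2" using h3 by (rule mult_right_mono) simp
    finally show ?thesis by simp
  qed
  have Nc: "N\<^sup>2 = (c n)\<^sup>2 + nsq (cutoff {n} c)"
    using nsq_cutoff[of "{n}", OF _ l] N0 by simp
  then have N65: "N\<^sup>2 \<le> 6/5 * (c n)\<^sup>2" using off by linarith
  then show cn: "c n \<noteq> 0" using Npos N0 by auto
  show "nsq (cutoff {n} c) \<le> 1/5 * (c n)\<^sup>2" using N65 Nc by linarith
  have "(3/2 * \<bar>c n\<bar>)\<^sup>2 = 9/4 * (c n)\<^sup>2" by (simp add: power_mult_distrib power_divide)
  then have "N\<^sup>2 \<le> (3/2 * \<bar>c n\<bar>)\<^sup>2" using N65 zero_le_power2[of "c n"] by linarith
  then have "N \<le> 3/2 * \<bar>c n\<bar>" by (rule power2_le_imp_le) simp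
  then have "\<tau> \<le> 2 * \<bar>t\<bar> / (real L + 1) * (3/2 * \<bar>c n\<bar>)"
    using \<tau>N by (elim order_trans) (intro mult_left_mono, auto)
  then have \<tau>3: "\<bar>t\<bar> * \<tau> \<le> 3 * t\<^sup>2 / (real L + 1) * \<bar>c n\<bar>"
  proof -
    assume "\<tau> \<le> 2 * \<bar>t\<bar> / (real L + 1) * (3/2 * \<bar>c n\<bar>)"
    then have "\<bar>t\<bar> * \<tau> \<le> \<bar>t\<bar> * (2 * \<bar>t\<bar> / (real L + 1) * (3/2 * \<bar>c n\<bar>))" by (rule mult_left_mono) simp
    also have "a * (2 * a / l * (3/2 * d)) = 3 * (a * a) / l * d" for a l d :: real by simp
    also have "\<bar>t\<bar> * \<bar>t\<bar> = t\<^sup>2" by (simp add: power2_eq_square)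
    finally show ?thesis .
  qed
  have S3: "S \<le> (2 * \<kappa> + 6 * t\<^sup>2 / (real L + 1)) * \<bar>c n\<bar>"
  proof -
    have "(2 * \<kappa> + 6 * t\<^sup>2 / (real L + 1)) * \<bar>c n\<bar> = 2 * \<kappa> * \<bar>c n\<bar> + 2 * (3 * t\<^sup>2 / (real L + 1) * \<bar>c n\<bar>)"
      by (simp add: distrib_right)
    then show ?thesis using S1 \<tau>3 by linarith
  qed
  \<comment> \<open>Row n of the equation without its diagonal term; every remaining bound is a
    multiple of |c n|, which therefore divides out.\<close>
  have "(x - real n - t * W n n) * c n = (\<Sum>k\<in>I - {n}. t * W n k * c k) + t * ip (W n) (cutoff I c)"
    using eq[of n] split[of n] unfolding f_def by (simp add: algebra_simps)
  then have "\<bar>x - real n - t * W n n\<bar> * \<bar>c n\<bar> \<le> \<kappa> * (2 * S * H) + \<bar>t\<bar> * \<tau>"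
    unfolding abs_mult[symmetric] using mid[OF I(2)] tt[of n] by linarith
  also have "\<dots> \<le> \<kappa> * (2 * ((2 * \<kappa> + 6 * t\<^sup>2 / (real L + 1)) * \<bar>c n\<bar>) * H) + 3 * t\<^sup>2 / (real L + 1) * \<bar>c n\<bar>"
    using S3 \<tau>3 H0 \<kappa>0 by (intro add_mono mult_left_mono mult_right_mono) auto
  also have "\<dots> = (2 * \<kappa> * H * (2 * \<kappa> + 6 * t\<^sup>2 / (real L + 1)) + 3 * t\<^sup>2 / (real L + 1)) * \<bar>c n\<bar>"
    by (simp add: algebra_simps)
  finally show "\<bar>x - real n - t * W n n\<bar> \<le> 2 * \<kappa> * H * (2 * \<kappa> + 6 * t\<^sup>2 / (real L + 1)) + 3 * t\<^sup>2 / (real L + 1)"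
    using cn by (simp add: mult_le_cancel_right)
qed

text \<open>For distinct eigenvalues orthogonality would force |c n * c' n| to equal the inner
  product of the parts away from n, which is at most 1/5 of it.\<close>

lemma localized_unique:
  assumes "eigen x c" "eigen x' c'" "c n \<noteq> 0" "c' n \<noteq> 0"
    and "nsq (cutoff {n} c) \<le> 1/5 * (c n)\<^sup>2" "nsq (cutoff {n} c') \<le> 1/5 * (c' n)\<^sup>2"
  shows "x = x'"
proof (rule ccontr)
  assume "x \<noteq> x'"
  then have 0: "ip c c' = 0" by (rule eigen_orthogonal[OF assms(1,2)])
  have l: "l2 c" "l2 c'" using assms unfolding eigen_def by auto
  have "ip c c' = c n * c' n + ip c (cutoff {n} c')"
    using ip_cutoff[of "{n}", OF _ l] by simp
  moreover have "ip c (cutoff {n} c') = ip (cutoff {n} c) (cutoff {n} c')"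
    unfolding ip_def by (rule suminf_cong) (simp add: cutoff_def)
  ultimately have "\<bar>c n * c' n\<bar> = \<bar>ip (cutoff {n} c) (cutoff {n} c')\<bar>" using 0 by linarith
  also have "\<dots> \<le> sqrt (nsq (cutoff {n} c)) * sqrt (nsq (cutoff {n} c'))"
    by (intro abs_ip_le l2_cutoff l)
  also have "\<dots> = sqrt (nsq (cutoff {n} c) * nsq (cutoff {n} c'))" by (rule real_sqrt_mult[symmetric])
  also have "\<dots> \<le> sqrt ((1/5 * (c n)\<^sup>2) * (1/5 * (c' n)\<^sup>2))"
    using assms nsq_nonneg[OF l2_cutoff[OF l(2)]] by (intro real_sqrt_le_mono mult_mono) auto
  also have "\<dots> = sqrt ((1/5 * (c n * c' n))\<^sup>2)" by (simp add: power_mult_distrib power2_eq_square)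
  also have "\<dots> = 1/5 * \<bar>c n * c' n\<bar>" by (simp only: real_sqrt_abs abs_mult)
  finally have "\<bar>c n * c' n\<bar> = 0" by linarith
  then show False using assms by simp
qed

end

section \<open>Existence of eigenvalues\<close>

text \<open>Here \<open>decay 0 = 0\<close>, as a power of 0; the value 1 at the centre is set
  separately in \<open>weight\<close>.\<close>

definition decay :: "nat \<Rightarrow> real" where
  "decay d = real d powr (-3/4)"

definition weight :: "nat \<Rightarrow> nat \<Rightarrow> real" where
  "weight n k = (if k = n then 1 else decay (ndist n k))"

lemma l2_decay: "l2 decay"
proof -
  have "(decay d)\<^sup>2 = real d powr (-3/2)" for d
    by (simp add: decay_def power2_eq_square powr_add[symmetric])
  then show ?thesis
    unfolding l2_def using summable_real_powr_iff[of "-3/2"] by simp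
qed

lemma weight_nonneg: "weight n k \<ge> 0"
  by (simp add: weight_def decay_def)

lemma weight_le_1: "weight n k \<le> 1"
proof (cases "k = n")
  case False
  then have "ndist n k \<noteq> 0" by simp
  then have "real (ndist n k) \<ge> 1" by linarith
  then have "real (ndist n k) powr (-3/4) \<le> real (ndist n k) powr 0" by (intro powr_mono) auto
  also have "\<dots> = 1" using False by simp
  finally show ?thesis using False by (simp add: weight_def decay_def)
qed (simp add: weight_def)

text \<open>Folding the two sides of n onto the distances gives a tail bound free of n, so that one
  L can later serve all n.\<close>

lemma cutoff_weight:
  "l2 (cutoff {n-L..n+L} (weight n))" "nsq (cutoff {n-L..n+L} (weight n)) \<le> 2 * nsq (cutoff {0..L} decay)"
proof -
  have lq: "l2 (cutoff {0..L} decay)" by (rule l2_cutoff[OF l2_decay])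
  have "(\<Sum>k<N. (cutoff {n-L..n+L} (weight n) k)\<^sup>2) \<le> 2 * nsq (cutoff {0..L} decay)" for N
  proof -
    define A where "A = {k. k < N \<and> k \<notin> {n-L..n+L}}"
    define B where "B = {L<..n+N}"
    have "(\<Sum>k<N. (cutoff {n-L..n+L} (weight n) k)\<^sup>2) = (\<Sum>k\<in>A. (cutoff {n-L..n+L} (weight n) k)\<^sup>2)"
      unfolding A_def by (rule sum.mono_neutral_right) (auto simp: cutoff_def)
    also have "\<dots> = (\<Sum>k\<in>A. (decay (ndist n k))\<^sup>2)"
      unfolding A_def by (rule sum.cong) (auto simp: cutoff_def weight_def)
    also have "\<dots> \<le> 2 * (\<Sum>d\<in>B - {0}. (decay d)\<^sup>2)"
    proof (rule sum_ndist_le[where p="\<lambda>d. (decay d)\<^sup>2"])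
      fix k assume "k \<in> A"
      then have "k < N" "\<not> ndist n k \<le> L" unfolding A_def ndist_le_iff by auto
      then show "k \<noteq> n \<and> ndist n k \<in> B" unfolding B_def by (auto simp: ndist_def)
    qed (auto simp: A_def B_def)
    also have "(\<Sum>d\<in>B - {0}. (decay d)\<^sup>2) = (\<Sum>d\<in>B - {0}. (cutoff {0..L} decay d)\<^sup>2)"
      by (rule sum.cong) (auto simp: cutoff_def B_def)
    also have "\<dots> \<le> nsq (cutoff {0..L} decay)"
      by (rule nsq_ge_sum[OF lq]) (simp add: B_def)
    finally show ?thesis by simp
  qed
  from l2_boundedI[of "cutoff {n-L..n+L} (weight n)", OF this]
  show "l2 (cutoff {n-L..n+L} (weight n))" "nsq (cutoff {n-L..n+L} (weight n)) \<le> 2 * nsq (cutoff {0..L} decay)" .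
qed

lemma l2_weight: "l2 (weight n)"
proof -
  have "l2 (\<lambda>k. if k = n then 1 else 0)"
    unfolding l2_def using sums_summable[OF sums_single[of n "\<lambda>_. 1::real"]]
    by (simp add: if_distrib[of "\<lambda>x. x\<^sup>2"] cong: if_cong)
  from l2_add[OF this cutoff_weight(1)[of n 0]] show ?thesis
    by (rule l2_mono(1)) (auto simp: cutoff_def weight_def)
qed

lemma nsq_weight: "nsq (weight n) \<le> 1 + 2 * nsq decay"
proof -
  have "nsq (weight n) = 1 + nsq (cutoff {n} (weight n))"
    using nsq_cutoff[of "{n}", OF _ l2_weight] by (simp add: weight_def)
  also have "nsq (cutoff {n} (weight n)) \<le> 2 * nsq (cutoff {0..0} decay)"
    using cutoff_weight(2)[of n 0] by simp
  also have "nsq (cutoff {0..0} decay) \<le> nsq decay"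
    by (rule l2_mono(2)[OF l2_decay]) (simp add: cutoff_def)
  finally show ?thesis by simp
qed

lemma nsq_cutoff_tendsto_0: "l2 u \<Longrightarrow> (\<lambda>L. nsq (cutoff {0..L} u)) \<longlonglongrightarrow> 0"
proof -
  assume u: "l2 u"
  have "(\<lambda>L. nsq u - (\<Sum>k\<le>L. (u k)\<^sup>2)) \<longlonglongrightarrow> nsq u - nsq u"
    unfolding nsq_def using u[unfolded l2_def] by (intro tendsto_diff tendsto_const summable_LIMSEQ')
  moreover have "nsq (cutoff {0..L} u) = nsq u - (\<Sum>k\<le>L. (u k)\<^sup>2)" for L
    using nsq_cutoff[OF _ u, of "{0..L}"] by (simp add: atLeast0AtMost)
  ultimately show ?thesis by simp
qed

lemma abs_ip_le_ip_abs:
  assumes "l2 u" "l2 w" "\<And>k. \<bar>v k\<bar> \<le> w k"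
  shows "\<bar>ip u v\<bar> \<le> ip (\<lambda>k. \<bar>u k\<bar>) w"
proof -
  have lv: "l2 v" by (rule l2_mono(1)[OF assms(2)]) (use assms(3) abs_ge_self order_trans in blast)
  have lu: "l2 (\<lambda>k. \<bar>u k\<bar>)" using assms(1) by (simp add: l2_def)
  have "\<bar>ip u v\<bar> \<le> (\<Sum>k. \<bar>u k * v k\<bar>)"
    unfolding ip_def by (rule summable_rabs[OF l2_abs_mult_summable[OF assms(1) lv]])
  also have "\<dots> \<le> (\<Sum>k. \<bar>u k\<bar> * w k)"
    by (rule suminf_le[OF _ l2_abs_mult_summable[OF assms(1) lv] l2_mult_summable[OF lu assms(2)]])
       (simp add: abs_mult mult_left_mono assms(3))
  finally show ?thesis unfolding ip_def .
qed

text \<open>As \<open>nat\<close> is discrete, bounded continuous functions on it are the bounded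
  sequences with the sup norm; the fixed point is sought in a ball of this space.\<close>

lemma complete_cball_bcontfun: "complete (cball (0 :: nat \<Rightarrow>\<^sub>C real) r)"
proof (rule completeI)
  fix f :: "nat \<Rightarrow> (nat \<Rightarrow>\<^sub>C real)"
  assume f: "\<forall>n. f n \<in> cball 0 r" and "Cauchy f"
  from \<open>Cauchy f\<close> obtain h where "uniform_limit UNIV f h sequentially"
    using uniformly_convergent_eq_cauchy[of "\<lambda>_. True" f]
    unfolding Cauchy_def uniform_limit_sequentially_iff
    by (metis dist_fun_lt_imp_dist_val_lt)
  from uniform_limit_bcontfunE[OF this sequentially_bot]
  obtain l where "f \<longlonglongrightarrow> l" by metis
  moreover from this have "l \<in> cball 0 r"
    using closed_sequentially[OF closed_cball] f by blast
  ultimately show "\<exists>l\<in>cball 0 r. f \<longlonglongrightarrow> l" by blast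
qed

section \<open>A contraction for the eigenvalue equations\<close>

context symmetric_perturbation
begin

text \<open>The most that row m of tW can yield on a vector dominated by the weight; it bounds both
  the coupling and its Lipschitz constant.\<close>

definition row_mass :: "nat \<Rightarrow> nat \<Rightarrow> real" where
  "row_mass n m = \<bar>t\<bar> * ip (\<lambda>k. \<bar>W m k\<bar>) (weight n)"

lemma l2_abs_row: "l2 (\<lambda>k. \<bar>W m k\<bar>)"
  using l2_row[of m] by (simp add: l2_def)

lemma nsq_abs_row: "nsq (\<lambda>k. \<bar>W m k\<bar>) = 1"
  using nsq_row[of m] by (simp add: nsq_def)

text \<open>Cauchy-Schwarz with a unit row. The bound is uniform but not small; in far rows
  \<open>damping\<close> supplies the smallness.\<close>

lemma row_mass_bound: "row_mass n m \<le> \<bar>t\<bar> * sqrt (1 + 2 * nsq decay)"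
proof -
  have "ip (\<lambda>k. \<bar>W m k\<bar>) (weight n) \<le> sqrt (nsq (weight n))"
    using abs_ip_le[OF l2_abs_row l2_weight, of m n] unfolding nsq_abs_row by simp
  also have "\<dots> \<le> sqrt (1 + 2 * nsq decay)"
    using nsq_weight by (rule real_sqrt_le_mono)
  finally show ?thesis unfolding row_mass_def by (rule mult_left_mono) simp
qed

text \<open>Near the centre damping is of no help, so smallness comes from the entries: 2L + 1 of
  them at most \<kappa>, and Cauchy-Schwarz for the tail of the weight.\<close>

lemma row_mass_bound_near:
  assumes \<kappa>: "\<And>k. k \<in> {n-L..n+L} \<Longrightarrow> \<bar>t * W m k\<bar> \<le> \<kappa>"
  shows "row_mass n m \<le> \<kappa> * (2 * real L + 1) + \<bar>t\<bar> * sqrt (2 * nsq (cutoff {0..L} decay))"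
proof -
  let ?I = "{n-L..n+L}"
  have \<kappa>0: "\<kappa> \<ge> 0" using \<kappa>[of n] by auto
  have "row_mass n m = (\<Sum>k\<in>?I. \<bar>t\<bar> * (\<bar>W m k\<bar> * weight n k)) + \<bar>t\<bar> * ip (\<lambda>k. \<bar>W m k\<bar>) (cutoff ?I (weight n))"
    unfolding row_mass_def
    by (subst ip_cutoff[of ?I, OF _ l2_abs_row l2_weight]) (simp_all add: distrib_left sum_distrib_left)
  moreover have "(\<Sum>k\<in>?I. \<bar>t\<bar> * (\<bar>W m k\<bar> * weight n k)) \<le> (\<Sum>k\<in>?I. \<kappa>)"
  proof (rule sum_mono)
    fix k assume "k \<in> ?I"
    then have "\<bar>t * W m k\<bar> * weight n k \<le> \<kappa> * 1"
      using \<kappa> weight_le_1 weight_nonneg \<kappa>0 by (intro mult_mono) auto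
    then show "\<bar>t\<bar> * (\<bar>W m k\<bar> * weight n k) \<le> \<kappa>" by (simp add: abs_mult mult.assoc)
  qed
  moreover have "(\<Sum>k\<in>?I. \<kappa>) \<le> \<kappa> * (2 * real L + 1)"
  proof -
    have "card ?I \<le> 2 * L + 1" by simp
    then have "real (card ?I) \<le> 2 * real L + 1" by linarith
    then have "real (card ?I) * \<kappa> \<le> (2 * real L + 1) * \<kappa>" using \<kappa>0 by (rule mult_right_mono)
    then show ?thesis by (simp add: mult.commute)
  qed
  moreover have "\<bar>t\<bar> * ip (\<lambda>k. \<bar>W m k\<bar>) (cutoff ?I (weight n)) \<le> \<bar>t\<bar> * sqrt (2 * nsq (cutoff {0..L} decay))"
  proof (rule mult_left_mono)
    have "ip (\<lambda>k. \<bar>W m k\<bar>) (cutoff ?I (weight n)) \<le> sqrt (nsq (cutoff ?I (weight n)))"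
      using abs_ip_le[OF l2_abs_row cutoff_weight(1), of m n L] unfolding nsq_abs_row by simp
    also have "\<dots> \<le> sqrt (2 * nsq (cutoff {0..L} decay))"
      using cutoff_weight(2) by (rule real_sqrt_le_mono)
    finally show "ip (\<lambda>k. \<bar>W m k\<bar>) (cutoff ?I (weight n)) \<le> sqrt (2 * nsq (cutoff {0..L} decay))" .
  qed simp
  ultimately show ?thesis by linarith
qed

text \<open>
  The eigenvalue equations with $c_n = 1$ are solved by a contraction in the sup norm. The unknown is
  $b_k = |k-n|^{3/4} c_k$ for $k \neq n$, and the free slot $b_n$ holds the shift $x - n$ of the eigenvalue.
  The exponent $3/4$ makes the weights square summable and still leaves a factor $|m-n|^{-1/4}$ to spare.
\<close>

definition trial :: "nat \<Rightarrow> (nat \<Rightarrow> real) \<Rightarrow> nat \<Rightarrow> real" where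
  "trial n b k = (if k = n then 1 else weight n k * b k)"

definition coupling :: "nat \<Rightarrow> (nat \<Rightarrow> real) \<Rightarrow> nat \<Rightarrow> real" where
  "coupling n b m = t * ip (W m) (trial n b)"

text \<open>What remains of the rescaling |m-n|^(3/4) after division by a denominator of order
  |m-n|.\<close>

definition damping :: "nat \<Rightarrow> nat \<Rightarrow> real" where
  "damping n m = (if m = n then 1 else real (ndist n m) powr (-1/4))"

text \<open>Row m \<noteq> n of the eigenvalue equation is solved for b_m. In row n the factor n +
  b_n - n is b_n itself, so that row determines the shift. The shift also occurs in the
  denominators, which makes the map nonlinear.\<close>

definition fixmap :: "nat \<Rightarrow> (nat \<Rightarrow> real) \<Rightarrow> nat \<Rightarrow> real" where
  "fixmap n b m = (if m = n then coupling n b n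
     else real (ndist n m) powr (3/4) / (real n + b n - real m) * coupling n b m)"

lemma abs_trial_le: "\<bar>b k\<bar> \<le> 1 \<Longrightarrow> \<bar>trial n b k\<bar> \<le> weight n k"
  using weight_nonneg[of n k] by (auto simp: trial_def abs_mult weight_def intro: mult_left_le)

lemma l2_trial: "(\<And>k. \<bar>b k\<bar> \<le> 1) \<Longrightarrow> l2 (trial n b)"
  using abs_trial_le[of b _ n] weight_nonneg[of n] by (intro l2_mono(1)[OF l2_weight[of n]]) simp

lemma coupling_bound: "(\<And>k. \<bar>b k\<bar> \<le> 1) \<Longrightarrow> \<bar>coupling n b m\<bar> \<le> row_mass n m"
  unfolding coupling_def row_mass_def abs_mult
  by (intro mult_left_mono abs_ip_le_ip_abs l2_row l2_weight abs_trial_le) auto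

lemma coupling_diff_bound:
  assumes "\<And>k. \<bar>b k\<bar> \<le> 1" "\<And>k. \<bar>b' k\<bar> \<le> 1" "\<And>k. \<bar>b k - b' k\<bar> \<le> \<delta>"
  shows "\<bar>coupling n b m - coupling n b' m\<bar> \<le> \<delta> * row_mass n m"
proof -
  have \<delta>0: "\<delta> \<ge> 0" using assms(3)[of 0] by linarith
  have "coupling n b m - coupling n b' m = t * ip (W m) (\<lambda>k. trial n b k - trial n b' k)"
    unfolding coupling_def by (subst ip_diff) (auto intro!: l2_row l2_trial assms simp: right_diff_distrib)
  also have "\<bar>\<dots>\<bar> \<le> \<bar>t\<bar> * ip (\<lambda>k. \<bar>W m k\<bar>) (\<lambda>k. \<delta> * weight n k)"
  proof (subst abs_mult, intro mult_left_mono abs_ip_le_ip_abs l2_row l2_cmult l2_weight)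
    fix k show "\<bar>trial n b k - trial n b' k\<bar> \<le> \<delta> * weight n k"
    proof (cases "k = n")
      case False
      then have "\<bar>trial n b k - trial n b' k\<bar> = weight n k * \<bar>b k - b' k\<bar>"
        using weight_nonneg[of n k] by (simp add: trial_def right_diff_distrib[symmetric] abs_mult)
      also have "\<dots> \<le> weight n k * \<delta>" using assms(3) weight_nonneg by (rule mult_left_mono)
      finally show ?thesis by (simp add: mult.commute)
    qed (simp add: trial_def \<delta>0 weight_nonneg)
  qed simp
  also have "\<dots> = \<delta> * row_mass n m"
    unfolding row_mass_def by (simp add: ip_cmult[OF l2_abs_row l2_weight])
  finally show ?thesis .
qed

lemma denominator_bound:
  assumes "m \<noteq> n" "\<bar>e\<bar> \<le> 1/2"
  shows "real (ndist n m) / 2 \<le> \<bar>real n + e - real m\<bar>" "real (ndist n m) \<ge> 1"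
proof -
  have "ndist n m \<noteq> 0" using assms by simp
  then show 1: "real (ndist n m) \<ge> 1" by linarith
  have "\<bar>real m - real n\<bar> \<le> \<bar>real n + e - real m\<bar> + \<bar>e\<bar>" by linarith
  moreover have "p / 2 \<le> q" if "p \<le> q + r" "r \<le> 1/2" "1 \<le> p" for p q r :: real
    using that by linarith
  ultimately show "real (ndist n m) / 2 \<le> \<bar>real n + e - real m\<bar>"
    using assms(2) 1 unfolding real_ndist by blast
qed

lemma multiplier_bound:
  assumes "m \<noteq> n" "\<bar>e\<bar> \<le> 1/2"
  shows "\<bar>real (ndist n m) powr (3/4) / (real n + e - real m)\<bar> \<le> 2 * damping n m"
proof -
  let ?d = "real (ndist n m)"
  note d = denominator_bound[OF assms]
  have "?d powr (3/4) = ?d powr (-1/4) * ?d"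
    using d(2) powr_add[of ?d "-1/4" 1] by simp
  then have "?d powr (3/4) \<le> 2 * damping n m * (?d / 2)"
    using assms by (simp add: damping_def)
  also have "\<dots> \<le> 2 * damping n m * \<bar>real n + e - real m\<bar>"
    using d by (intro mult_left_mono) (auto simp: damping_def)
  finally have "?d powr (3/4) \<le> 2 * damping n m * \<bar>real n + e - real m\<bar>" .
  moreover have "0 < \<bar>real n + e - real m\<bar>" using d by linarith
  ultimately show ?thesis by (simp add: abs_divide pos_divide_le_eq)
qed

text \<open>The contraction estimate has to follow the shift inside the denominators. These are at
  least half the distance, and at least 1/2, so a change of the shift costs no more than the damping
  already present.\<close>

lemma multiplier_diff_bound:
  assumes "m \<noteq> n" "\<bar>e\<bar> \<le> 1/2" "\<bar>e'\<bar> \<le> 1/2"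
  shows "\<bar>real (ndist n m) powr (3/4) / (real n + e - real m) - real (ndist n m) powr (3/4) / (real n + e' - real m)\<bar>
    \<le> 4 * damping n m * \<bar>e - e'\<bar>"
proof -
  let ?d = "real (ndist n m)" and ?D = "real n + e - real m" and ?E = "real n + e' - real m"
  note d = denominator_bound[OF assms(1,2)] denominator_bound[OF assms(1,3)]
  have ne: "?D \<noteq> 0" "?E \<noteq> 0" using d by auto
  have "?d powr (3/4) / ?D - ?d powr (3/4) / ?E = (?d powr (3/4) / ?D) * ((e' - e) / ?E)"
    using ne by (simp add: field_simps)
  also have "\<bar>\<dots>\<bar> = \<bar>?d powr (3/4) / ?D\<bar> * (\<bar>e - e'\<bar> / \<bar>?E\<bar>)"
    by (simp only: abs_mult abs_divide abs_minus_commute)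
  also have "\<dots> \<le> (2 * damping n m) * (2 * \<bar>e - e'\<bar>)"
  proof (intro mult_mono multiplier_bound assms)
    have "\<bar>?E\<bar> \<ge> 1/2" using d by linarith
    then have "1 * \<bar>e - e'\<bar> \<le> 2 * \<bar>?E\<bar> * \<bar>e - e'\<bar>" by (intro mult_right_mono) auto
    then show "\<bar>e - e'\<bar> / \<bar>?E\<bar> \<le> 2 * \<bar>e - e'\<bar>" using ne by (simp add: pos_divide_le_eq ac_simps)
  qed (auto simp: damping_def)
  finally show ?thesis by simp
qed

lemma fixmap_bound:
  assumes "\<And>m. damping n m * row_mass n m \<le> 1/12" "\<And>k. \<bar>b k\<bar> \<le> 1/2"
  shows "\<bar>fixmap n b m\<bar> \<le> 1/2"
proof -
  have b1: "\<bar>b k\<bar> \<le> 1" for k using assms(2)[of k] by linarith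
  note cb = coupling_bound[of b n, OF b1]
  show ?thesis
  proof (cases "m = n")
    case True
    then show ?thesis using cb[of n] assms(1)[of n] by (simp add: fixmap_def damping_def)
  next
    case False
    have "\<bar>fixmap n b m\<bar> = \<bar>real (ndist n m) powr (3/4) / (real n + b n - real m)\<bar> * \<bar>coupling n b m\<bar>"
      using False by (simp add: fixmap_def abs_mult)
    also have "\<dots> \<le> (2 * damping n m) * row_mass n m"
      by (intro mult_mono multiplier_bound cb assms False) (auto simp: damping_def)
    finally show ?thesis using assms(1)[of m] by simp
  qed
qed

text \<open>Varying the coupling costs 2 and varying the multiplier costs 4 times
  \<open>damping n m * row_mass n m\<close>; the bound 1/12 turns this 6 into the contraction factor
  1/2.\<close>

lemma fixmap_lipschitz:
  assumes "\<And>m. damping n m * row_mass n m \<le> 1/12" "\<And>k. \<bar>b k\<bar> \<le> 1/2" "\<And>k. \<bar>b' k\<bar> \<le> 1/2"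
    "\<And>k. \<bar>b k - b' k\<bar> \<le> \<delta>"
  shows "\<bar>fixmap n b m - fixmap n b' m\<bar> \<le> \<delta> / 2"
proof -
  have b1: "\<bar>b k\<bar> \<le> 1" "\<bar>b' k\<bar> \<le> 1" for k using assms(2)[of k] assms(3)[of k] by linarith+
  have \<delta>0: "\<delta> \<ge> 0" using assms(4)[of 0] by linarith
  note cd = coupling_diff_bound[of b b' \<delta> n, OF b1 assms(4)]
  have m0: "row_mass n m \<ge> 0" for m using coupling_bound[of b n m, OF b1(1)] by linarith
  show ?thesis
  proof (cases "m = n")
    case True
    have "\<delta> * row_mass n n \<le> \<delta> * (1/12)"
      using assms(1)[of n] \<delta>0 by (intro mult_left_mono) (auto simp: damping_def)
    then show ?thesis using cd[of n] \<delta>0 True by (simp add: fixmap_def)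
  next
    case False
    let ?q = "\<lambda>e. real (ndist n m) powr (3/4) / (real n + e - real m)"
    have eq: "fixmap n b m - fixmap n b' m = ?q (b n) * (coupling n b m - coupling n b' m)
        + (?q (b n) - ?q (b' n)) * coupling n b' m"
    proof -
      have "x * g - y * h = x * (g - h) + (x - y) * h" for x y g h :: real
        by (simp add: algebra_simps)
      then show ?thesis unfolding fixmap_def if_not_P[OF False] .
    qed
    have "\<bar>fixmap n b m - fixmap n b' m\<bar> \<le> \<bar>?q (b n)\<bar> * \<bar>coupling n b m - coupling n b' m\<bar>
        + \<bar>?q (b n) - ?q (b' n)\<bar> * \<bar>coupling n b' m\<bar>"
      unfolding eq abs_mult[symmetric] by (rule abs_triangle_ineq)
    also have "\<dots> \<le> (2 * damping n m) * (\<delta> * row_mass n m) + (4 * damping n m * \<delta>) * row_mass n m"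
    proof -
      have d0: "damping n m \<ge> 0" by (simp add: damping_def)
      have 1: "\<bar>?q (b n)\<bar> \<le> 2 * damping n m" by (rule multiplier_bound[OF False assms(2)])
      have 2: "\<bar>coupling n b m - coupling n b' m\<bar> \<le> \<delta> * row_mass n m" by (rule cd)
      have "4 * damping n m * \<bar>b n - b' n\<bar> \<le> 4 * damping n m * \<delta>"
        using d0 by (intro mult_left_mono assms(4)) simp
      with multiplier_diff_bound[OF False assms(2,3)[of n]]
      have 3: "\<bar>?q (b n) - ?q (b' n)\<bar> \<le> 4 * damping n m * \<delta>" by linarith
      have 4: "\<bar>coupling n b' m\<bar> \<le> row_mass n m" by (rule coupling_bound[OF b1(2)])
      show ?thesis
        by (rule add_mono[OF mult_mono[OF 1 2] mult_mono[OF 3 4]]) (simp_all add: d0 \<delta>0)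
    qed
    also have "\<dots> = 6 * \<delta> * (damping n m * row_mass n m)" by (simp add: algebra_simps)
    also have "\<dots> \<le> 6 * \<delta> * (1/12)" using assms(1) \<delta>0 by (intro mult_left_mono) auto
    finally show ?thesis by simp
  qed
qed

lemma fixmap_fixpoint:
  assumes "\<And>m. damping n m * row_mass n m \<le> 1/12"
  obtains b where "\<And>k. \<bar>b k\<bar> \<le> 1/2" "\<And>m. fixmap n b m = b m"
proof -
  define K :: "(nat \<Rightarrow>\<^sub>C real) set" where "K = cball 0 (1/2)"
  have memK: "b \<in> K \<longleftrightarrow> (\<forall>k. \<bar>apply_bcontfun b k\<bar> \<le> 1/2)" for b
  proof
    assume "b \<in> K"
    then have "norm b \<le> 1/2" unfolding K_def by simp
    moreover have "\<bar>apply_bcontfun b k\<bar> \<le> norm b" for k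
      using norm_bounded[of b k] by simp
    ultimately show "\<forall>k. \<bar>apply_bcontfun b k\<bar> \<le> 1/2" by (meson order_trans)
  next
    assume "\<forall>k. \<bar>apply_bcontfun b k\<bar> \<le> 1/2"
    then have "norm b \<le> 1/2" by (intro norm_bound) simp
    then show "b \<in> K" unfolding K_def by simp
  qed
  define F where "F b = Bcontfun (fixmap n (apply_bcontfun b))" for b :: "nat \<Rightarrow>\<^sub>C real"
  have F: "apply_bcontfun (F b) = fixmap n (apply_bcontfun b)" if "b \<in> K" for b
    unfolding F_def
    by (rule Bcontfun_inverse, rule bcontfun_normI[where b="1/2"])
       (use that memK fixmap_bound[OF assms] in auto)
  have "\<exists>!b\<in>K. F b = b"
  proof (rule Banach_fix[where c="1/2"])
    show "complete K" unfolding K_def by (rule complete_cball_bcontfun)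
    show "K \<noteq> {}" unfolding K_def by simp
    show "F ` K \<subseteq> K"
      using memK F fixmap_bound[OF assms] by auto
    fix b b' assume bb: "b \<in> K" "b' \<in> K"
    show "dist (F b) (F b') \<le> 1/2 * dist b b'"
    proof (rule dist_bound)
      fix m
      have "\<bar>apply_bcontfun b k - apply_bcontfun b' k\<bar> \<le> dist b b'" for k
        using dist_bounded[of b k b'] by (simp add: dist_real_def)
      then show "dist (apply_bcontfun (F b) m) (apply_bcontfun (F b') m) \<le> 1/2 * dist b b'"
        unfolding F[OF bb(1)] F[OF bb(2)] dist_real_def
        using fixmap_lipschitz[OF assms, of "apply_bcontfun b" "apply_bcontfun b'" "dist b b'" m] bb memK by simp
    qed
  qed auto
  then obtain b where b: "b \<in> K" "F b = b" by blast
  show thesis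
    by (rule that[of "apply_bcontfun b"]) (use b memK F[OF b(1)] in auto)
qed

lemma eigen_exists:
  assumes "\<And>m. damping n m * row_mass n m \<le> 1/12"
  shows "\<exists>x c. eigen x c \<and> \<bar>x - real n\<bar> \<le> 1/2"
proof -
  obtain b where b: "\<And>k. \<bar>b k\<bar> \<le> 1/2" "\<And>m. fixmap n b m = b m"
    using fixmap_fixpoint[OF assms] by blast
  have b1: "\<bar>b k\<bar> \<le> 1" for k using b(1)[of k] by linarith
  have "(real n + b n - real m) * trial n b m = t * ip (W m) (trial n b)" for m
  proof (cases "m = n")
    case True
    then show ?thesis using b(2)[of n] by (simp add: trial_def fixmap_def coupling_def)
  next
    case False
    let ?d = "real (ndist n m)"
    note d = denominator_bound[OF False b(1)[of n]]
    have p1: "?d powr (-3/4) * ?d powr (3/4) = 1" using False by (simp add: powr_add[symmetric])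
    have "b m = ?d powr (3/4) / (real n + b n - real m) * coupling n b m"
      using b(2)[of m] False by (simp add: fixmap_def)
    moreover have "real n + b n - real m \<noteq> 0" using d by auto
    ultimately have "(real n + b n - real m) * b m = ?d powr (3/4) * coupling n b m" by simp
    then have "(real n + b n - real m) * (?d powr (-3/4) * b m) = (?d powr (-3/4) * ?d powr (3/4)) * coupling n b m"
      by (metis mult.assoc mult.left_commute)
    then show ?thesis
      unfolding p1 using False by (simp add: trial_def coupling_def weight_def decay_def)
  qed
  moreover have "trial n b \<noteq> (\<lambda>_. 0)"
    by (metis trial_def zero_neq_one)
  ultimately have "eigen (real n + b n) (trial n b)"
    unfolding eigen_def using l2_trial[of b, OF b1] by blast
  then show ?thesis using b(1)[of n] by (intro exI[of _ "real n + b n"] exI[of _ "trial n b"]) simp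
qed

end

text \<open>L and \<kappa> depend on |t| alone, hence serve all n and both parity classes. L is
  taken large enough to make the damping of far rows and the tail of the weight small; only then is
  \<kappa> chosen in terms of L.\<close>

theorem eigen_exists_uniform:
  fixes t :: real
  shows "\<exists>(L::nat) \<kappa>::real. \<kappa> > 0 \<and> (\<forall>W n s. symmetric_perturbation W \<longrightarrow> \<bar>s\<bar> = \<bar>t\<bar> \<longrightarrow>
      (\<forall>m\<in>{n-L..n+L}. \<forall>k\<in>{n-L..n+L}. \<bar>s * W m k\<bar> \<le> \<kappa>) \<longrightarrow>
      (\<exists>x c. symmetric_perturbation.eigen W s x c \<and> \<bar>x - real n\<bar> \<le> 1/2))"
proof -
  have "(\<lambda>L. \<bar>t\<bar> * sqrt (2 * nsq (cutoff {0..L} decay))) \<longlonglongrightarrow> \<bar>t\<bar> * sqrt (2 * 0)"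
    by (intro tendsto_intros nsq_cutoff_tendsto_0 l2_decay)
  then have "\<forall>\<^sub>F L in sequentially. \<bar>t\<bar> * sqrt (2 * nsq (cutoff {0..L} decay)) < 1/24"
    by (rule order_tendstoD) simp
  moreover have "(\<lambda>L::nat. (real L + 1) powr (-1/4)) \<longlonglongrightarrow> 0" by real_asymp
  then have "(\<lambda>L::nat. (real L + 1) powr (-1/4) * (\<bar>t\<bar> * sqrt (1 + 2 * nsq decay))) \<longlonglongrightarrow> 0"
    by (rule tendsto_mult_left_zero)
  then have "\<forall>\<^sub>F L::nat in sequentially. (real L + 1) powr (-1/4) * (\<bar>t\<bar> * sqrt (1 + 2 * nsq decay)) < 1/12"
    by (rule order_tendstoD) simp
  ultimately have "\<forall>\<^sub>F L::nat in sequentially. \<bar>t\<bar> * sqrt (2 * nsq (cutoff {0..L} decay)) < 1/24 \<and>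
     (real L + 1) powr (-1/4) * (\<bar>t\<bar> * sqrt (1 + 2 * nsq decay)) < 1/12"
    by (rule eventually_conj)
  from eventually_happens'[OF sequentially_bot this] obtain L where L: "\<bar>t\<bar> * sqrt (2 * nsq (cutoff {0..L} decay)) < 1/24"
     "(real L + 1) powr (-1/4) * (\<bar>t\<bar> * sqrt (1 + 2 * nsq decay)) < 1/12"
    by blast
  \<comment> \<open>2L + 1 entries of size \<kappa> add up to 1/24; with a tail below 1/24 this
    gives the 1/12 that the contraction asks for.\<close>
  define \<kappa> where "\<kappa> = 1 / (24 * (2 * real L + 1))"
  show ?thesis
  proof (rule exI[of _ L], rule exI[of _ \<kappa>], intro conjI allI impI)
    show "\<kappa> > 0" unfolding \<kappa>_def by simp
    fix W n s assume W: "symmetric_perturbation W" and s: "\<bar>s\<bar> = \<bar>t\<bar>"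
      and \<kappa>: "\<forall>m\<in>{n-L..n+L}. \<forall>k\<in>{n-L..n+L}. \<bar>s * W m k\<bar> \<le> \<kappa>"
    interpret symmetric_perturbation W s by (rule W)
    have "damping n m * row_mass n m \<le> 1/12" for m
    proof (cases "m \<in> {n-L..n+L}")
      case True
      have "row_mass n m \<le> \<kappa> * (2 * real L + 1) + \<bar>t\<bar> * sqrt (2 * nsq (cutoff {0..L} decay))"
        using row_mass_bound_near[of n L m \<kappa>] bspec[OF \<kappa> True] s by simp
      also have "\<kappa> * (2 * real L + 1) = 1/24" unfolding \<kappa>_def by simp
      finally have m: "row_mass n m \<le> 1/12" using L(1) by linarith
      have "damping n m \<le> 1"
      proof (cases "m = n")
        case False
        then have "real (ndist n m) \<ge> 1" using denominator_bound(2)[of m n 0] by simp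
        then have "real (ndist n m) powr (-1/4) \<le> real (ndist n m) powr 0" by (intro powr_mono) auto
        then show ?thesis using False by (auto simp: damping_def)
      qed (simp add: damping_def)
      moreover have "row_mass n m \<ge> 0" using coupling_bound[of "\<lambda>_. 0" n m] by simp
      ultimately have "damping n m * row_mass n m \<le> 1 * row_mass n m" by (intro mult_right_mono)
      then show ?thesis using m by simp
    next
      case False
      then have "\<not> ndist n m \<le> L" unfolding ndist_le_iff .
      then have "real L + 1 \<le> real (ndist n m)" by linarith
      then have "real (ndist n m) powr (-1/4) \<le> (real L + 1) powr (-1/4)" by (intro powr_mono2') auto
      moreover have "m \<noteq> n" using False by auto
      ultimately have "damping n m * row_mass n m \<le> (real L + 1) powr (-1/4) * (\<bar>t\<bar> * sqrt (1 + 2 * nsq decay))"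
        using row_mass_bound[of n m] s coupling_bound[of "\<lambda>_. 0" n m] by (intro mult_mono) (auto simp: damping_def)
      then show ?thesis using L(2) by linarith
    qed
    then obtain x c where "eigen x c \<and> \<bar>x - real n\<bar> \<le> 1/2" using eigen_exists by blast
    then show "\<exists>x c. eigen x c \<and> \<bar>x - real n\<bar> \<le> 1/2" by blast
  qed
qed

section \<open>Asymptotics of the eigenvalues\<close>

lemma symmetric_perturbation_parity: "symmetric_perturbation (parity_mat g)"
proof -
  interpret orthogonal_matrix "parity_mat g" by (rule orthogonal_parity_mat)
  show ?thesis by unfold_locales (rule parity_mat_sym)
qed

lemma shifted_spectrum_iff:
  "x \<in> shifted_spectrum s \<Delta> g \<longleftrightarrow> (\<exists>c. symmetric_perturbation.eigen (parity_mat g) (s * \<Delta>) x c)"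
proof -
  interpret symmetric_perturbation "parity_mat g" "s * \<Delta>" by (rule symmetric_perturbation_parity)
  have "x \<in> shifted_spectrum s \<Delta> g \<longleftrightarrow> rabi_eigenvalue s \<Delta> g (x - g\<^sup>2)"
    unfolding shifted_spectrum_def by (auto simp: algebra_simps) (metis add_diff_cancel_left' diff_add_cancel)
  then show ?thesis
    unfolding rabi_eigenvalue_iff eigen_def by simp
qed

text \<open>The difference of the harmonic number and the logarithm decreases from its value 1 at n
  = 1.\<close>

lemma harm_le_ln: assumes "n \<ge> 1" "L \<le> n" shows "2 * harm L \<le> 2 + 2 * ln (real n)"
proof -
  obtain l where n: "n = Suc l" using assms(1) by (cases n) auto
  have "harm L \<le> (harm n :: real)" using assms(2) by (rule harm_mono)
  also have "harm n - ln (real n) \<le> harm (Suc 0) - ln (real (Suc 0))"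
    unfolding n using decseqD[OF decseq_harm_diff_ln, of 0 l] by simp
  then have "harm n \<le> 1 + ln (real n)" by (simp add: harm_def)
  finally show ?thesis by simp
qed

text \<open>Two indices of the strip differ by at most g sqrt n and are at least n/2, so they lie
  within 3 g sqrt j of each other, the window of \<open>disp_bulk\<close> for displacement 2g.
  Entries there are of order n^(-1/4).\<close>

lemma parity_mat_near_diagonal:
  assumes g: "g > 0"
  obtains C where "C > 0"
    and "\<forall>\<^sub>F n in sequentially. \<forall>m j. m \<in> {n - nat \<lfloor>g * sqrt (real n) / 2\<rfloor>..n + nat \<lfloor>g * sqrt (real n) / 2\<rfloor>} \<longrightarrow>
        j \<in> {n - nat \<lfloor>g * sqrt (real n) / 2\<rfloor>..n + nat \<lfloor>g * sqrt (real n) / 2\<rfloor>} \<longrightarrow>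
        \<bar>parity_mat g m j\<bar> \<le> sqrt (2 * C / sqrt (real n))"
proof -
  have "2 * g > 0" using g by simp
  from disp_bulk[OF this] obtain c C where C: "c > 0" "C > 0"
    and ev: "\<forall>\<^sub>F m in sequentially. \<forall>l. \<bar>real l - real m\<bar> \<le> 3/2 * (2 * g) * sqrt (real m) \<longrightarrow>
        c / sqrt (real m) \<le> (disp (2 * g) m l)\<^sup>2 + (disp (2 * g) m (l - 1))\<^sup>2 \<and>
        (disp (2 * g) m l)\<^sup>2 + (disp (2 * g) m (l - 1))\<^sup>2 \<le> C / sqrt (real m)"
    by blast
  from ev obtain M where M: "\<And>m l. m \<ge> M \<Longrightarrow> \<bar>real l - real m\<bar> \<le> 3/2 * (2 * g) * sqrt (real m) \<Longrightarrow>
        (disp (2 * g) m l)\<^sup>2 + (disp (2 * g) m (l - 1))\<^sup>2 \<le> C / sqrt (real m)"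
    unfolding eventually_sequentially by blast
  have "\<forall>\<^sub>F n::nat in sequentially. g * sqrt (real n) \<le> real n" using g by real_asymp
  moreover have "\<forall>\<^sub>F n in sequentially. n \<ge> 2 * M + 1" by (rule eventually_ge_at_top)
  ultimately have "\<forall>\<^sub>F n in sequentially. \<forall>m j. m \<in> {n - nat \<lfloor>g * sqrt (real n) / 2\<rfloor>..n + nat \<lfloor>g * sqrt (real n) / 2\<rfloor>} \<longrightarrow>
        j \<in> {n - nat \<lfloor>g * sqrt (real n) / 2\<rfloor>..n + nat \<lfloor>g * sqrt (real n) / 2\<rfloor>} \<longrightarrow>
        \<bar>parity_mat g m j\<bar> \<le> sqrt (2 * C / sqrt (real n))"
  proof eventually_elim
    case (elim n)
    define L where "L = nat \<lfloor>g * sqrt (real n) / 2\<rfloor>"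
    have L: "real L \<le> g * sqrt (real n) / 2" unfolding L_def using g by (intro of_nat_floor) simp
    show ?case unfolding L_def[symmetric]
    proof (intro allI impI)
      fix m j assume mj: "m \<in> {n-L..n+L}" "j \<in> {n-L..n+L}"
      have jn: "real j \<ge> real n - real L" "real m \<le> real n + real L" "real m \<ge> real n - real L" "real j \<le> real n + real L"
        using mj by auto
      then have j2: "real j \<ge> real n / 2" using L elim(1) by linarith
      then have jM: "j \<ge> M" using elim(2) by linarith
      have n0: "sqrt (real n) > 0" using elim(2) by simp
      have "sqrt (real n / 4) \<le> sqrt (real j)" using j2 by (intro real_sqrt_le_mono) linarith
      moreover have "sqrt (real n / 4) = sqrt (real n) / 2" by (simp add: real_sqrt_divide)
      ultimately have sj: "sqrt (real n) / 2 \<le> sqrt (real j)" by simp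
      have "\<bar>real m - real j\<bar> \<le> g * sqrt (real n)" using jn L by linarith
      also have "\<dots> \<le> g * (3 * sqrt (real j))"
        using sj n0 g by (intro mult_left_mono) (linarith | simp)+
      finally have "\<bar>real m - real j\<bar> \<le> 3/2 * (2 * g) * sqrt (real j)" by simp
      from M[OF jM this] have "(disp (2 * g) j m)\<^sup>2 \<le> C / sqrt (real j)"
        using zero_le_power2[of "disp (2 * g) j (m - 1)"] by linarith
      also have "\<dots> \<le> C / (sqrt (real n) / 2)"
      proof -
        have "sqrt (real j) > 0" using sj n0 by linarith
        then show ?thesis using sj n0 C by (intro divide_left_mono mult_pos_pos) auto
      qed
      finally have "(disp (2 * g) j m)\<^sup>2 \<le> 2 * C / sqrt (real n)" by (simp add: mult.commute)
      then have "\<bar>disp (2 * g) j m\<bar> \<le> sqrt (2 * C / sqrt (real n))" by (simp add: real_le_rsqrt)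
      then show "\<bar>parity_mat g m j\<bar> \<le> sqrt (2 * C / sqrt (real n))" by (simp add: parity_mat_eq abs_mult)
    qed
  qed
  with C(2) show thesis by (rule that)
qed

text \<open>With a strip of width of order sqrt n, \<kappa> is of order n^(-1/4) and H of order log
  n. So \<kappa> H tends to 0, which starts the localization; the second-order term \<kappa>^2 H is
  of order log n / sqrt n, and the terms from outside the strip are no larger.\<close>

theorem eigenvalue_asymptotics:
  fixes \<Delta> g :: real
  assumes \<Delta>: "\<Delta> > 0" and g: "g > 0"
  obtains K where "K > 0" and "\<forall>\<^sub>F n in sequentially. \<forall>s\<in>{1,-1}. \<exists>x.
    shifted_spectrum s \<Delta> g \<inter> {real n - 1/2..real n + 1/2} = {x} \<and>
    \<bar>x - real n - s * \<Delta> * ((-1) ^ n * disp (2 * g) n n)\<bar> \<le> K * ln (real n) / sqrt (real n)"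
proof -
  define strip where "strip n = nat \<lfloor>g * sqrt (real n) / 2\<rfloor>" for n
  obtain C where C: "C > 0" and near: "\<forall>\<^sub>F n in sequentially. \<forall>m j. m \<in> {n - strip n..n + strip n} \<longrightarrow>
        j \<in> {n - strip n..n + strip n} \<longrightarrow> \<bar>parity_mat g m j\<bar> \<le> sqrt (2 * C / sqrt (real n))"
    using parity_mat_near_diagonal[OF g] unfolding strip_def by blast
  obtain L0 \<kappa>0 where k0: "\<kappa>0 > 0" and ex: "\<forall>W n s. symmetric_perturbation W \<longrightarrow> \<bar>s\<bar> = \<bar>\<Delta>\<bar> \<longrightarrow>
      (\<forall>m\<in>{n-L0..n+L0}. \<forall>k\<in>{n-L0..n+L0}. \<bar>s * W m k\<bar> \<le> \<kappa>0) \<longrightarrow>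
      (\<exists>x c. symmetric_perturbation.eigen W s x c \<and> \<bar>x - real n\<bar> \<le> 1/2)"
    using eigen_exists_uniform[of \<Delta>] by (elim exE conjE)
  define \<kappa> where "\<kappa> n = \<Delta> * sqrt (2 * C / sqrt (real n))" for n :: nat
  define H where "H n = 2 + 2 * ln (real n)" for n :: nat
  \<comment> \<open>The error of \<open>eigen_localized\<close> with L + 1 replaced by its lower
    bound g sqrt n / 2.\<close>
  define E where "E n = 2 * \<kappa> n * H n * (2 * \<kappa> n + 12 * \<Delta>\<^sup>2 / (g * sqrt (real n))) + 6 * \<Delta>\<^sup>2 / (g * sqrt (real n))" for n :: nat
  have "E \<in> O(\<lambda>n. ln (real n) / sqrt (real n))"
    unfolding E_def \<kappa>_def H_def using \<Delta> g C by real_asymp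
  then obtain K where K: "K > 0" "\<forall>\<^sub>F n in sequentially. norm (E n) \<le> K * norm (ln (real n) / sqrt (real n))"
    by (elim landau_o.bigE)
  have "\<forall>\<^sub>F n in sequentially. n \<ge> (1::nat)" by (rule eventually_ge_at_top)
  moreover have "\<forall>\<^sub>F n::nat in sequentially. g * sqrt (real n) \<le> real n" using g by real_asymp
  moreover have "\<forall>\<^sub>F n::nat in sequentially. real L0 + 1 \<le> g * sqrt (real n) / 2" using g by real_asymp
  moreover have "(\<lambda>n. \<kappa> n) \<longlonglongrightarrow> 0" unfolding \<kappa>_def using \<Delta> C by real_asymp
  then have "\<forall>\<^sub>F n in sequentially. \<kappa> n < \<kappa>0" using k0 by (rule order_tendstoD)
  moreover have "(\<lambda>n. 4 * \<kappa> n * H n) \<longlonglongrightarrow> 0" unfolding \<kappa>_def H_def using \<Delta> C by real_asymp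
  then have "\<forall>\<^sub>F n in sequentially. 4 * \<kappa> n * H n < 1" by (rule order_tendstoD) simp
  moreover have "(\<lambda>n. 32 * H n * (\<kappa> n)\<^sup>2) \<longlonglongrightarrow> 0" unfolding \<kappa>_def H_def using \<Delta> C by real_asymp
  then have "\<forall>\<^sub>F n in sequentially. 32 * H n * (\<kappa> n)\<^sup>2 < 1/8" by (rule order_tendstoD) simp
  moreover have "(\<lambda>n. (128 * H n * \<Delta> ^ 4 + 4 * \<Delta>\<^sup>2) / (g * sqrt (real n) / 2)\<^sup>2) \<longlonglongrightarrow> 0"
    unfolding H_def using \<Delta> g by real_asymp
  then have "\<forall>\<^sub>F n in sequentially. (128 * H n * \<Delta> ^ 4 + 4 * \<Delta>\<^sup>2) / (g * sqrt (real n) / 2)\<^sup>2 < 1/16"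
    by (rule order_tendstoD) simp
  ultimately have "\<forall>\<^sub>F n in sequentially. \<forall>s\<in>{1,-1}. \<exists>x.
    shifted_spectrum s \<Delta> g \<inter> {real n - 1/2..real n + 1/2} = {x} \<and>
    \<bar>x - real n - s * \<Delta> * ((-1) ^ n * disp (2 * g) n n)\<bar> \<le> K * ln (real n) / sqrt (real n)"
    using near K(2)
  proof eventually_elim
    case (elim n)
    let ?L = "strip n"
    let ?I = "{n - ?L..n + ?L}"
    have n0: "sqrt (real n) > 0" using elim(1) by simp
    have Lle: "real ?L \<le> g * sqrt (real n) / 2" unfolding strip_def using g by (intro of_nat_floor) simp
    have Lge: "g * sqrt (real n) / 2 \<le> real ?L + 1" unfolding strip_def using g by linarith
    have Lp: "g * sqrt (real n) / 2 > 0" using g n0 by simp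
    have Ln: "?L \<le> n" using Lle elim(2) g n0 by linarith
    have L0: "L0 \<le> ?L" using Lge elim(3) by linarith
    have H0: "H n \<ge> 0" unfolding H_def using elim(1) by simp
    have \<kappa>n0: "\<kappa> n \<ge> 0" unfolding \<kappa>_def using \<Delta> C by simp
    show ?case
    proof
      fix s :: real assume "s \<in> {1,-1}"
      then have s: "\<bar>s\<bar> = 1" by auto
      define t where "t = s * \<Delta>"
      have t: "\<bar>t\<bar> = \<Delta>" "t\<^sup>2 = \<Delta>\<^sup>2" "t ^ 4 = \<Delta> ^ 4"
        using s \<Delta> \<open>s \<in> {1,-1}\<close> unfolding t_def by (auto simp: abs_mult)
      interpret P: symmetric_perturbation "parity_mat g" t by (rule symmetric_perturbation_parity)
      have spec: "x \<in> shifted_spectrum s \<Delta> g \<longleftrightarrow> (\<exists>c. P.eigen x c)" for x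
        unfolding shifted_spectrum_iff t_def ..
      have bd: "\<bar>t * parity_mat g m k\<bar> \<le> \<kappa> n" if "m \<in> ?I" "k \<in> ?I" for m k
        unfolding \<kappa>_def abs_mult t using elim(8) that \<Delta> by (intro mult_left_mono) auto
      have h3: "(128 * H n * t ^ 4 + 4 * t\<^sup>2) / (real ?L + 1)\<^sup>2 \<le> 1/16"
      proof -
        have "(g * sqrt (real n) / 2)\<^sup>2 \<le> (real ?L + 1)\<^sup>2" using Lge Lp by (intro power_mono) auto
        then have "(128 * H n * t ^ 4 + 4 * t\<^sup>2) / (real ?L + 1)\<^sup>2
            \<le> (128 * H n * t ^ 4 + 4 * t\<^sup>2) / (g * sqrt (real n) / 2)\<^sup>2"
          using Lp H0 \<Delta> unfolding t by (intro divide_left_mono mult_pos_pos zero_less_power) auto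
        then show ?thesis using elim(7) unfolding t by linarith
      qed
      note loc = P.eigen_localized[of _ _ n ?L "\<kappa> n" "H n", OF _ _ bd harm_le_ln[OF elim(1) Ln, folded H_def]
          less_imp_le[OF elim(5)] less_imp_le[OF elim(6)] h3]
      have "\<exists>x c. P.eigen x c \<and> \<bar>x - real n\<bar> \<le> 1/2"
      proof (rule ex[rule_format, OF symmetric_perturbation_parity])
        show "\<bar>t\<bar> = \<bar>\<Delta>\<bar>" using t \<Delta> by simp
        fix m k assume "m \<in> {n-L0..n+L0}" "k \<in> {n-L0..n+L0}"
        then have "m \<in> ?I" "k \<in> ?I" using L0 by auto
        from bd[OF this] show "\<bar>t * parity_mat g m k\<bar> \<le> \<kappa>0" using elim(4) by linarith
      qed
      then obtain x c where xc: "P.eigen x c" "\<bar>x - real n\<bar> \<le> 1/2" by blast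
      have win: "y \<in> {real n - 1/2..real n + 1/2} \<longleftrightarrow> \<bar>y - real n\<bar> \<le> 1/2" for y
        unfolding atLeastAtMost_iff by linarith
      have "shifted_spectrum s \<Delta> g \<inter> {real n - 1/2..real n + 1/2} = {x}"
      proof (intro equalityI subsetI)
        fix x' assume "x' \<in> shifted_spectrum s \<Delta> g \<inter> {real n - 1/2..real n + 1/2}"
        then obtain c' where xc': "P.eigen x' c'" "\<bar>x' - real n\<bar> \<le> 1/2" unfolding Int_iff spec win by blast
        have "x' = x"
          by (rule P.localized_unique[OF xc'(1) xc(1) loc(1)[OF xc'] loc(1)[OF xc] loc(2)[OF xc'] loc(2)[OF xc]])
        then show "x' \<in> {x}" by simp
      next
        fix x' assume "x' \<in> {x}"
        then show "x' \<in> shifted_spectrum s \<Delta> g \<inter> {real n - 1/2..real n + 1/2}"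
          using xc unfolding Int_iff spec win by blast
      qed
      moreover have "\<bar>x - real n - s * \<Delta> * ((-1) ^ n * disp (2 * g) n n)\<bar> \<le> K * ln (real n) / sqrt (real n)"
      proof -
        have q: "a / (real ?L + 1) \<le> 2 * a / (g * sqrt (real n))" if "a \<ge> 0" for a
        proof -
          have "a / (real ?L + 1) \<le> a / (g * sqrt (real n) / 2)"
            using Lge Lp that by (intro divide_left_mono) auto
          then show ?thesis by (simp add: mult.commute)
        qed
        have "\<bar>x - real n - t * parity_mat g n n\<bar>
            \<le> 2 * \<kappa> n * H n * (2 * \<kappa> n + 6 * t\<^sup>2 / (real ?L + 1)) + 3 * t\<^sup>2 / (real ?L + 1)"
          by (rule loc(3)[OF xc])
        also have "\<dots> \<le> E n"
          unfolding E_def using q[of "6 * t\<^sup>2"] q[of "3 * t\<^sup>2"] \<kappa>n0 H0 unfolding t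
          by (intro add_mono mult_left_mono) auto
        also have "\<dots> \<le> K * norm (ln (real n) / sqrt (real n))" using elim(9) by simp
        also have "\<dots> = K * ln (real n) / sqrt (real n)" using elim(1) by simp
        finally show ?thesis unfolding t_def parity_mat_eq .
      qed
      ultimately show "\<exists>x. shifted_spectrum s \<Delta> g \<inter> {real n - 1/2..real n + 1/2} = {x} \<and>
        \<bar>x - real n - s * \<Delta> * ((-1) ^ n * disp (2 * g) n n)\<bar> \<le> K * ln (real n) / sqrt (real n)" by blast
    qed
  qed
  with K(1) show thesis by (rule that)
qed

section \<open>Counting the exceptional integers\<close>

text \<open>A small y n forces |z n| to be at least \<gamma> n^(-1/4). As z drifts by only n^(-3/4)
  per step, it keeps its sign and half its size over \<eta> sqrt n steps, and y moves monotonically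
  meanwhile. Two near-zeros in that range are therefore no further apart than y needs to cross the
  threshold band.\<close>

lemma near_zeros_clustered:
  fixes y z :: "nat \<Rightarrow> real"
  assumes pos: "\<beta> > 0" "c > 0" "B \<ge> 0" "K > 0"
    and low: "\<forall>\<^sub>F n in sequentially. c / sqrt (real n) \<le> (y n)\<^sup>2 + (z n)\<^sup>2"
    and dy: "\<And>n. y (Suc n) - y n = \<beta> * z n / sqrt (real (Suc n))"
    and dz: "\<forall>\<^sub>F n in sequentially. \<bar>z (Suc n) - z n\<bar> \<le> B * real n powr (-3/4)"
  obtains \<eta> D N1 where "\<eta> > 0" "D \<ge> 0"
    "\<And>n n'. \<lbrakk>N1 \<le> n; n \<le> n'; real n' \<le> real n + \<eta> * sqrt (real n);
       \<bar>y n\<bar> \<le> K * ln (real n) / sqrt (real n); \<bar>y n'\<bar> \<le> K * ln (real n') / sqrt (real n')\<rbrakk>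
       \<Longrightarrow> real n' - real n \<le> D * real n powr (1/4) * ln (real n)"
proof -
  define \<gamma> where "\<gamma> = sqrt (c / 2)"
  have \<gamma>: "\<gamma> > 0" "\<gamma>\<^sup>2 = c / 2" unfolding \<gamma>_def using pos by auto
  \<comment> \<open>Over \<eta> sqrt n steps z moves by at most B \<eta> n^(-1/4), which must not
    exceed half of \<gamma> n^(-1/4); the cap 1 ensures n' \<le> 2n.\<close>
  define \<eta> where "\<eta> = min 1 (\<gamma> / (2 * (B + 1)))"
  have \<eta>: "\<eta> > 0" "\<eta> \<le> 1" unfolding \<eta>_def using \<gamma> pos by auto
  have "(B + 1) * \<eta> \<le> (B + 1) * (\<gamma> / (2 * (B + 1)))"
    unfolding \<eta>_def using pos by (intro mult_left_mono) auto
  also have "\<dots> = \<gamma> / 2" using pos by (simp add: field_simps)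
  finally have B\<eta>: "B * \<eta> \<le> \<gamma> / 2" using \<eta> by (simp add: algebra_simps)
  \<comment> \<open>12 is 3 times 4: y changes by at most 3 K ln n / sqrt n, since ln n' \<le> 2 ln
    n, and by at least (\<beta> \<gamma> / 4) n^(-3/4) in each step.\<close>
  define D where "D = 12 * K / (\<beta> * \<gamma>)"
  have D0: "D \<ge> 0" unfolding D_def using pos \<gamma> by simp
  have "\<forall>\<^sub>F n::nat in sequentially. (K * ln (real n) / sqrt (real n))\<^sup>2 < c / 2 / sqrt (real n)"
    using pos by real_asymp
  then have "\<forall>\<^sub>F n in sequentially. c / sqrt (real n) \<le> (y n)\<^sup>2 + (z n)\<^sup>2 \<and>
      \<bar>z (Suc n) - z n\<bar> \<le> B * real n powr (-3/4) \<and>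
      (K * ln (real n) / sqrt (real n))\<^sup>2 < c / 2 / sqrt (real n) \<and> n \<ge> 2"
    using low dz eventually_ge_at_top[of "2::nat"] by eventually_elim auto
  then obtain N1 where N1: "\<And>n. n \<ge> N1 \<Longrightarrow> c / sqrt (real n) \<le> (y n)\<^sup>2 + (z n)\<^sup>2"
      "\<And>n. n \<ge> N1 \<Longrightarrow> \<bar>z (Suc n) - z n\<bar> \<le> B * real n powr (-3/4)"
      "\<And>n. n \<ge> N1 \<Longrightarrow> (K * ln (real n) / sqrt (real n))\<^sup>2 < c / 2 / sqrt (real n)" "\<And>n. n \<ge> N1 \<Longrightarrow> n \<ge> 2"
    unfolding eventually_sequentially by blast
  show thesis
  proof (rule that[of \<eta> D N1])
    fix n n' assume n: "N1 \<le> n" "n \<le> n'" and n': "real n' \<le> real n + \<eta> * sqrt (real n)"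
      and y: "\<bar>y n\<bar> \<le> K * ln (real n) / sqrt (real n)" "\<bar>y n'\<bar> \<le> K * ln (real n') / sqrt (real n')"
    have n2: "real n \<ge> 2" using N1(4)[OF n(1)] by simp
    have sn: "sqrt (real n) > 0" "sqrt (real n) \<le> real n"
    proof -
      show "sqrt (real n) > 0" using n2 by simp
      have "real n \<le> real n * real n" using n2 by simp
      then show "sqrt (real n) \<le> real n" by (simp add: real_le_lsqrt power2_eq_square)
    qed
    have "\<eta> * sqrt (real n) \<le> 1 * sqrt (real n)" using \<eta> by (intro mult_right_mono) auto
    then have n'2: "real n' \<le> 2 * real n" using n' sn by linarith
    define u where "u = real n powr (-1/4)"
    have u0: "u > 0" unfolding u_def using n2 by simp
    have uu: "u\<^sup>2 = 1 / sqrt (real n)"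
      unfolding u_def power2_eq_square using n2
      by (simp add: powr_add[symmetric] powr_minus_divide powr_half_sqrt)
    have u3: "real n powr (-3/4) = u / sqrt (real n)"
      unfolding u_def using n2
      by (simp add: powr_half_sqrt[symmetric] powr_diff[symmetric])
    have "(y n)\<^sup>2 \<le> (K * ln (real n) / sqrt (real n))\<^sup>2" using y(1) by (metis abs_ge_zero power2_abs power_mono)
    then have "c / 2 / sqrt (real n) \<le> (z n)\<^sup>2" using N1(1,3)[OF n(1)] by simp
    then have "(\<gamma> * u)\<^sup>2 \<le> (z n)\<^sup>2" by (simp add: power_mult_distrib \<gamma> uu)
    then have zn: "\<gamma> * u \<le> \<bar>z n\<bar>" using \<gamma> u0 by (simp add: abs_le_square_iff[symmetric])
    \<comment> \<open>Multiplication by this sign treats increasing and decreasing y alike.\<close>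
    define \<sigma> where "\<sigma> = sgn (z n)"
    have \<sigma>: "\<sigma> * z n = \<bar>z n\<bar>" "\<bar>\<sigma>\<bar> \<le> 1" unfolding \<sigma>_def by (auto simp: sgn_if)
    have zi: "\<bar>z (n + i) - z n\<bar> \<le> real i * (B * (u / sqrt (real n)))" for i
    proof (induction i)
      case (Suc i)
      have "real (n + i) powr (-3/4) \<le> real n powr (-3/4)"
        using n2 by (intro powr_mono2') auto
      then have "B * real (n + i) powr (-3/4) \<le> B * (u / sqrt (real n))"
        unfolding u3 using pos by (intro mult_left_mono) auto
      with N1(2)[of "n + i"] n(1) have "\<bar>z (n + Suc i) - z (n + i)\<bar> \<le> B * (u / sqrt (real n))" by simp
      then have "\<bar>z (n + Suc i) - z n\<bar> \<le> real i * (B * (u / sqrt (real n))) + B * (u / sqrt (real n))"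
        using Suc by linarith
      moreover have "real (Suc i) * (B * (u / sqrt (real n))) = real i * (B * (u / sqrt (real n))) + B * (u / sqrt (real n))"
        by (simp add: distrib_right del: times_divide_eq_right)
      ultimately show ?case by (simp only:)
    qed simp
    have z_low: "\<sigma> * z (n + i) \<ge> \<gamma> / 2 * u" if "n + i \<le> n'" for i
    proof -
      have "real (n + i) \<le> real n'" using that by (simp only: of_nat_le_iff)
      then have "real i \<le> \<eta> * sqrt (real n)" using n' by simp
      then have "real i * (B * (u / sqrt (real n))) \<le> \<eta> * sqrt (real n) * (B * (u / sqrt (real n)))"
        using pos u0 sn by (intro mult_right_mono) auto
      also have "\<dots> = B * \<eta> * u" using sn by simp
      also have "\<dots> \<le> \<gamma> / 2 * u" using B\<eta> u0 by (intro mult_right_mono) auto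
      finally have "\<bar>z (n + i) - z n\<bar> \<le> \<gamma> / 2 * u" using zi[of i] by linarith
      then have "\<bar>\<sigma>\<bar> * \<bar>z (n + i) - z n\<bar> \<le> 1 * (\<gamma> / 2 * u)" using \<sigma>(2) by (intro mult_mono) auto
      then have "\<bar>\<sigma> * z (n + i) - \<sigma> * z n\<bar> \<le> \<gamma> / 2 * u" by (simp add: abs_mult[symmetric] right_diff_distrib)
      then show ?thesis using \<sigma>(1) zn by linarith
    qed
    have y_inc: "real i * (\<beta> * (\<gamma> / 4) * (u / sqrt (real n))) \<le> \<sigma> * (y (n + i) - y n)" if "n + i \<le> n'" for i
      using that
    proof (induction i)
      case (Suc i)
      have st: "\<beta> * (\<gamma> / 4) * (u / sqrt (real n)) \<le> \<sigma> * (y (n + Suc i) - y (n + i))"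
      proof -
        have "real (n + Suc i) \<le> real n'" using Suc.prems by (simp only: of_nat_le_iff)
        then have "real (Suc (n + i)) \<le> 2\<^sup>2 * real n" using n'2 n2 by simp
        then have "sqrt (real (Suc (n + i))) \<le> sqrt (2\<^sup>2 * real n)" by (rule real_sqrt_le_mono)
        then have q: "sqrt (real (Suc (n + i))) \<le> 2 * sqrt (real n)" by (simp add: real_sqrt_mult)
        have "\<beta> * (\<gamma> / 4) * (u / sqrt (real n)) = \<beta> * (\<gamma> / 2 * u) / (2 * sqrt (real n))" by simp
        also have "\<dots> \<le> \<beta> * (\<gamma> / 2 * u) / sqrt (real (Suc (n + i)))"
          using q pos \<gamma> u0 sn by (intro divide_left_mono) auto
        also have "\<dots> \<le> \<beta> * (\<sigma> * z (n + i)) / sqrt (real (Suc (n + i)))"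
          using z_low[of i] Suc.prems pos by (intro divide_right_mono mult_left_mono) auto
        also have "\<dots> = \<sigma> * (y (n + Suc i) - y (n + i))"
          using dy[of "n + i"] by simp
        finally show ?thesis .
      qed
      have "real (Suc i) * (\<beta> * (\<gamma> / 4) * (u / sqrt (real n)))
          = real i * (\<beta> * (\<gamma> / 4) * (u / sqrt (real n))) + \<beta> * (\<gamma> / 4) * (u / sqrt (real n))"
        by (simp add: distrib_right del: times_divide_eq_right)
      also have "\<dots> \<le> \<sigma> * (y (n + i) - y n) + \<sigma> * (y (n + Suc i) - y (n + i))"
        using st Suc.IH Suc.prems by (intro add_mono) auto
      also have "\<dots> = \<sigma> * (y (n + Suc i) - y n)" by (simp add: algebra_simps)
      finally show ?case .
    qed simp
    have "real (n' - n) * (\<beta> * (\<gamma> / 4) * (u / sqrt (real n))) \<le> \<sigma> * (y n' - y n)"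
      using y_inc[of "n' - n"] n(2) by simp
    also have "\<dots> \<le> \<bar>\<sigma>\<bar> * \<bar>y n' - y n\<bar>" unfolding abs_mult[symmetric] by simp
    also have "\<dots> \<le> 1 * \<bar>y n' - y n\<bar>" using \<sigma>(2) by (intro mult_right_mono) auto
    also have "\<dots> \<le> K * ln (real n') / sqrt (real n') + K * ln (real n) / sqrt (real n)"
    proof -
      have "a \<le> A \<Longrightarrow> b \<le> A' \<Longrightarrow> d \<le> b + a \<Longrightarrow> 1 * d \<le> A' + A" for a b d A A' :: real by simp
      from this[OF y abs_triangle_ineq4] show ?thesis .
    qed
    also have "K * ln (real n') / sqrt (real n') \<le> K * (2 * ln (real n)) / sqrt (real n)"
    proof (rule frac_le)
      have "real n' \<ge> 2" using n n2 by linarith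
      have "real n' \<le> real n * real n" using n'2 n2 mult_right_mono[of 2 "real n" "real n"] by linarith
      then have "ln (real n') \<le> ln (real n * real n)" using \<open>real n' \<ge> 2\<close> n2 by (subst ln_le_cancel_iff) auto
      also have "\<dots> = 2 * ln (real n)" using n2 by (simp add: ln_mult)
      finally show "K * ln (real n') \<le> K * (2 * ln (real n))" using pos by (intro mult_left_mono) auto
      show "0 \<le> K * (2 * ln (real n))" using pos n2 by simp
    qed (use sn n in auto)
    finally have "real (n' - n) * (\<beta> * (\<gamma> / 4) * (u / sqrt (real n))) \<le> 3 * K * ln (real n) / sqrt (real n)"
      by (simp add: add_divide_distrib[symmetric])
    then have "real (n' - n) * (\<beta> * (\<gamma> / 4) * u) / sqrt (real n) \<le> 3 * K * ln (real n) / sqrt (real n)" by simp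
    then have 1: "real (n' - n) * (\<beta> * (\<gamma> / 4) * u) \<le> 3 * K * ln (real n)"
      using sn by (simp only: divide_le_cancel)
    have "u * real n powr (1/4) = 1" unfolding u_def using n2 by (simp add: powr_add[symmetric])
    then have "real (n' - n) * (\<beta> * \<gamma> / 4) = real (n' - n) * (\<beta> * (\<gamma> / 4) * u) * real n powr (1/4)" by simp
    also have "\<dots> \<le> 3 * K * ln (real n) * real n powr (1/4)" using 1 by (rule mult_right_mono) simp
    finally have "real (n' - n) \<le> D * real n powr (1/4) * ln (real n)"
      unfolding D_def using pos \<gamma> by (simp add: field_simps)
    then show "real n' - real n \<le> D * real n powr (1/4) * ln (real n)" using n(2) by simp
  qed (use \<eta> D0 in auto)
qed

section \<open>From clusters to a count\<close>

lemma card_le_diameter: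
  fixes T :: "nat set"
  assumes "finite T" "d \<ge> 0" "\<And>a b. a \<in> T \<Longrightarrow> b \<in> T \<Longrightarrow> a \<le> b \<Longrightarrow> real b - real a \<le> d"
  shows "real (card T) \<le> d + 1"
proof (cases "T = {}")
  case False
  define a where "a = Min T"
  have a: "a \<in> T" "\<And>b. b \<in> T \<Longrightarrow> a \<le> b" unfolding a_def using assms(1) False by auto
  have "T \<subseteq> {a..a + nat \<lfloor>d\<rfloor>}"
  proof
    fix b assume b: "b \<in> T"
    have "real (b - a) \<le> d" using assms(3)[OF a(1) b a(2)[OF b]] a(2)[OF b] by simp
    then have "b - a \<le> nat \<lfloor>d\<rfloor>" by (simp add: le_nat_floor)
    then show "b \<in> {a..a + nat \<lfloor>d\<rfloor>}" using a(2)[OF b] by auto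
  qed
  then have "card T \<le> card {a..a + nat \<lfloor>d\<rfloor>}" by (intro card_mono) auto
  then have "real (card T) \<le> real (nat \<lfloor>d\<rfloor>) + 1" by simp
  then show ?thesis using assms(2) by (smt (verit) of_nat_floor)
qed (use assms in simp)

text \<open>Integers with the same floor of sqrt n / \<theta> form a block whose length is of order
  sqrt n, short enough for the cluster estimate; there are at most sqrt N / \<theta> + 1 blocks up
  to N.\<close>

lemma card_clustered:
  fixes B :: "nat set"
  assumes "\<eta> > 0" "D \<ge> 0"
    and B: "\<And>n n'. \<lbrakk>n \<in> B; n' \<in> B; n \<le> n'; real n' \<le> real n + \<eta> * sqrt (real n)\<rbrakk>
       \<Longrightarrow> real n' - real n \<le> D * real n powr (1/4) * ln (real n)"
    and B1: "\<And>n. n \<in> B \<Longrightarrow> n \<ge> 1" and N: "N \<ge> 1"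
  shows "real (card {n\<in>B. n \<le> N}) \<le> (sqrt (real N) / min 1 (\<eta> / 3) + 1) * (D * real N powr (1/4) * ln (real N) + 1)"
proof -
  \<comment> \<open>For a \<ge> 1 and \<theta> \<le> 1, (sqrt a + \<theta>)^2 - a is at most 3
    \<theta> sqrt a; hence the third of \<eta>.\<close>
  define \<theta> where "\<theta> = min 1 (\<eta> / 3)"
  have \<theta>: "\<theta> > 0" "\<theta> \<le> 1" "3 * \<theta> \<le> \<eta>" unfolding \<theta>_def using assms(1) by auto
  define blk where "blk n = nat \<lfloor>sqrt (real n) / \<theta>\<rfloor>" for n
  define T where "T k = {n\<in>B. n \<le> N \<and> blk n = k}" for k
  have lnN: "ln (real N) \<ge> 0" using N by simp
  have d0: "D * real N powr (1/4) * ln (real N) \<ge> 0" using assms(2) lnN by simp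
  have cT: "real (card (T k)) \<le> D * real N powr (1/4) * ln (real N) + 1" for k
  proof (rule card_le_diameter[OF _ d0])
    show "finite (T k)" unfolding T_def by (rule finite_subset[of _ "{..N}"]) auto
    fix a b assume a: "a \<in> T k" and b: "b \<in> T k" and ab: "a \<le> b"
    have aB: "a \<in> B" "b \<in> B" "a \<le> N" using a b unfolding T_def by auto
    have a1: "real a \<ge> 1" using B1[OF aB(1)] by simp
    have "nat \<lfloor>sqrt (real a) / \<theta>\<rfloor> = nat \<lfloor>sqrt (real b) / \<theta>\<rfloor>" using a b unfolding T_def blk_def by simp
    moreover have "sqrt (real a) / \<theta> \<ge> 0" "sqrt (real b) / \<theta> \<ge> 0" using \<theta> by auto
    ultimately have "sqrt (real b) / \<theta> - sqrt (real a) / \<theta> < 1" by linarith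
    then have st: "sqrt (real b) \<le> sqrt (real a) + \<theta>" using \<theta> by (simp add: field_simps)
    have "real b = (sqrt (real b))\<^sup>2" by simp
    also have "\<dots> \<le> (sqrt (real a) + \<theta>)\<^sup>2" using st by (intro power_mono) auto
    also have "\<dots> = real a + \<theta> * (2 * sqrt (real a) + \<theta>)" by (simp add: power2_eq_square algebra_simps)
    also have "\<dots> \<le> real a + \<theta> * (3 * sqrt (real a))"
    proof -
      have "1 \<le> sqrt (real a)" using a1 by simp
      then have "2 * sqrt (real a) + \<theta> \<le> 3 * sqrt (real a)" using \<theta> by linarith
      then show ?thesis using \<theta> by (intro add_left_mono mult_left_mono) auto
    qed
    also have "\<dots> \<le> real a + \<eta> * sqrt (real a)"
      using mult_right_mono[OF \<theta>(3), of "sqrt (real a)"] by simp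
    finally have "real b - real a \<le> D * real a powr (1/4) * ln (real a)" by (rule B[OF aB(1,2) ab])
    also have "\<dots> \<le> D * real N powr (1/4) * ln (real N)"
    proof (rule mult_mono)
      show "D * real a powr (1/4) \<le> D * real N powr (1/4)"
        using assms(2) aB(3) by (intro mult_left_mono powr_mono2) auto
      show "ln (real a) \<le> ln (real N)" using aB(3) a1 by (subst ln_le_cancel_iff) auto
    qed (use assms(2) a1 in auto)
    finally show "real b - real a \<le> D * real N powr (1/4) * ln (real N)" .
  qed
  have "{n\<in>B. n \<le> N} \<subseteq> (\<Union>k\<le>blk N. T k)"
  proof
    fix n assume "n \<in> {n\<in>B. n \<le> N}"
    moreover from this have "blk n \<le> blk N"
      unfolding blk_def using \<theta> by (intro nat_mono floor_mono divide_right_mono) auto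
    ultimately show "n \<in> (\<Union>k\<le>blk N. T k)" unfolding T_def by auto
  qed
  moreover have "finite (\<Union>k\<le>blk N. T k)"
    by (rule finite_subset[of _ "{..N}"]) (auto simp: T_def)
  ultimately have "card {n\<in>B. n \<le> N} \<le> card (\<Union>k\<le>blk N. T k)" by (rule card_mono[rotated])
  also have "\<dots> \<le> (\<Sum>k\<le>blk N. card (T k))" by (rule card_UN_le) simp
  finally have "real (card {n\<in>B. n \<le> N}) \<le> (\<Sum>k\<le>blk N. real (card (T k)))"
    by (simp only: of_nat_sum[symmetric] of_nat_le_iff)
  also have "\<dots> \<le> (\<Sum>k\<le>blk N. D * real N powr (1/4) * ln (real N) + 1)" by (intro sum_mono cT)
  also have "\<dots> = (real (blk N) + 1) * (D * real N powr (1/4) * ln (real N) + 1)"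
    by simp
  also have "\<dots> \<le> (sqrt (real N) / \<theta> + 1) * (D * real N powr (1/4) * ln (real N) + 1)"
  proof (rule mult_right_mono)
    have "real (blk N) \<le> sqrt (real N) / \<theta>" unfolding blk_def using \<theta> by (intro of_nat_floor) simp
    then show "real (blk N) + 1 \<le> sqrt (real N) / \<theta> + 1" by simp
  qed (use d0 in linarith)
  finally show ?thesis unfolding \<theta>_def .
qed

text \<open>The pattern at n is read off from the four integers n - 1, ..., n + 2, so an element of
  B spoils at most four values of n. Zero is listed apart, since 0 - 1 = 0 would be misread as its
  predecessor.\<close>

lemma card_neighbourhood_le:
  fixes B :: "nat set"
  shows "card {n \<in> {n. n < M \<or> n = 0 \<or> n - 1 \<in> B \<or> n \<in> B \<or> n + 1 \<in> B \<or> n + 2 \<in> B}. n \<le> N}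
    \<le> M + 1 + 4 * card {n\<in>B. n \<le> N + 2}"
proof -
  let ?B = "{n\<in>B. n \<le> N + 2}"
  have fB: "finite ?B" by (rule finite_subset[of _ "{..N+2}"]) auto
  have "{n \<in> {n. n < M \<or> n = 0 \<or> n - 1 \<in> B \<or> n \<in> B \<or> n + 1 \<in> B \<or> n + 2 \<in> B}. n \<le> N}
      \<subseteq> ({..<M} \<union> {0}) \<union> ((Suc ` ?B \<union> ?B) \<union> ((\<lambda>n. n - 1) ` ?B \<union> (\<lambda>n. n - 2) ` ?B))"
  proof (rule subsetI)
    fix n assume n: "n \<in> {n \<in> {n. n < M \<or> n = 0 \<or> n - 1 \<in> B \<or> n \<in> B \<or> n + 1 \<in> B \<or> n + 2 \<in> B}. n \<le> N}"
    have "n \<in> Suc ` ?B" if "n - 1 \<in> B" "n \<noteq> 0"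
      using n that by (intro image_eqI[of _ _ "n - 1"]) auto
    moreover have "n \<in> (\<lambda>n. n - 1) ` ?B" if "n + 1 \<in> B"
      using n that by (intro image_eqI[of _ _ "n + 1"]) auto
    moreover have "n \<in> (\<lambda>n. n - 2) ` ?B" if "n + 2 \<in> B"
      using n that by (intro image_eqI[of _ _ "n + 2"]) auto
    ultimately show "n \<in> ({..<M} \<union> {0}) \<union> ((Suc ` ?B \<union> ?B) \<union> ((\<lambda>n. n - 1) ` ?B \<union> (\<lambda>n. n - 2) ` ?B))"
      using n by auto
  qed
  then have "card {n \<in> {n. n < M \<or> n = 0 \<or> n - 1 \<in> B \<or> n \<in> B \<or> n + 1 \<in> B \<or> n + 2 \<in> B}. n \<le> N}
      \<le> card (({..<M} \<union> {0}) \<union> ((Suc ` ?B \<union> ?B) \<union> ((\<lambda>n. n - 1) ` ?B \<union> (\<lambda>n. n - 2) ` ?B)))"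
    using fB by (intro card_mono) auto
  also have "\<dots> \<le> (card {..<M} + card {0::nat}) + ((card (Suc ` ?B) + card ?B)
      + (card ((\<lambda>n. n - 1) ` ?B) + card ((\<lambda>n. n - 2) ` ?B)))"
    by (intro order_trans[OF card_Un_le] add_mono order_refl card_Un_le)
  also have "\<dots> \<le> (M + 1) + ((card ?B + card ?B) + (card ?B + card ?B))"
    using fB by (intro add_mono card_image_le) auto
  finally show ?thesis by simp
qed

lemma neighbourhood_count_bigo:
  fixes B :: "nat set"
  assumes "\<eta> > 0" "D \<ge> 0"
    and B: "\<And>n n'. \<lbrakk>n \<in> B; n' \<in> B; n \<le> n'; real n' \<le> real n + \<eta> * sqrt (real n)\<rbrakk>
       \<Longrightarrow> real n' - real n \<le> D * real n powr (1/4) * ln (real n)"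
    and B1: "\<And>n. n \<in> B \<Longrightarrow> n \<ge> 1" and "\<epsilon> > 0"
  shows "(\<lambda>N. real (card {n \<in> {n. n < M \<or> n = 0 \<or> n - 1 \<in> B \<or> n \<in> B \<or> n + 1 \<in> B \<or> n + 2 \<in> B}. n \<le> N}))
     \<in> O(\<lambda>N. real N powr (3/4 + \<epsilon>))"
proof -
  define \<theta> where "\<theta> = min 1 (\<eta> / 3)"
  have \<theta>: "\<theta> > 0" unfolding \<theta>_def using assms(1) by simp
  define m where "m = real M + 1"
  define F where "F N = m + 4 * ((sqrt (real N + 2) / \<theta> + 1) * (D * (real N + 2) powr (1/4) * ln (real N + 2) + 1))" for N :: nat
  \<comment> \<open>F grows like N^(3/4) log N when D > 0, and \<epsilon> absorbs the logarithm; for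
    D = 0 the leading term is a different one, hence the case split.\<close>
  have "F \<in> O(\<lambda>N. real N powr (3/4 + \<epsilon>))"
  proof (cases "D = 0")
    case True
    then show ?thesis unfolding F_def using \<theta> assms by simp real_asymp
  next
    case False
    then have "D > 0" using assms by simp
    then show ?thesis unfolding F_def using \<theta> assms by real_asymp
  qed
  moreover have "norm (real (card {n \<in> {n. n < M \<or> n = 0 \<or> n - 1 \<in> B \<or> n \<in> B \<or> n + 1 \<in> B \<or> n + 2 \<in> B}. n \<le> N})) \<le> norm (F N)" for N
  proof -
    have "real (card {n \<in> {n. n < M \<or> n = 0 \<or> n - 1 \<in> B \<or> n \<in> B \<or> n + 1 \<in> B \<or> n + 2 \<in> B}. n \<le> N})
        \<le> real (M + 1 + 4 * card {n\<in>B. n \<le> N + 2})"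
      by (intro of_nat_mono card_neighbourhood_le)
    also have "\<dots> \<le> F N"
    proof -
      have "real (card {n\<in>B. n \<le> N + 2})
          \<le> (sqrt (real (N + 2)) / \<theta> + 1) * (D * real (N + 2) powr (1/4) * ln (real (N + 2)) + 1)"
        unfolding \<theta>_def by (rule card_clustered[OF assms(1,2) B B1]) auto
      moreover have "real (N + 2) = real N + 2" by simp
      ultimately have "4 * real (card {n\<in>B. n \<le> N + 2})
          \<le> 4 * ((sqrt (real N + 2) / \<theta> + 1) * (D * (real N + 2) powr (1/4) * ln (real N + 2) + 1))"
        by (simp only:)
      then show ?thesis unfolding F_def m_def by simp
    qed
    finally show ?thesis by simp
  qed
  then have "(\<lambda>N. real (card {n \<in> {n. n < M \<or> n = 0 \<or> n - 1 \<in> B \<or> n \<in> B \<or> n + 1 \<in> B \<or> n + 2 \<in> B}. n \<le> N})) \<in> O(F)"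
    by (intro landau_o.big_mono always_eventually allI)
  ultimately show ?thesis by (rule landau_o.big_trans[rotated])
qed

section \<open>The interlacing pattern\<close>

text \<open>The windows around r and r + 1 meet at r + 1/2 and together cover the gap, so it holds
  only what the windows hold.\<close>

lemma two_in_gap:
  fixes X :: "real set"
  assumes "X \<inter> {r - 1/2..r + 1/2} = {a}" "X \<inter> {r + 1 - 1/2..r + 1 + 1/2} = {b}"
    and "r < a" "a < r + 1/2" "r + 1 - 1/2 < b" "b < r + 1"
  shows "X \<inter> {r..r + 1} = {a, b}" "X \<inter> {r<..<r + 1} = {a, b}" "a \<noteq> b"
proof -
  have ab: "a \<in> X" "b \<in> X" using assms(1,2) by auto
  have "x = a \<or> x = b" if "x \<in> X" "r \<le> x" "x \<le> r + 1" for x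
  proof (cases "x \<le> r + 1/2")
    case True
    then have "x \<in> X \<inter> {r - 1/2..r + 1/2}" using that by auto
    then show ?thesis unfolding assms(1) by simp
  next
    case False
    then have "x \<in> X \<inter> {r + 1 - 1/2..r + 1 + 1/2}" using that by auto
    then show ?thesis unfolding assms(2) by simp
  qed
  moreover have "r \<le> a" "a \<le> r + 1" "r \<le> b" "a < r + 1" "r < b" using assms(3-6) by linarith+
  ultimately show "X \<inter> {r..r + 1} = {a, b}" "X \<inter> {r<..<r + 1} = {a, b}" "a \<noteq> b"
    using ab assms(3-6) less_imp_le[of r] less_imp_le[of _ "r + 1"] by fastforce+
qed

lemma none_in_gap:
  fixes X :: "real set"
  assumes "X \<inter> {r - 1/2..r + 1/2} = {a}" "X \<inter> {r + 1 - 1/2..r + 1 + 1/2} = {b}" "a < r" "r + 1 < b"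
  shows "X \<inter> {r..r + 1} = {}"
proof -
  have "False" if "x \<in> X" "r \<le> x" "x \<le> r + 1" for x
  proof (cases "x \<le> r + 1/2")
    case True
    then have "x \<in> X \<inter> {r - 1/2..r + 1/2}" using that by auto
    then show ?thesis unfolding assms(1) using assms(3) that by simp
  next
    case False
    then have "x \<in> X \<inter> {r + 1 - 1/2..r + 1 + 1/2}" using that by auto
    then show ?thesis unfolding assms(2) using assms(4) that by simp
  qed
  then show ?thesis by auto
qed

text \<open>Strictness at r + 1/2 keeps the point out of the window around r + 1, so neighbouring
  windows never share a point.\<close>

definition right_of :: "real set \<Rightarrow> real \<Rightarrow> bool" where
  "right_of X r \<longleftrightarrow> (\<exists>x. X \<inter> {r - 1/2..r + 1/2} = {x} \<and> r < x \<and> x < r + 1/2)"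

definition left_of :: "real set \<Rightarrow> real \<Rightarrow> bool" where
  "left_of X r \<longleftrightarrow> (\<exists>x. X \<inter> {r - 1/2..r + 1/2} = {x} \<and> r - 1/2 < x \<and> x < r)"

lemma gap_right_left:
  assumes "right_of X r" "left_of X (r + 1)"
  shows "card (X \<inter> {r..r + 1}) = 2" "card (X \<inter> {r<..<r + 1}) = 2" "r \<notin> X" "r + 1 \<notin> X"
proof -
  obtain a b where ab: "X \<inter> {r - 1/2..r + 1/2} = {a}" "r < a" "a < r + 1/2"
      "X \<inter> {r + 1 - 1/2..r + 1 + 1/2} = {b}" "r + 1 - 1/2 < b" "b < r + 1"
    using assms unfolding right_of_def left_of_def by blast
  note gap = two_in_gap[OF ab(1,4,2,3,5,6)]
  show "card (X \<inter> {r..r + 1}) = 2" "card (X \<inter> {r<..<r + 1}) = 2" using gap by auto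
  have "r \<notin> {a, b}" "r + 1 \<notin> {a, b}" using ab by auto
  then show "r \<notin> X" "r + 1 \<notin> X" unfolding gap(1)[symmetric] by auto
qed

lemma gap_left_right:
  assumes "left_of X r" "right_of X (r + 1)"
  shows "X \<inter> {r..r + 1} = {}"
proof -
  obtain a b where ab: "X \<inter> {r - 1/2..r + 1/2} = {a}" "a < r"
      "X \<inter> {r + 1 - 1/2..r + 1 + 1/2} = {b}" "r + 1 < b"
    using assms unfolding right_of_def left_of_def by blast
  then show ?thesis by (intro none_in_gap)
qed

text \<open>X leans into the middle gap from both ends and away from the outer gaps, and Y does the
  opposite. Emptiness is established on closed gaps, which excludes the integers at their ends as
  well.\<close>

lemma two_pattern_of_sides:
  assumes X: "left_of X (r - 1)" "right_of X r" "left_of X (r + 1)" "right_of X (r + 2)"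
    and Y: "right_of Y (r - 1)" "left_of Y r" "right_of Y (r + 1)" "left_of Y (r + 2)"
  shows "two_pattern X Y r" and "\<forall>m\<in>{r - 1, r, r + 1}. m \<notin> X \<union> Y"
    and "card ((X \<union> Y) \<inter> {r..r + 1}) = 2"
proof -
  have X0: "X \<inter> {r - 1..r} = {}" using gap_left_right[of X "r - 1"] X by simp
  have X2: "X \<inter> {r + 1..r + 2} = {}" using gap_left_right[of X "r + 1"] X by (simp add: add.assoc)
  have Y1: "Y \<inter> {r..r + 1} = {}" using gap_left_right[OF Y(2,3)] .
  note X1 = gap_right_left[OF X(2,3)]
  have Y0: "card (Y \<inter> {r - 1<..<r}) = 2" "r - 1 \<notin> Y"
    using gap_right_left[of Y "r - 1"] Y by simp_all
  have Y2: "card (Y \<inter> {r + 1<..<r + 2}) = 2"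
    using gap_right_left(2)[of Y "r + 1"] Y by (simp add: add.assoc)
  have sub: "Z \<inter> {p..q} = {} \<Longrightarrow> Z \<inter> {p<..<q} = {}" for Z :: "real set" and p q
    using greaterThanLessThan_subseteq_atLeastAtMost_iff[of p q p q] by blast
  show "two_pattern X Y r"
    unfolding two_pattern_def using X1(2) Y0(1) Y2 sub[OF X0] sub[OF X2] sub[OF Y1] by blast
  show "\<forall>m\<in>{r - 1, r, r + 1}. m \<notin> X \<union> Y"
    using X0 X1(3,4) Y0(2) Y1 by auto
  have "(X \<union> Y) \<inter> {r..r + 1} = X \<inter> {r..r + 1}" using Y1 by blast
  then show "card ((X \<union> Y) \<inter> {r..r + 1}) = 2" using X1(1) by simp
qed

section \<open>Diagonal entries and their increments\<close>

lemma disp_diagonal_step: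
  "disp \<beta> (Suc n) (Suc n) - disp \<beta> n n = \<beta> * disp \<beta> n (Suc n) / sqrt (real (Suc n))"
proof -
  have "sqrt (real (Suc n)) * (disp \<beta> (Suc n) (Suc n) - disp \<beta> n n) = \<beta> * disp \<beta> n (Suc n)"
    using disp_raise[of n \<beta> "Suc n"] by (simp add: right_diff_distrib)
  then show ?thesis by (simp add: field_simps)
qed

text \<open>Raising at component n + 2: the two square roots differ by at most 1, so after division
  by sqrt (n + 1) the increment is smaller than the entries by a factor of order sqrt n.\<close>

lemma disp_offdiagonal_step:
  assumes "n \<ge> 1" "\<bar>disp \<beta> n (Suc n)\<bar> \<le> a" "\<bar>disp \<beta> n (Suc (Suc n))\<bar> \<le> a" "\<beta> > 0"
  shows "\<bar>disp \<beta> (Suc n) (Suc (Suc n)) - disp \<beta> n (Suc n)\<bar> \<le> (1 + \<beta>) * a / sqrt (real n)"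
proof -
  let ?p = "sqrt (real (Suc n))" and ?q = "sqrt (real (Suc (Suc n)))"
  have a0: "a \<ge> 0" using assms(2) by linarith
  have q: "0 \<le> ?q - ?p" "?q - ?p \<le> 1"
  proof -
    have "real (Suc (Suc n)) \<le> (?p + 1)\<^sup>2" by (simp add: power2_eq_square algebra_simps)
    then have "?q \<le> ?p + 1" by (intro real_le_lsqrt) simp_all
    then show "0 \<le> ?q - ?p" "?q - ?p \<le> 1" by simp_all
  qed
  have "?p * (disp \<beta> (Suc n) (Suc (Suc n)) - disp \<beta> n (Suc n))
      = (?q - ?p) * disp \<beta> n (Suc n) + \<beta> * disp \<beta> n (Suc (Suc n))"
    using disp_raise[of n \<beta> "Suc (Suc n)"] by (simp add: algebra_simps)
  then have "\<bar>?p * (disp \<beta> (Suc n) (Suc (Suc n)) - disp \<beta> n (Suc n))\<bar>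
      \<le> \<bar>(?q - ?p) * disp \<beta> n (Suc n)\<bar> + \<bar>\<beta> * disp \<beta> n (Suc (Suc n))\<bar>"
    by (simp only: abs_triangle_ineq)
  also have "\<dots> \<le> 1 * a + \<beta> * a"
    unfolding abs_mult using q assms a0 by (intro add_mono mult_mono) auto
  finally have "?p * \<bar>disp \<beta> (Suc n) (Suc (Suc n)) - disp \<beta> n (Suc n)\<bar> \<le> (1 + \<beta>) * a"
    by (simp add: abs_mult distrib_right)
  then have "\<bar>disp \<beta> (Suc n) (Suc (Suc n)) - disp \<beta> n (Suc n)\<bar> \<le> (1 + \<beta>) * a / ?p"
    by (simp add: field_simps)
  also have "\<dots> \<le> (1 + \<beta>) * a / sqrt (real n)"
    using a0 assms(1,4) by (intro divide_left_mono) auto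
  finally show ?thesis .
qed

text \<open>\<open>disp_bulk\<close> is read at l = n + 1 and l = n + 2. The pair (D_nn, D_{n,n+1})
  supplies both bounds, the next pair the entry that enters the increment of z.\<close>

lemma disp_diagonal_bounds:
  assumes \<beta>: "\<beta> > 0"
  obtains c C where "c > 0" "C > 0"
    "\<forall>\<^sub>F n in sequentially. c / sqrt (real n) \<le> (disp \<beta> n n)\<^sup>2 + (disp \<beta> n (Suc n))\<^sup>2"
    "\<forall>\<^sub>F n in sequentially. \<bar>disp \<beta> n n\<bar> \<le> sqrt C * real n powr (-1/4) \<and>
       \<bar>disp \<beta> n (Suc n)\<bar> \<le> sqrt C * real n powr (-1/4) \<and>
       \<bar>disp \<beta> (Suc n) (Suc (Suc n)) - disp \<beta> n (Suc n)\<bar> \<le> (1 + \<beta>) * sqrt C * real n powr (-3/4)"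
proof -
  obtain c C where C: "c > 0" "C > 0"
    and ev: "\<forall>\<^sub>F m in sequentially. \<forall>l. \<bar>real l - real m\<bar> \<le> 3/2 * \<beta> * sqrt (real m) \<longrightarrow>
        c / sqrt (real m) \<le> (disp \<beta> m l)\<^sup>2 + (disp \<beta> m (l - 1))\<^sup>2 \<and>
        (disp \<beta> m l)\<^sup>2 + (disp \<beta> m (l - 1))\<^sup>2 \<le> C / sqrt (real m)"
    using disp_bulk[OF \<beta>] by blast
  have "\<forall>\<^sub>F n::nat in sequentially. 2 \<le> 3/2 * \<beta> * sqrt (real n)" using \<beta> by real_asymp
  with ev eventually_ge_at_top[of "1::nat"]
  have main: "\<forall>\<^sub>F n in sequentially. c / sqrt (real n) \<le> (disp \<beta> n n)\<^sup>2 + (disp \<beta> n (Suc n))\<^sup>2 \<and>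
     (\<bar>disp \<beta> n n\<bar> \<le> sqrt C * real n powr (-1/4) \<and>
       \<bar>disp \<beta> n (Suc n)\<bar> \<le> sqrt C * real n powr (-1/4) \<and>
       \<bar>disp \<beta> (Suc n) (Suc (Suc n)) - disp \<beta> n (Suc n)\<bar> \<le> (1 + \<beta>) * sqrt C * real n powr (-3/4))"
  proof eventually_elim
    case (elim n)
    have b1: "c / sqrt (real n) \<le> (disp \<beta> n (Suc n))\<^sup>2 + (disp \<beta> n n)\<^sup>2"
      "(disp \<beta> n (Suc n))\<^sup>2 + (disp \<beta> n n)\<^sup>2 \<le> C / sqrt (real n)"
      using elim(1)[rule_format, of "Suc n"] elim(3) by simp_all
    have b2: "(disp \<beta> n (Suc (Suc n)))\<^sup>2 + (disp \<beta> n (Suc n))\<^sup>2 \<le> C / sqrt (real n)"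
      using elim(1)[rule_format, of "Suc (Suc n)"] elim(3) by simp
    have q: "sqrt (C / sqrt (real n)) = sqrt C * real n powr (-1/4)"
    proof -
      have "sqrt (C / sqrt (real n)) = sqrt C / (real n powr (1/2)) powr (1/2)"
        using elim(2) by (simp add: real_sqrt_divide powr_half_sqrt)
      then show ?thesis using elim(2) by (simp add: powr_powr powr_minus_divide)
    qed
    have le: "\<bar>v\<bar> \<le> sqrt C * real n powr (-1/4)" if "v\<^sup>2 \<le> C / sqrt (real n)" for v
      unfolding q[symmetric] using that by (simp add: real_le_rsqrt)
    have y: "\<bar>disp \<beta> n n\<bar> \<le> sqrt C * real n powr (-1/4)"
      by (rule le) (use b1 zero_le_power2[of "disp \<beta> n (Suc n)"] in linarith)
    have z: "\<bar>disp \<beta> n (Suc n)\<bar> \<le> sqrt C * real n powr (-1/4)"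
      by (rule le) (use b1 zero_le_power2[of "disp \<beta> n n"] in linarith)
    have w: "\<bar>disp \<beta> n (Suc (Suc n))\<bar> \<le> sqrt C * real n powr (-1/4)"
      by (rule le) (use b2 zero_le_power2[of "disp \<beta> n (Suc n)"] in linarith)
    have "real n powr (-1/4) / sqrt (real n) = real n powr (-3/4)"
      using elim(2) by (simp add: powr_half_sqrt[symmetric] powr_diff[symmetric])
    then have "(1 + \<beta>) * (sqrt C * real n powr (-1/4)) / sqrt (real n) = (1 + \<beta>) * sqrt C * real n powr (-3/4)"
      by (simp only: times_divide_eq_right[symmetric] mult.assoc)
    with disp_offdiagonal_step[OF elim(2) z w \<beta>] y z b1(1) show ?case by simp
  qed
  show thesis
    by (rule that[OF C]) (use main in \<open>auto elim: eventually_mono\<close>)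
qed

text \<open>v is the first-order shift: it decides the side once it exceeds the error e, and the
  last hypothesis keeps the eigenvalue off the ends of the window.\<close>

lemma side_of_eigenvalue:
  assumes "X \<inter> {r - 1/2..r + 1/2} = {x}" "\<bar>x - r - v\<bar> \<le> e" "e < \<bar>v\<bar>" "\<bar>v\<bar> + e < 1/2"
  shows "v > 0 \<Longrightarrow> right_of X r" "v < 0 \<Longrightarrow> left_of X r"
proof -
  assume "v > 0"
  then have "r < x" "x < r + 1/2" using assms(2-4) by linarith+
  then show "right_of X r" unfolding right_of_def using assms(1) by blast
next
  assume "v < 0"
  then have "r - 1/2 < x" "x < r" using assms(2-4) by linarith+
  then show "left_of X r" unfolding left_of_def using assms(1) by blast
qed

theorem theorem1p1:
  fixes \<Delta> g :: real
  assumes "\<Delta> > 0" and "g > 0"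
  shows "\<exists>S :: nat set.
     (\<forall>\<epsilon>>0. (\<lambda>N. real (card {n\<in>S. n \<le> N})) \<in> O(\<lambda>N. real N powr (3/4 + \<epsilon>))) \<and>
     (\<forall>n. n \<ge> 1 \<and> n \<notin> S \<longrightarrow>
        (let Xp = shifted_spectrum 1 \<Delta> g; Xm = shifted_spectrum (-1) \<Delta> g; x = real n in
          (two_pattern Xp Xm x \<or> two_pattern Xm Xp x) \<and>
          (\<forall>m\<in>{x-1, x, x+1}. m \<notin> Xp \<union> Xm) \<and>
          card ((Xp \<union> Xm) \<inter> {x..x+1}) = 2))"
proof -
  define y where "y n = disp (2 * g) n n" for n
  define z where "z n = disp (2 * g) n (Suc n)" for n
  define X where "X s = shifted_spectrum s \<Delta> g" for s
  have \<beta>: "2 * g > 0" using assms by simp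
  obtain c C where C: "c > 0" "C > 0"
    and low: "\<forall>\<^sub>F n in sequentially. c / sqrt (real n) \<le> (y n)\<^sup>2 + (z n)\<^sup>2"
    and up: "\<forall>\<^sub>F n in sequentially. \<bar>y n\<bar> \<le> sqrt C * real n powr (-1/4) \<and>
       \<bar>z n\<bar> \<le> sqrt C * real n powr (-1/4) \<and>
       \<bar>z (Suc n) - z n\<bar> \<le> (1 + 2 * g) * sqrt C * real n powr (-3/4)"
    unfolding y_def z_def using disp_diagonal_bounds[OF \<beta>] by blast
  obtain K0 where K0: "K0 > 0" and asym: "\<forall>\<^sub>F n in sequentially. \<forall>s\<in>{1,-1}. \<exists>x.
    X s \<inter> {real n - 1/2..real n + 1/2} = {x} \<and>
    \<bar>x - real n - s * \<Delta> * ((-1) ^ n * y n)\<bar> \<le> K0 * ln (real n) / sqrt (real n)"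
    unfolding X_def y_def using eigenvalue_asymptotics[OF assms] by blast
  \<comment> \<open>The shift \<Delta> |y n| has to exceed the error K0 ln n / sqrt n; division by
    \<Delta> gives the threshold for |y n|.\<close>
  define K where "K = K0 / \<Delta>"
  have K: "K > 0" unfolding K_def using K0 assms by simp
  have dy: "y (Suc n) - y n = 2 * g * z n / sqrt (real (Suc n))" for n
    unfolding y_def z_def by (rule disp_diagonal_step)
  have dz: "\<forall>\<^sub>F n in sequentially. \<bar>z (Suc n) - z n\<bar> \<le> ((1 + 2 * g) * sqrt C) * real n powr (-3/4)"
    using up by eventually_elim simp
  have B0: "(1 + 2 * g) * sqrt C \<ge> 0" using C assms by simp
  obtain \<eta> D N1 where \<eta>: "\<eta> > 0" "D \<ge> 0"
    and cluster: "\<And>n n'. \<lbrakk>N1 \<le> n; n \<le> n'; real n' \<le> real n + \<eta> * sqrt (real n);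
       \<bar>y n\<bar> \<le> K * ln (real n) / sqrt (real n); \<bar>y n'\<bar> \<le> K * ln (real n') / sqrt (real n')\<rbrakk>
       \<Longrightarrow> real n' - real n \<le> D * real n powr (1/4) * ln (real n)"
    using near_zeros_clustered[OF \<beta> C(1) B0 K low dy dz] by blast
  have "\<forall>\<^sub>F n::nat in sequentially. \<Delta> * (sqrt C * real n powr (-1/4)) + K0 * ln (real n) / sqrt (real n) < 1/2"
  proof -
    have "(\<lambda>n::nat. \<Delta> * (sqrt C * real n powr (-1/4)) + K0 * ln (real n) / sqrt (real n)) \<longlonglongrightarrow> 0"
      using K0 assms C by real_asymp
    then show ?thesis by (rule order_tendstoD) simp
  qed
  \<comment> \<open>Increments of y are of order n^(-3/4), below the threshold n^(-1/2) log n, so y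
    cannot change sign in a step that starts above the threshold.\<close>
  moreover have "\<forall>\<^sub>F n::nat in sequentially. 2 * g * (sqrt C * real n powr (-1/4)) / sqrt (real n) < K * ln (real n) / sqrt (real n)"
    using K assms C by real_asymp
  ultimately have "\<forall>\<^sub>F n in sequentially.
      (\<forall>s\<in>{1,-1}. \<exists>x. X s \<inter> {real n - 1/2..real n + 1/2} = {x} \<and>
         \<bar>x - real n - s * \<Delta> * ((-1) ^ n * y n)\<bar> \<le> K0 * ln (real n) / sqrt (real n)) \<and>
      \<Delta> * \<bar>y n\<bar> + K0 * ln (real n) / sqrt (real n) < 1/2 \<and>
      \<bar>y (Suc n) - y n\<bar> < K * ln (real n) / sqrt (real n)"
    using asym up eventually_ge_at_top[of "1::nat"]
  proof eventually_elim
    case (elim n)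
    have "\<Delta> * \<bar>y n\<bar> \<le> \<Delta> * (sqrt C * real n powr (-1/4))"
      using elim(4) assms by (intro mult_left_mono) auto
    moreover have "\<bar>y (Suc n) - y n\<bar> \<le> 2 * g * (sqrt C * real n powr (-1/4)) / sqrt (real n)"
    proof -
      have "\<bar>y (Suc n) - y n\<bar> = 2 * g * \<bar>z n\<bar> / sqrt (real (Suc n))"
        unfolding dy using assms by (simp add: abs_mult)
      also have "\<dots> \<le> 2 * g * (sqrt C * real n powr (-1/4)) / sqrt (real n)"
        using elim(4,5) assms C by (intro frac_le mult_left_mono) auto
      finally show ?thesis .
    qed
    ultimately show ?case using elim by linarith
  qed
  then obtain M where M: "\<And>n s. n \<ge> M \<Longrightarrow> s \<in> {1,-1} \<Longrightarrow> \<exists>x. X s \<inter> {real n - 1/2..real n + 1/2} = {x} \<and>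
         \<bar>x - real n - s * \<Delta> * ((-1) ^ n * y n)\<bar> \<le> K0 * ln (real n) / sqrt (real n)"
    "\<And>n. n \<ge> M \<Longrightarrow> \<Delta> * \<bar>y n\<bar> + K0 * ln (real n) / sqrt (real n) < 1/2"
    "\<And>n. n \<ge> M \<Longrightarrow> \<bar>y (Suc n) - y n\<bar> < K * ln (real n) / sqrt (real n)"
    unfolding eventually_sequentially by blast
  define B where "B = {n. n \<ge> Suc (max M N1) \<and> \<bar>y n\<bar> \<le> K * ln (real n) / sqrt (real n)}"
  \<comment> \<open>The offset 2 leaves n - 1 \<ge> \<open>Suc (max M N1)\<close>, so for each of
    the four integers not being in B means being above the threshold.\<close>
  define S where "S = {n. n < max M N1 + 2 \<or> n = 0 \<or> n - 1 \<in> B \<or> n \<in> B \<or> n + 1 \<in> B \<or> n + 2 \<in> B}"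
  have "(\<lambda>N. real (card {n\<in>S. n \<le> N})) \<in> O(\<lambda>N. real N powr (3/4 + \<epsilon>))" if "\<epsilon> > 0" for \<epsilon> :: real
    unfolding S_def
  proof (rule neighbourhood_count_bigo[OF \<eta> _ _ that])
    fix n n' assume "n \<in> B" "n' \<in> B" "n \<le> n'" "real n' \<le> real n + \<eta> * sqrt (real n)"
    then show "real n' - real n \<le> D * real n powr (1/4) * ln (real n)"
      unfolding B_def by (intro cluster) auto
  qed (simp add: B_def)
  moreover have "(two_pattern (X 1) (X (-1)) (real n) \<or> two_pattern (X (-1)) (X 1) (real n)) \<and>
      (\<forall>m\<in>{real n - 1, real n, real n + 1}. m \<notin> X 1 \<union> X (-1)) \<and>
      card ((X 1 \<union> X (-1)) \<inter> {real n..real n + 1}) = 2" if n: "n \<notin> S" for n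
  proof -
    have n2: "n \<ge> max M N1 + 2" using n unfolding S_def by auto
    \<comment> \<open>The sign of \<tau> is that of the shift in the class s = 1, and the opposite
      one for s = -1; as y keeps its sign, \<tau> alternates.\<close>
    define \<tau> where "\<tau> m = (-1) ^ m * y m" for m
    have large: "K * ln (real m) / sqrt (real m) < \<bar>y m\<bar>" if "m \<in> {n - 1, n, n + 1, n + 2}" for m
    proof -
      have "m \<notin> B" "m \<ge> Suc (max M N1)" using that n n2 unfolding S_def by auto
      then show ?thesis unfolding B_def by auto
    qed
    have side: "s * \<tau> m > 0 \<Longrightarrow> right_of (X s) (real m)" "s * \<tau> m < 0 \<Longrightarrow> left_of (X s) (real m)"
      if m: "m \<in> {n - 1, n, n + 1, n + 2}" and s: "s \<in> {1,-1}" for m s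
    proof -
      have mM: "m \<ge> M" using m n2 by auto
      obtain x where x: "X s \<inter> {real m - 1/2..real m + 1/2} = {x}"
         "\<bar>x - real m - s * \<Delta> * ((-1) ^ m * y m)\<bar> \<le> K0 * ln (real m) / sqrt (real m)"
        using M(1)[OF mM s] by blast
      have "\<bar>s * \<Delta> * ((-1) ^ m * y m)\<bar> = \<Delta> * \<bar>y m\<bar>"
        using s assms by (auto simp: abs_mult)
      moreover have "K0 * ln (real m) / sqrt (real m) < \<Delta> * \<bar>y m\<bar>"
        using mult_strict_left_mono[OF large[OF m] assms(1)] assms(1) unfolding K_def by simp
      ultimately have v: "K0 * ln (real m) / sqrt (real m) < \<bar>s * \<Delta> * ((-1) ^ m * y m)\<bar>"
        "\<bar>s * \<Delta> * ((-1) ^ m * y m)\<bar> + K0 * ln (real m) / sqrt (real m) < 1/2"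
        using M(2)[OF mM] by linarith+
      have e: "s * \<Delta> * ((-1) ^ m * y m) = \<Delta> * (s * \<tau> m)" unfolding \<tau>_def by simp
      show "s * \<tau> m > 0 \<Longrightarrow> right_of (X s) (real m)" "s * \<tau> m < 0 \<Longrightarrow> left_of (X s) (real m)"
        using side_of_eigenvalue[OF x v] assms(1) unfolding e
        by (auto simp: zero_less_mult_iff mult_less_0_iff)
    qed
    have flip: "(\<tau> (Suc m) > 0 \<longleftrightarrow> \<tau> m < 0) \<and> (\<tau> (Suc m) < 0 \<longleftrightarrow> \<tau> m > 0)"
      if "m \<in> {n - 1, n, n + 1}" for m
    proof -
      have "m \<ge> M" "m \<in> {n - 1, n, n + 1, n + 2}" using that n2 by auto
      then have "\<bar>y (Suc m) - y m\<bar> < \<bar>y m\<bar>" using M(3)[of m] large[of m] by linarith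
      then have "(y (Suc m) > 0 \<longleftrightarrow> y m > 0) \<and> (y (Suc m) < 0 \<longleftrightarrow> y m < 0)" by linarith
      then show ?thesis unfolding \<tau>_def by (cases "even m") auto
    qed
    have nm: "Suc (n - 1) = n" "real (n - 1) = real n - 1" "real (n + 1) = real n + 1" "real (n + 2) = real n + 2"
      using n2 by auto
    have "\<tau> n \<noteq> 0"
    proof -
      have "n \<ge> 1" using n2 by simp
      then have "K * ln (real n) / sqrt (real n) \<ge> 0" using K by simp
      then show ?thesis using large[of n] unfolding \<tau>_def by auto
    qed
    then consider "\<tau> n > 0" | "\<tau> n < 0" by linarith
    then show ?thesis
    proof cases
      case 1
      then have t: "\<tau> (n - 1) < 0" "\<tau> (n + 1) < 0" "\<tau> (n + 2) > 0"
        using flip[of "n - 1"] flip[of n] flip[of "n + 1"] nm(1) by auto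
      have "left_of (X 1) (real n - 1)" "right_of (X 1) (real n)" "left_of (X 1) (real n + 1)" "right_of (X 1) (real n + 2)"
        "right_of (X (-1)) (real n - 1)" "left_of (X (-1)) (real n)" "right_of (X (-1)) (real n + 1)" "left_of (X (-1)) (real n + 2)"
        using side[of "n - 1" 1] side[of n 1] side[of "n + 1" 1] side[of "n + 2" 1]
          side[of "n - 1" "-1"] side[of n "-1"] side[of "n + 1" "-1"] side[of "n + 2" "-1"] t 1
        unfolding nm by auto
      from two_pattern_of_sides[OF this] show ?thesis by blast
    next
      case 2
      then have t: "\<tau> (n - 1) > 0" "\<tau> (n + 1) > 0" "\<tau> (n + 2) < 0"
        using flip[of "n - 1"] flip[of n] flip[of "n + 1"] nm(1) by auto
      have "left_of (X (-1)) (real n - 1)" "right_of (X (-1)) (real n)" "left_of (X (-1)) (real n + 1)" "right_of (X (-1)) (real n + 2)"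
        "right_of (X 1) (real n - 1)" "left_of (X 1) (real n)" "right_of (X 1) (real n + 1)" "left_of (X 1) (real n + 2)"
        using side[of "n - 1" 1] side[of n 1] side[of "n + 1" 1] side[of "n + 2" 1]
          side[of "n - 1" "-1"] side[of n "-1"] side[of "n + 1" "-1"] side[of "n + 2" "-1"] t 2
        unfolding nm by auto
      from two_pattern_of_sides[OF this] show ?thesis by (simp add: Un_commute)
    qed
  qed
  ultimately show ?thesis
    unfolding X_def Let_def by (intro exI[of _ S]) blast
qed

end
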